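(* For operator spaces $X$ and $Y$, the natural embedding $\psi: X^*\otimes^{s'}Y^*\to SB(X\times Y,\mathbb{C})$, determined by $\psi(f\otimes g)(x,y)=f(x)g(y)$ for $f\in X^*$, $g\in Y^*$, $x\in X$, $y\in Y$, is isometric.
   Context: An operator space is a closed subspace of $B(H)$ with the inherited matrix norms; the dual $V^*$ of an operator space $V$ has the standard operator space structure $M_p(V^* )=CB(V,M_p)$, and $M_p(V^* )_1$ denotes its closed unit ball. For operator spaces $V,W$ and $f\in CB(V,M_p)$, $g\in CB(W,M_p)$, $f\bar\circ g:V\otimes W\to M_p$ is the linear map with $(f\bar\circ g)(v\otimes w)=f(v)\circ g(w)$, where here $\circ$ is the entrywise (schur) product of matrices. For $u\in M_n(V\otimes W)$, $\|u\|_{s'}=\sup\{\|(f\bar\circ g)_n(u)\|: f\in M_p(V^* )_1,\ g\in M_p(W^* )_1,\ p\in\mathbb{N}\}$, where $(f\bar\circ g)_n$ is the $n$-th amplification. $V\otimes^{s'}W$ is the completion of $V\otimes W$ in $\|\cdot\|_{s'}$. $SB(V\times W,\mathbb{C})$ is the space of bilinear forms $\varphi:V\times W\to\mathbb{C}$ with $\|\varphi\|_{sb}=\sup\{\|[\varphi(v_{ij},w_{ij})]\|_{M_n}:\|[v_{ij}]\|_{M_n(V)}\le1,\|[w_{ij}]\|_{M_n(W)}\le1,n\in\mathbb{N}\}<\infty$, with norm $\|\cdot\|_{sb}$. *)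

theory Defs
  imports "HOL-Analysis.Analysis" "HOL-Library.Function_Algebras"
begin

section \<open>Complex vector spaces and complex Hilbert spaces\<close>

class complex_vector = ab_group_add +
  fixes scaleC :: "complex \<Rightarrow> 'a \<Rightarrow> 'a" (infixr "*\<^sub>C" 75)
  assumes scaleC_add_right: "a *\<^sub>C (x + y) = a *\<^sub>C x + a *\<^sub>C y"
    and scaleC_add_left: "(a + b) *\<^sub>C x = a *\<^sub>C x + b *\<^sub>C x"
    and scaleC_scaleC: "a *\<^sub>C b *\<^sub>C x = (a * b) *\<^sub>C x"
    and scaleC_one: "1 *\<^sub>C x = x"

global_interpretation complex_vector: vector_space
    "scaleC :: complex \<Rightarrow> 'a \<Rightarrow> 'a::complex_vector"
  defines csubspace_raw_def: csubspace = "module.subspace (scaleC :: complex \<Rightarrow> 'a \<Rightarrow> 'a)"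
    and cspan_raw_def: cspan = "module.span (scaleC :: complex \<Rightarrow> 'a \<Rightarrow> 'a)"
  by unfold_locales
    (simp_all add: scaleC_add_right scaleC_add_left scaleC_scaleC scaleC_one)

class complex_normed_vector = complex_vector + real_normed_vector +
  assumes scaleR_scaleC: "r *\<^sub>R x = complex_of_real r *\<^sub>C x"
    and norm_scaleC: "norm (a *\<^sub>C x) = cmod a * norm x"

class complex_hilbert = complex_normed_vector + banach +
  fixes cinner :: "'a \<Rightarrow> 'a \<Rightarrow> complex"
  assumes cinner_commute: "cinner x y = cnj (cinner y x)"
    and cinner_add_right: "cinner x (y + z) = cinner x y + cinner x z"
    and cinner_scaleC_right: "cinner x (a *\<^sub>C y) = a * cinner x y"
    and norm_eq_sqrt_cinner: "norm x = sqrt (Re (cinner x x))"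

instantiation complex :: complex_hilbert
begin
definition scaleC_complex :: "complex \<Rightarrow> complex \<Rightarrow> complex"
  where "scaleC_complex a x = a * x"
definition cinner_complex :: "complex \<Rightarrow> complex \<Rightarrow> complex"
  where "cinner_complex x y = cnj x * y"
instance
proof
  fix a b x y z :: complex and r :: real
  show "a *\<^sub>C (x + y) = a *\<^sub>C x + a *\<^sub>C y" "(a + b) *\<^sub>C x = a *\<^sub>C x + b *\<^sub>C x"
    "a *\<^sub>C b *\<^sub>C x = (a * b) *\<^sub>C x" "1 *\<^sub>C x = x"
    "r *\<^sub>R x = complex_of_real r *\<^sub>C x" "norm (a *\<^sub>C x) = cmod a * norm x"
    by (simp_all add: scaleC_complex_def ring_distribs norm_mult scaleR_conv_of_real)
  show "cinner x y = cnj (cinner y x)" "cinner x (y + z) = cinner x y + cinner x z"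
    "cinner x (a *\<^sub>C y) = a * cinner x y"
    by (simp_all add: cinner_complex_def scaleC_complex_def ring_distribs)
  show "norm x = sqrt (Re (cinner x x))"
    by (simp add: cinner_complex_def cmod_def power2_eq_square)
qed
end

instantiation "fun" :: (type, complex_vector) complex_vector
begin
definition scaleC_fun :: "complex \<Rightarrow> ('a \<Rightarrow> 'b) \<Rightarrow> 'a \<Rightarrow> 'b"
  where "scaleC_fun a f = (\<lambda>x. a *\<^sub>C f x)"
instance
  by standard
    (auto simp: scaleC_fun_def fun_eq_iff scaleC_add_right scaleC_add_left
      scaleC_scaleC scaleC_one)
end

lemma bounded_linear_scaleC:
  "bounded_linear (\<lambda>x. a *\<^sub>C x :: 'a::complex_normed_vector)"
  by (rule bounded_linear_intro[where K = "cmod a"])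
    (simp_all add: scaleC_add_right scaleR_scaleC scaleC_scaleC norm_scaleC mult.commute)

instantiation blinfun :: (real_normed_vector, complex_normed_vector) complex_vector
begin
lift_definition scaleC_blinfun :: "complex \<Rightarrow> 'a \<Rightarrow>\<^sub>L 'b \<Rightarrow> 'a \<Rightarrow>\<^sub>L 'b"
  is "\<lambda>a T x. a *\<^sub>C T x"
  by (rule bounded_linear_compose[OF bounded_linear_scaleC])
instance
  by standard
    (transfer; simp add: fun_eq_iff scaleC_add_right scaleC_add_left scaleC_scaleC scaleC_one)+
end

definition clinear_on :: "'a set \<Rightarrow> ('a::complex_vector \<Rightarrow> 'b::complex_vector) \<Rightarrow> bool"
  where "clinear_on S f \<longleftrightarrow>
    (\<forall>x\<in>S. \<forall>y\<in>S. f (x + y) = f x + f y) \<and> (\<forall>a. \<forall>x\<in>S. f (a *\<^sub>C x) = a *\<^sub>C f x)"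

definition cbilinear_on ::
    "'a set \<Rightarrow> 'b set \<Rightarrow> ('a::complex_vector \<Rightarrow> 'b::complex_vector \<Rightarrow> complex) \<Rightarrow> bool"
  where "cbilinear_on S T \<beta> \<longleftrightarrow>
    (\<forall>y\<in>T. clinear_on S (\<lambda>x. \<beta> x y)) \<and> (\<forall>x\<in>S. clinear_on T (\<beta> x))"


section \<open>Operator spaces and their duals\<close>

text \<open>
  Elements of \<open>M\<^sub>n(V)\<close> are functions \<open>nat \<Rightarrow> nat \<Rightarrow> 'a\<close> of which only the entries
  with indices below \<open>n\<close> matter.
\<close>

record 'a matrix_normed =
  points :: "'a set"
  mnorm :: "nat \<Rightarrow> (nat \<Rightarrow> nat \<Rightarrow> 'a) \<Rightarrow> real"

definition matrices :: "('a, 'z) matrix_normed_scheme \<Rightarrow> nat \<Rightarrow> (nat \<Rightarrow> nat \<Rightarrow> 'a) set"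
  where "matrices V n = {v. \<forall>i<n. \<forall>j<n. v i j \<in> points V}"

definition mat_ball :: "('a, 'z) matrix_normed_scheme \<Rightarrow> nat \<Rightarrow> (nat \<Rightarrow> nat \<Rightarrow> 'a) set"
  where "mat_ball V n = {v \<in> matrices V n. mnorm V n v \<le> 1}"

text \<open>
  The type \<open>'h \<Rightarrow>\<^sub>L 'h\<close> consists of the bounded \<^emph>\<open>real\<close>-linear operators, so complex
  linearity has to be required separately.
\<close>

definition operator_space :: "('h::complex_hilbert \<Rightarrow>\<^sub>L 'h) set \<Rightarrow> bool"
  where "operator_space X \<longleftrightarrow>
    closed X \<and> csubspace X \<and> (\<forall>T\<in>X. clinear_on UNIV (blinfun_apply T))"

text \<open>The norm of \<open>M\<^sub>n(B(H)) = B(H\<^sup>n)\<close>, where \<open>H\<^sup>n\<close> is the Hilbert space direct sum.\<close>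

definition op_mat_norm :: "nat \<Rightarrow> (nat \<Rightarrow> nat \<Rightarrow> 'h::complex_hilbert \<Rightarrow>\<^sub>L 'h) \<Rightarrow> real"
  where "op_mat_norm n T =
    Sup {L2_set (\<lambda>i. norm (\<Sum>j<n. blinfun_apply (T i j) (\<xi> j))) {..<n} | \<xi>.
      L2_set (\<lambda>j. norm (\<xi> j)) {..<n} \<le> 1}"

definition opspace :: "('h::complex_hilbert \<Rightarrow>\<^sub>L 'h) set \<Rightarrow> ('h \<Rightarrow>\<^sub>L 'h) matrix_normed"
  where "opspace X = \<lparr>points = X, mnorm = op_mat_norm\<rparr>"

text \<open>
  Operator norm of a scalar matrix indexed by a finite set \<open>I\<close>.  With \<open>I = {..<n}\<close> this is
  the norm of \<open>M\<^sub>n\<close>; with \<open>I = {..<n} \<times> {..<p}\<close> it is the norm of \<open>M\<^sub>n(M\<^sub>p) = M\<^sub>n\<^sub>p\<close>.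
\<close>

definition scalar_mat_norm :: "'i set \<Rightarrow> ('i \<Rightarrow> 'i \<Rightarrow> complex) \<Rightarrow> real"
  where "scalar_mat_norm I a =
    Sup {L2_set (\<lambda>i. cmod (\<Sum>j\<in>I. a i j * \<xi> j)) I | \<xi>. L2_set (\<lambda>j. cmod (\<xi> j)) I \<le> 1}"

text \<open>The norm of \<open>A \<in> M\<^sub>n(M\<^sub>p)\<close>; \<open>A i j k l\<close> is the \<open>(k, l)\<close> entry of the \<open>(i, j)\<close> block.\<close>

definition block_norm ::
    "nat \<Rightarrow> nat \<Rightarrow> (nat \<Rightarrow> nat \<Rightarrow> nat \<Rightarrow> nat \<Rightarrow> complex) \<Rightarrow> real"
  where "block_norm n p A = scalar_mat_norm ({..<n} \<times> {..<p}) (\<lambda>(i, k) (j, l). A i j k l)"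

text \<open>
  A linear map \<open>f : V \<rightarrow> M\<^sub>p\<close> is given by its entries: \<open>F k l v\<close> is the \<open>(k, l)\<close> entry of
  \<open>f v\<close>.  This is also the identification of maps into \<open>M\<^sub>p\<close> with matrices of functionals.
\<close>

definition cb_values ::
    "('a, 'z) matrix_normed_scheme \<Rightarrow> nat \<Rightarrow> (nat \<Rightarrow> nat \<Rightarrow> 'a \<Rightarrow> complex) \<Rightarrow> real set"
  where "cb_values V p F =
    {block_norm n p (\<lambda>i j k l. F k l (v i j)) | n v. 0 < n \<and> v \<in> mat_ball V n}"

definition CB ::
    "('a::complex_vector, 'z) matrix_normed_scheme \<Rightarrow> nat
      \<Rightarrow> (nat \<Rightarrow> nat \<Rightarrow> 'a \<Rightarrow> complex) set"
  where "CB V p =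
    {F. (\<forall>k<p. \<forall>l<p. clinear_on (points V) (F k l)) \<and> bdd_above (cb_values V p F)}"

definition cb_norm ::
    "('a, 'z) matrix_normed_scheme \<Rightarrow> nat \<Rightarrow> (nat \<Rightarrow> nat \<Rightarrow> 'a \<Rightarrow> complex) \<Rightarrow> real"
  where "cb_norm V p F = Sup (cb_values V p F)"

definition CB_ball ::
    "('a::complex_vector, 'z) matrix_normed_scheme \<Rightarrow> nat
      \<Rightarrow> (nat \<Rightarrow> nat \<Rightarrow> 'a \<Rightarrow> complex) set"
  where "CB_ball V p = {F \<in> CB V p. cb_norm V p F \<le> 1}"

text \<open>
  Functionals on \<open>V\<close> are extended by zero outside of \<open>points V\<close>, so that an element of the
  dual is a unique function.
\<close>

definition dual :: "('a::complex_vector, 'z) matrix_normed_scheme \<Rightarrow> ('a \<Rightarrow> complex) matrix_normed"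
  where "dual V =
    \<lparr>points = {f. (\<lambda>_ _. f) \<in> CB V 1 \<and> (\<forall>x. x \<notin> points V \<longrightarrow> f x = 0)},
     mnorm = cb_norm V\<rparr>"


section \<open>The algebraic tensor product and the norm $s'$\<close>

text \<open>
  \<open>V \<otimes> W\<close> is realised as the span of the evaluations \<open>\<beta> \<mapsto> \<beta> v w\<close> in the space of linear
  functionals on the bilinear forms on \<open>V \<times> W\<close>; functionals are zero on arguments
  that are not bilinear forms.
\<close>

type_synonym ('a, 'b) tensor = "('a \<Rightarrow> 'b \<Rightarrow> complex) \<Rightarrow> complex"

definition elem_tensor ::
    "('a::complex_vector, 'y) matrix_normed_scheme \<Rightarrow> ('b::complex_vector, 'z) matrix_normed_scheme
      \<Rightarrow> 'a \<Rightarrow> 'b \<Rightarrow> ('a, 'b) tensor"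
  where "elem_tensor V W v w =
    (\<lambda>\<beta>. if cbilinear_on (points V) (points W) \<beta> then \<beta> v w else 0)"

definition tensor_product ::
    "('a::complex_vector, 'y) matrix_normed_scheme \<Rightarrow> ('b::complex_vector, 'z) matrix_normed_scheme
      \<Rightarrow> ('a, 'b) tensor set"
  where "tensor_product V W =
    cspan {elem_tensor V W v w | v w. v \<in> points V \<and> w \<in> points W}"

text \<open>
  The map \<open>f \<bar>\<circ> g : V \<otimes> W \<rightarrow> M\<^sub>p\<close>.  By the lemmas below its \<open>(k, l)\<close> entry is the linear
  extension of \<open>v \<otimes> w \<mapsto> F k l v * G k l w\<close>, the entrywise product of \<open>f v\<close> and \<open>g w\<close>.
\<close>

definition schur_map ::
    "(nat \<Rightarrow> nat \<Rightarrow> 'a \<Rightarrow> complex) \<Rightarrow> (nat \<Rightarrow> nat \<Rightarrow> 'b \<Rightarrow> complex)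
      \<Rightarrow> nat \<Rightarrow> nat \<Rightarrow> ('a, 'b) tensor \<Rightarrow> complex"
  where "schur_map F G k l u = u (\<lambda>v w. F k l v * G k l w)"

lemma clinear_on_schur_map: "clinear_on S (schur_map F G k l)"
  by (simp add: clinear_on_def schur_map_def scaleC_fun_def)

lemma schur_map_elem_tensor:
  assumes "F \<in> CB V p" "G \<in> CB W p" "k < p" "l < p"
  shows "schur_map F G k l (elem_tensor V W v w) = F k l v * G k l w"
  using assms
  by (auto simp: schur_map_def elem_tensor_def CB_def cbilinear_on_def clinear_on_def
      scaleC_complex_def algebra_simps)

lemma clinear_on_elem_tensor_left:
  "w \<in> points W \<Longrightarrow> clinear_on (points V) (\<lambda>v. elem_tensor V W v w)"
  by (auto simp: clinear_on_def elem_tensor_def cbilinear_on_def fun_eq_iff scaleC_fun_def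
      scaleC_complex_def)

lemma clinear_on_elem_tensor_right:
  "v \<in> points V \<Longrightarrow> clinear_on (points W) (elem_tensor V W v)"
  by (auto simp: clinear_on_def elem_tensor_def cbilinear_on_def fun_eq_iff scaleC_fun_def
      scaleC_complex_def)

definition s'_norm ::
    "('a::complex_vector, 'y) matrix_normed_scheme \<Rightarrow> ('b::complex_vector, 'z) matrix_normed_scheme
      \<Rightarrow> nat \<Rightarrow> (nat \<Rightarrow> nat \<Rightarrow> ('a, 'b) tensor) \<Rightarrow> real"
  where "s'_norm V W n u =
    Sup {block_norm n p (\<lambda>i j k l. schur_map F G k l (u i j)) | p F G.
      0 < p \<and> F \<in> CB_ball V p \<and> G \<in> CB_ball W p}"


section \<open>Completion of a normed space\<close>

text \<open>
  The completion of the space \<open>S\<close> with norm \<open>N\<close> is the quotient of the space of Cauchy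
  sequences by the subspace of null sequences.
\<close>

definition Cauchy_seqs :: "'a::complex_vector set \<Rightarrow> ('a \<Rightarrow> real) \<Rightarrow> (nat \<Rightarrow> 'a) set"
  where "Cauchy_seqs S N =
    {u. range u \<subseteq> S \<and> (\<forall>\<epsilon>>0. \<exists>M. \<forall>m\<ge>M. \<forall>n\<ge>M. N (u m - u n) < \<epsilon>)}"

definition seq_class ::
    "'a::complex_vector set \<Rightarrow> ('a \<Rightarrow> real) \<Rightarrow> (nat \<Rightarrow> 'a) \<Rightarrow> (nat \<Rightarrow> 'a) set"
  where "seq_class S N u = {w \<in> Cauchy_seqs S N. (\<lambda>n. N (w n - u n)) \<longlonglongrightarrow> 0}"

definition completion :: "'a::complex_vector set \<Rightarrow> ('a \<Rightarrow> real) \<Rightarrow> (nat \<Rightarrow> 'a) set set"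
  where "completion S N = seq_class S N ` Cauchy_seqs S N"

definition comp_embed ::
    "'a::complex_vector set \<Rightarrow> ('a \<Rightarrow> real) \<Rightarrow> 'a \<Rightarrow> (nat \<Rightarrow> 'a) set"
  where "comp_embed S N x = seq_class S N (\<lambda>_. x)"

definition comp_norm :: "('a \<Rightarrow> real) \<Rightarrow> (nat \<Rightarrow> 'a) set \<Rightarrow> real"
  where "comp_norm N A = (THE r. \<forall>u\<in>A. (\<lambda>n. N (u n)) \<longlonglongrightarrow> r)"

text \<open>
  Linearity of a map on the completion.  The sum of the classes of \<open>u\<close> and \<open>w\<close> is the class
  of \<open>u + w\<close>, and the multiple by \<open>a\<close> of the class of \<open>u\<close> is the class of \<open>a *\<^sub>C u\<close>, with the
  pointwise operations on sequences.
\<close>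

definition comp_linear ::
    "'a::complex_vector set \<Rightarrow> ('a \<Rightarrow> real) \<Rightarrow> ((nat \<Rightarrow> 'a) set \<Rightarrow> 'b::complex_vector) \<Rightarrow> bool"
  where "comp_linear S N \<psi> \<longleftrightarrow> clinear_on (Cauchy_seqs S N) (\<lambda>u. \<psi> (seq_class S N u))"

abbreviation s'_norm1 ::
    "('a::complex_vector, 'y) matrix_normed_scheme \<Rightarrow> ('b::complex_vector, 'z) matrix_normed_scheme
      \<Rightarrow> ('a, 'b) tensor \<Rightarrow> real"
  where "s'_norm1 V W u \<equiv> s'_norm V W 1 (\<lambda>_ _. u)"

definition s'_tensor ::
    "('a::complex_vector, 'y) matrix_normed_scheme \<Rightarrow> ('b::complex_vector, 'z) matrix_normed_scheme
      \<Rightarrow> (nat \<Rightarrow> ('a, 'b) tensor) set set"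
  where "s'_tensor V W = completion (tensor_product V W) (s'_norm1 V W)"

definition s'_tensor_norm ::
    "('a::complex_vector, 'y) matrix_normed_scheme \<Rightarrow> ('b::complex_vector, 'z) matrix_normed_scheme
      \<Rightarrow> (nat \<Rightarrow> ('a, 'b) tensor) set \<Rightarrow> real"
  where "s'_tensor_norm V W = comp_norm (s'_norm1 V W)"

definition s'_elem_tensor ::
    "('a::complex_vector, 'y) matrix_normed_scheme \<Rightarrow> ('b::complex_vector, 'z) matrix_normed_scheme
      \<Rightarrow> 'a \<Rightarrow> 'b \<Rightarrow> (nat \<Rightarrow> ('a, 'b) tensor) set"
  where "s'_elem_tensor V W v w =
    comp_embed (tensor_product V W) (s'_norm1 V W) (elem_tensor V W v w)"


section \<open>Schur bounded bilinear forms\<close>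

definition sb_values ::
    "('a, 'y) matrix_normed_scheme \<Rightarrow> ('b, 'z) matrix_normed_scheme
      \<Rightarrow> ('a \<Rightarrow> 'b \<Rightarrow> complex) \<Rightarrow> real set"
  where "sb_values V W \<phi> =
    {scalar_mat_norm {..<n} (\<lambda>i j. \<phi> (v i j) (w i j)) | n v w.
      0 < n \<and> v \<in> mat_ball V n \<and> w \<in> mat_ball W n}"

definition SB ::
    "('a::complex_vector, 'y) matrix_normed_scheme \<Rightarrow> ('b::complex_vector, 'z) matrix_normed_scheme
      \<Rightarrow> ('a \<Rightarrow> 'b \<Rightarrow> complex) set"
  where "SB V W =
    {\<phi>. cbilinear_on (points V) (points W) \<phi> \<and> bdd_above (sb_values V W \<phi>) \<and>
        (\<forall>x y. x \<notin> points V \<or> y \<notin> points W \<longrightarrow> \<phi> x y = 0)}"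

definition sb_norm ::
    "('a, 'y) matrix_normed_scheme \<Rightarrow> ('b, 'z) matrix_normed_scheme
      \<Rightarrow> ('a \<Rightarrow> 'b \<Rightarrow> complex) \<Rightarrow> real"
  where "sb_norm V W \<phi> = Sup (sb_values V W \<phi>)"

text \<open>
  Bounded linear maps from the completion into \<open>SB(V \<times> W, \<complex>)\<close> which send the
  class of \<open>f \<otimes> g\<close> to the form \<open>(x, y) \<mapsto> f x * g y\<close>; outside of the completion they are set
  to zero.
\<close>

definition natural_embedding ::
    "('a::complex_vector, 'y) matrix_normed_scheme \<Rightarrow> ('b::complex_vector, 'z) matrix_normed_scheme
      \<Rightarrow> ((nat \<Rightarrow> ('a \<Rightarrow> complex, 'b \<Rightarrow> complex) tensor) set \<Rightarrow> 'a \<Rightarrow> 'b \<Rightarrow> complex) \<Rightarrow> bool"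
  where "natural_embedding V W \<psi> \<longleftrightarrow>
    (\<forall>A \<in> s'_tensor (dual V) (dual W). \<psi> A \<in> SB V W) \<and>
    (\<forall>A. A \<notin> s'_tensor (dual V) (dual W) \<longrightarrow> \<psi> A = 0) \<and>
    comp_linear (tensor_product (dual V) (dual W)) (s'_norm1 (dual V) (dual W)) \<psi> \<and>
    (\<exists>C. \<forall>A \<in> s'_tensor (dual V) (dual W).
      sb_norm V W (\<psi> A) \<le> C * s'_tensor_norm (dual V) (dual W) A) \<and>
    (\<forall>f \<in> points (dual V). \<forall>g \<in> points (dual W). \<forall>x \<in> points V. \<forall>y \<in> points W.
      \<psi> (s'_elem_tensor (dual V) (dual W) f g) x y = f x * g y)"

end

theory Submission
  imports Defs
begin

text \<open>
  For an algebraic tensor \<open>u = \<Sum> f\<^sub>r \<otimes> g\<^sub>r\<close> in \<open>X\<^sup>* \<otimes> Y\<^sup>*\<close>, the norm of \<open>\<psi> u\<close> is the supremum of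
  \<open>\<parallel>[\<Sum> f\<^sub>r x\<^sub>k\<^sub>l g\<^sub>r y\<^sub>k\<^sub>l]\<parallel>\<close> over matrices \<open>x\<close> and \<open>y\<close> in the unit balls of \<open>M\<^sub>p(X)\<close> and \<open>M\<^sub>p(Y)\<close>.
  The norm of \<open>u\<close> is the same supremum with \<open>F\<^sub>k\<^sub>l f\<^sub>r\<close> and \<open>G\<^sub>k\<^sub>l g\<^sub>r\<close> in place of \<open>f\<^sub>r x\<^sub>k\<^sub>l\<close> and
  \<open>g\<^sub>r y\<^sub>k\<^sub>l\<close>, where \<open>F\<close> and \<open>G\<close> run through the unit balls of \<open>CB(X\<^sup>*, M\<^sub>p)\<close> and \<open>CB(Y\<^sup>*, M\<^sub>p)\<close>.
  Evaluation at \<open>x\<close> is such an \<open>F\<close>, so the second supremum is at least the first.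

  The two suprema agree because the unit ball of \<open>M\<^sub>p(X)\<close> is weak* dense in that of
  \<open>CB(X\<^sup>*, M\<^sub>p) = M\<^sub>p(X\<^sup>*\<^sup>*)\<close>.  A matrix coefficient of \<open>F \<bar>\<circ> G\<close> is linear in \<open>F\<close> and in \<open>G\<close>
  separately, and therefore only the dual form of this density is needed (\<open>dual_pairing_le\<close>): if
  \<open>\<bar>\<Sum> f\<^sub>k\<^sub>l x\<^sub>k\<^sub>l\<bar> \<le> M\<close> on the unit ball of \<open>M\<^sub>p(X)\<close>, then \<open>\<bar>\<Sum> F\<^sub>k\<^sub>l f\<^sub>k\<^sub>l\<bar> \<le> M\<close>.  It is applied once for
  \<open>F\<close> and once for \<open>G\<close> (\<open>schur_map_le_tensor_form\<close>).

  To prove the estimate, write \<open>\<phi> x = \<Sum> f\<^sub>k\<^sub>l x\<^sub>k\<^sub>l\<close>.  For a matrix \<open>x\<close> of any size \<open>m\<close> in the unit ball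
  and rectangular scalar matrices \<open>\<alpha>\<close> and \<open>\<beta>\<close>, the bound on \<open>\<phi>\<close> gives
  \<open>2 Re \<phi>(\<alpha>\<^sup>t x \<beta>) \<le> M (\<parallel>\<alpha>\<^sup>*\<alpha>\<parallel> + \<parallel>\<beta>\<^sup>*\<beta>\<parallel>)\<close>.  The pairs \<open>(\<alpha>\<^sup>*\<alpha>, \<beta>\<^sup>*\<beta>)\<close> together with the left sides
  form a convex cone, by direct sums of matrices, and the Hahn--Banach theorem replaces the right side
  by \<open>\<rho>(\<alpha>\<^sup>*\<alpha>) + \<sigma>(\<beta>\<^sup>*\<beta>)\<close> with positive functionals \<open>\<rho>\<close> and \<open>\<sigma>\<close> of mass at most \<open>M\<close>
  (\<open>ex_dominating_forms\<close>).  In bases that are orthonormal for \<open>\<rho>\<close> and for \<open>\<sigma>\<close>, the matrix \<open>f\<close> becomes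
  a matrix \<open>f'\<close> in the unit ball of \<open>M\<^sub>p(X\<^sup>*)\<close>, and \<open>f = c\<^sup>t f' d\<close> with Hilbert--Schmidt norms of \<open>c\<close>
  and \<open>d\<close> at most \<open>\<surd>M\<close>.  Since \<open>[F\<^sub>k\<^sub>l f'\<^sub>i\<^sub>j]\<close> is a contraction, \<open>\<Sum> F\<^sub>k\<^sub>l f\<^sub>k\<^sub>l\<close> is at most \<open>M\<close> in modulus.

  Contractivity of the entrywise product of scalar matrices makes both suprema finite.  The
  isometry then passes to the completion, as the forms are a normed space that is closed under
  the limits of Cauchy sequences; boundedness makes the extension unique.
\<close>

section \<open>Norms of scalar matrices\<close>

lemma cmod_sum_mult_le:
  "cmod (\<Sum>i\<in>I. a i * b i) \<le> L2_set (\<lambda>i. cmod (a i)) I * L2_set (\<lambda>i. cmod (b i)) I"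
proof -
  have "cmod (\<Sum>i\<in>I. a i * b i) \<le> (\<Sum>i\<in>I. \<bar>cmod (a i)\<bar> * \<bar>cmod (b i)\<bar>)"
    using norm_sum[of "\<lambda>i. a i * b i" I] by (simp add: norm_mult)
  also have "\<dots> \<le> L2_set (\<lambda>i. cmod (a i)) I * L2_set (\<lambda>i. cmod (b i)) I"
    by (rule L2_set_mult_ineq)
  finally show ?thesis .
qed

lemma L2_set_cmod_mult:
  "L2_set (\<lambda>i. cmod (a * b i)) I = cmod a * L2_set (\<lambda>i. cmod (b i)) I"
  by (simp add: norm_mult L2_set_right_distrib)

lemma L2_set_zero_fun [simp]: "L2_set (\<lambda>i. 0) I = 0"
  by (simp add: L2_set_def)

lemma L2_set_power2: "(L2_set f I)\<^sup>2 = (\<Sum>i\<in>I. (f i)\<^sup>2)"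
  by (simp add: L2_set_def sum_nonneg)

lemma sum_mult_cnj_self: "(\<Sum>i\<in>I. cnj (a i) * a i) = complex_of_real ((L2_set (\<lambda>i. cmod (a i)) I)\<^sup>2)"
  unfolding L2_set_power2 of_real_sum complex_norm_square by (simp add: mult.commute)

lemma L2_set_delta:
  assumes "finite I" "l \<in> I"
  shows "L2_set (\<lambda>k. cmod (if k = l then 1 else 0)) I = 1"
proof -
  have "(\<Sum>k\<in>I. (cmod (if k = l then 1 else 0))\<^sup>2) = (\<Sum>k\<in>I. if k = l then 1 else 0)"
    by (intro sum.cong) auto
  then show ?thesis
    using assms by (simp add: L2_set_def)
qed

lemma bdd_above_scalar_mat:
  assumes "finite I"
  shows "bdd_above {L2_set (\<lambda>i. cmod (\<Sum>j\<in>I. a i j * \<xi> j)) I | \<xi>. L2_set (\<lambda>j. cmod (\<xi> j)) I \<le> 1}"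
proof (rule bdd_aboveI, clarify)
  fix \<xi> :: "'a \<Rightarrow> complex"
  assume le: "L2_set (\<lambda>j. cmod (\<xi> j)) I \<le> 1"
  have "L2_set (\<lambda>i. cmod (\<Sum>j\<in>I. a i j * \<xi> j)) I \<le> (\<Sum>i\<in>I. cmod (\<Sum>j\<in>I. a i j * \<xi> j))"
    by (rule L2_set_le_sum) simp
  also have "\<dots> \<le> (\<Sum>i\<in>I. \<Sum>j\<in>I. cmod (a i j))"
  proof (intro sum_mono order_trans[OF norm_sum])
    fix i j assume "j \<in> I"
    then have "cmod (\<xi> j) \<le> 1"
      using member_le_L2_set[OF assms, of j "\<lambda>j. cmod (\<xi> j)"] le by simp
    then show "cmod (a i j * \<xi> j) \<le> cmod (a i j)"
      by (simp add: norm_mult mult_left_le)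
  qed
  finally show "L2_set (\<lambda>i. cmod (\<Sum>j\<in>I. a i j * \<xi> j)) I \<le> (\<Sum>i\<in>I. \<Sum>j\<in>I. cmod (a i j))" .
qed

lemma scalar_mat_norm_nonneg:
  assumes "finite I"
  shows "0 \<le> scalar_mat_norm I a"
  unfolding scalar_mat_norm_def
  by (rule cSup_upper2[OF _ _ bdd_above_scalar_mat[OF assms], of "0"])
    (auto intro!: exI[of _ "\<lambda>_. 0"])

lemma L2_set_scalar_mat_le:
  assumes "finite I"
  shows "L2_set (\<lambda>i. cmod (\<Sum>j\<in>I. a i j * \<xi> j)) I \<le> scalar_mat_norm I a * L2_set (\<lambda>j. cmod (\<xi> j)) I"
proof (cases "L2_set (\<lambda>j. cmod (\<xi> j)) I = 0")
  case True
  then have "\<forall>j\<in>I. \<xi> j = 0"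
    using assms by (simp add: L2_set_eq_0_iff)
  then show ?thesis
    by (simp add: True)
next
  case False
  define t where "t = L2_set (\<lambda>j. cmod (\<xi> j)) I"
  have t: "t > 0"
    using False L2_set_nonneg[of "\<lambda>j. cmod (\<xi> j)" I] unfolding t_def by linarith
  define \<eta> where "\<eta> j = complex_of_real (1 / t) * \<xi> j" for j
  have "L2_set (\<lambda>j. cmod (\<eta> j)) I \<le> 1"
    unfolding \<eta>_def L2_set_cmod_mult using t by (simp add: t_def norm_divide)
  then have "L2_set (\<lambda>i. cmod (\<Sum>j\<in>I. a i j * \<eta> j)) I \<le> scalar_mat_norm I a"
    unfolding scalar_mat_norm_def by (intro cSup_upper bdd_above_scalar_mat assms) auto
  moreover have "L2_set (\<lambda>i. cmod (\<Sum>j\<in>I. a i j * \<eta> j)) I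
      = L2_set (\<lambda>i. cmod (complex_of_real (1 / t) * (\<Sum>j\<in>I. a i j * \<xi> j))) I"
    by (simp add: \<eta>_def sum_distrib_left mult_ac)
  ultimately have "(1 / t) * L2_set (\<lambda>i. cmod (\<Sum>j\<in>I. a i j * \<xi> j)) I \<le> scalar_mat_norm I a"
    unfolding L2_set_cmod_mult using t by (simp add: norm_divide)
  then show ?thesis
    using t by (simp add: t_def[symmetric] field_simps)
qed

lemma cmod_bilinear_le:
  assumes "finite I"
  shows "cmod (\<Sum>i\<in>I. \<Sum>j\<in>I. \<zeta> i * a i j * \<xi> j)
    \<le> scalar_mat_norm I a * (L2_set (\<lambda>i. cmod (\<zeta> i)) I * L2_set (\<lambda>j. cmod (\<xi> j)) I)"
proof -
  have "cmod (\<Sum>i\<in>I. \<Sum>j\<in>I. \<zeta> i * a i j * \<xi> j) = cmod (\<Sum>i\<in>I. \<zeta> i * (\<Sum>j\<in>I. a i j * \<xi> j))"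
    by (simp add: sum_distrib_left mult_ac)
  also have "\<dots> \<le> L2_set (\<lambda>i. cmod (\<zeta> i)) I * L2_set (\<lambda>i. cmod (\<Sum>j\<in>I. a i j * \<xi> j)) I"
    by (rule cmod_sum_mult_le)
  also have "\<dots> \<le> L2_set (\<lambda>i. cmod (\<zeta> i)) I * (scalar_mat_norm I a * L2_set (\<lambda>j. cmod (\<xi> j)) I)"
    by (intro mult_left_mono L2_set_scalar_mat_le assms) simp
  finally show ?thesis by (simp add: mult_ac)
qed

lemma scalar_mat_norm_le_bilinear:
  assumes "finite I"
    and bound: "\<And>\<zeta> \<xi>. L2_set (\<lambda>i. cmod (\<zeta> i)) I \<le> 1 \<Longrightarrow> L2_set (\<lambda>j. cmod (\<xi> j)) I \<le> 1 \<Longrightarrow>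
      cmod (\<Sum>i\<in>I. \<Sum>j\<in>I. \<zeta> i * a i j * \<xi> j) \<le> c"
  shows "scalar_mat_norm I a \<le> c"
  unfolding scalar_mat_norm_def
proof (rule cSup_least)
  show "{L2_set (\<lambda>i. cmod (\<Sum>j\<in>I. a i j * \<xi> j)) I |\<xi>. L2_set (\<lambda>j. cmod (\<xi> j)) I \<le> 1} \<noteq> {}"
    by (auto intro!: exI[of _ "\<lambda>_. 0"])
next
  fix r
  assume "r \<in> {L2_set (\<lambda>i. cmod (\<Sum>j\<in>I. a i j * \<xi> j)) I |\<xi>. L2_set (\<lambda>j. cmod (\<xi> j)) I \<le> 1}"
  then obtain \<xi> where \<xi>: "L2_set (\<lambda>j. cmod (\<xi> j)) I \<le> 1"
    and r: "r = L2_set (\<lambda>i. cmod (\<Sum>j\<in>I. a i j * \<xi> j)) I"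
    by auto
  define b where "b i = (\<Sum>j\<in>I. a i j * \<xi> j)" for i
  show "r \<le> c"
  proof (cases "r = 0")
    case True
    then show ?thesis
      using bound[of "\<lambda>_. 0" "\<lambda>_. 0"] by simp
  next
    case False
    then have r0: "r > 0"
      unfolding r using L2_set_nonneg[of "\<lambda>i. cmod (\<Sum>j\<in>I. a i j * \<xi> j)" I] by linarith
    define \<zeta> where "\<zeta> i = complex_of_real (1 / r) * cnj (b i)" for i
    have "L2_set (\<lambda>i. cmod (\<zeta> i)) I \<le> 1"
      unfolding \<zeta>_def L2_set_cmod_mult complex_mod_cnj
      using r0 r[folded b_def] by (simp add: norm_divide)
    then have "cmod (\<Sum>i\<in>I. \<Sum>j\<in>I. \<zeta> i * a i j * \<xi> j) \<le> c"
      using \<xi> by (rule bound)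
    moreover have "(\<Sum>i\<in>I. \<Sum>j\<in>I. \<zeta> i * a i j * \<xi> j) = (\<Sum>i\<in>I. \<zeta> i * b i)"
      by (simp add: b_def sum_distrib_left mult_ac)
    moreover have "\<dots> = complex_of_real (1 / r) * (\<Sum>i\<in>I. cnj (b i) * b i)"
      by (simp add: \<zeta>_def sum_distrib_left mult_ac)
    moreover have "\<dots> = complex_of_real r"
      unfolding sum_mult_cnj_self using r0 by (simp add: r b_def power2_eq_square)
    ultimately show ?thesis
      using r0 by simp
  qed
qed

lemma scalar_mat_norm_entry:
  assumes "finite I" "i \<in> I" "j \<in> I"
  shows "cmod (a i j) \<le> scalar_mat_norm I a"
proof -
  have "(\<Sum>k\<in>I. \<Sum>l\<in>I. (if k = i then 1 else 0) * a k l * (if l = j then 1 else 0)) = a i j"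
    (is "?s = _")
  proof -
    have "?s = (\<Sum>k\<in>I. if k = i then (\<Sum>l\<in>I. if l = j then a i l else 0) else 0)"
      by (intro sum.cong refl) (auto intro!: sum.cong)
    also have "\<dots> = a i j"
      using assms by simp
    finally show ?thesis .
  qed
  then show ?thesis
    using cmod_bilinear_le[OF assms(1), of "\<lambda>k. if k = i then 1 else 0" a "\<lambda>l. if l = j then 1 else 0"]
      L2_set_delta[OF assms(1,2)] L2_set_delta[OF assms(1,3)] by simp
qed

lemma scalar_mat_norm_cong:
  "(\<And>i j. i \<in> I \<Longrightarrow> j \<in> I \<Longrightarrow> a i j = b i j) \<Longrightarrow> scalar_mat_norm I a = scalar_mat_norm I b"
  unfolding scalar_mat_norm_def by (simp cong: L2_set_cong sum.cong)

lemma scalar_mat_norm_add_le: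
  assumes "finite I"
  shows "scalar_mat_norm I (\<lambda>i j. a i j + b i j) \<le> scalar_mat_norm I a + scalar_mat_norm I b"
proof (rule scalar_mat_norm_le_bilinear[OF assms])
  fix \<zeta> \<xi> :: "'a \<Rightarrow> complex"
  assume le: "L2_set (\<lambda>i. cmod (\<zeta> i)) I \<le> 1" "L2_set (\<lambda>i. cmod (\<xi> i)) I \<le> 1"
  have prod: "L2_set (\<lambda>i. cmod (\<zeta> i)) I * L2_set (\<lambda>i. cmod (\<xi> i)) I \<le> 1"
    using le by (simp add: mult_le_one)
  have "cmod (\<Sum>i\<in>I. \<Sum>j\<in>I. \<zeta> i * a i j * \<xi> j) \<le> scalar_mat_norm I a"
    "cmod (\<Sum>i\<in>I. \<Sum>j\<in>I. \<zeta> i * b i j * \<xi> j) \<le> scalar_mat_norm I b"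
    using cmod_bilinear_le[OF assms, of \<zeta> a \<xi>] cmod_bilinear_le[OF assms, of \<zeta> b \<xi>]
      mult_left_le[OF prod scalar_mat_norm_nonneg[OF assms, of a]]
      mult_left_le[OF prod scalar_mat_norm_nonneg[OF assms, of b]] by linarith+
  then show "cmod (\<Sum>i\<in>I. \<Sum>j\<in>I. \<zeta> i * (a i j + b i j) * \<xi> j) \<le> scalar_mat_norm I a + scalar_mat_norm I b"
    by (simp add: ring_distribs sum.distrib norm_triangle_le)
qed

lemma scalar_mat_norm_cmult_le:
  assumes "finite I"
  shows "scalar_mat_norm I (\<lambda>i j. c * a i j) \<le> cmod c * scalar_mat_norm I a"
proof (rule scalar_mat_norm_le_bilinear[OF assms])
  fix \<zeta> \<xi> :: "'a \<Rightarrow> complex"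
  assume le: "L2_set (\<lambda>i. cmod (\<zeta> i)) I \<le> 1" "L2_set (\<lambda>i. cmod (\<xi> i)) I \<le> 1"
  have prod: "L2_set (\<lambda>i. cmod (\<zeta> i)) I * L2_set (\<lambda>i. cmod (\<xi> i)) I \<le> 1"
    using le by (simp add: mult_le_one)
  have "cmod (\<Sum>i\<in>I. \<Sum>j\<in>I. \<zeta> i * a i j * \<xi> j) \<le> scalar_mat_norm I a"
    using cmod_bilinear_le[OF assms, of \<zeta> a \<xi>]
      mult_left_le[OF prod scalar_mat_norm_nonneg[OF assms, of a]] by linarith
  moreover have "(\<Sum>i\<in>I. \<Sum>j\<in>I. \<zeta> i * (c * a i j) * \<xi> j) = c * (\<Sum>i\<in>I. \<Sum>j\<in>I. \<zeta> i * a i j * \<xi> j)"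
    by (simp add: sum_distrib_left mult_ac)
  ultimately show "cmod (\<Sum>i\<in>I. \<Sum>j\<in>I. \<zeta> i * (c * a i j) * \<xi> j) \<le> cmod c * scalar_mat_norm I a"
    by (simp add: norm_mult mult_left_mono)
qed

lemma scalar_mat_norm_reindex:
  assumes h: "bij_betw h I J" and "finite I"
  shows "scalar_mat_norm J a = scalar_mat_norm I (\<lambda>i j. a (h i) (h j))"
proof -
  have fin: "finite J" using assms bij_betw_finite by blast
  have le: "scalar_mat_norm J a \<le> scalar_mat_norm I (\<lambda>i j. a (h i) (h j))"
    if h: "bij_betw h I J" and fin: "finite I" "finite J" for h a and I :: "'x set" and J :: "'y set"
  proof (rule scalar_mat_norm_le_bilinear[OF fin(2)])
    fix \<zeta> \<xi> :: "'y \<Rightarrow> complex"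
    assume le: "L2_set (\<lambda>i. cmod (\<zeta> i)) J \<le> 1" "L2_set (\<lambda>i. cmod (\<xi> i)) J \<le> 1"
    have L2: "L2_set (\<lambda>i. cmod (\<zeta> (h i))) I = L2_set (\<lambda>i. cmod (\<zeta> i)) J" for \<zeta> :: "'y \<Rightarrow> complex"
      unfolding L2_set_def using sum.reindex_bij_betw[OF h, of "\<lambda>i. (cmod (\<zeta> i))\<^sup>2"] by simp
    have "(\<Sum>i\<in>J. \<Sum>j\<in>J. \<zeta> i * a i j * \<xi> j) = (\<Sum>i\<in>I. \<Sum>j\<in>I. \<zeta> (h i) * a (h i) (h j) * \<xi> (h j))"
      unfolding sum.reindex_bij_betw[OF h, symmetric] ..
    also have "cmod \<dots> \<le> scalar_mat_norm I (\<lambda>i j. a (h i) (h j)) * (L2_set (\<lambda>i. cmod (\<zeta> i)) J * L2_set (\<lambda>i. cmod (\<xi> i)) J)"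
      using cmod_bilinear_le[OF fin(1), of "\<lambda>i. \<zeta> (h i)" "\<lambda>i j. a (h i) (h j)" "\<lambda>i. \<xi> (h i)"]
      by (simp add: L2)
    also have "\<dots> \<le> scalar_mat_norm I (\<lambda>i j. a (h i) (h j))"
      using le by (simp add: mult_left_le mult_le_one scalar_mat_norm_nonneg fin)
    finally show "cmod (\<Sum>i\<in>J. \<Sum>j\<in>J. \<zeta> i * a i j * \<xi> j) \<le> scalar_mat_norm I (\<lambda>i j. a (h i) (h j))" .
  qed
  have "scalar_mat_norm I (\<lambda>i j. a (h i) (h j))
      \<le> scalar_mat_norm J (\<lambda>i j. a (h (inv_into I h i)) (h (inv_into I h j)))"
    using bij_betw_inv_into[OF h] fin assms(2) by (intro le)
  also have "\<dots> = scalar_mat_norm J a"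
    using h by (intro scalar_mat_norm_cong) (auto simp: bij_betw_inv_into_right)
  finally show ?thesis
    using le[OF h assms(2) fin] by (simp add: antisym)
qed

lemma block_norm_one_left: "block_norm 1 p A = scalar_mat_norm {..<p} (A 0 0)"
proof -
  have "bij_betw (\<lambda>k. (0::nat, k)) {..<p} ({..<1} \<times> {..<p})"
    by (auto simp: bij_betw_def inj_on_def)
  then show ?thesis
    unfolding block_norm_def by (subst scalar_mat_norm_reindex) auto
qed

lemma block_norm_one_right: "block_norm n 1 A = scalar_mat_norm {..<n} (\<lambda>i j. A i j 0 0)"
proof -
  have "bij_betw (\<lambda>k. (k, 0::nat)) {..<n} ({..<n} \<times> {..<1})"
    by (auto simp: bij_betw_def inj_on_def)
  then show ?thesis
    unfolding block_norm_def by (subst scalar_mat_norm_reindex) auto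
qed

lemma block_norm_swap: "block_norm n p A = block_norm p n (\<lambda>k l i j. A i j k l)"
proof -
  have "bij_betw prod.swap ({..<p} \<times> {..<n}) ({..<n} \<times> {..<p})"
    by (auto simp: bij_betw_def inj_on_def)
  then show ?thesis
    unfolding block_norm_def by (subst scalar_mat_norm_reindex)
      (auto simp: case_prod_unfold)
qed

text \<open>A crude bound, which shows that a matrix with completely bounded entries is completely bounded.
  For fixed \<open>k\<close> and \<open>l\<close> the coordinates of the test vectors that belong to \<open>k\<close> and to \<open>l\<close> form vectors
  of norm at most one.\<close>

lemma block_norm_le_sum_entries:
  "block_norm n p A \<le> (\<Sum>k<p. \<Sum>l<p. scalar_mat_norm {..<n} (\<lambda>i j. A i j k l))"
  unfolding block_norm_def
proof (rule scalar_mat_norm_le_bilinear)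
  fix \<zeta> \<xi> :: "nat \<times> nat \<Rightarrow> complex"
  let ?P = "{..<n} \<times> {..<p}"
  assume le: "L2_set (\<lambda>i. cmod (\<zeta> i)) ?P \<le> 1" "L2_set (\<lambda>i. cmod (\<xi> i)) ?P \<le> 1"
  have part: "L2_set (\<lambda>i. cmod (\<zeta> (i, k))) {..<n} \<le> 1"
    if "L2_set (\<lambda>i. cmod (\<zeta> i)) ?P \<le> 1" "k < p" for \<zeta> :: "nat \<times> nat \<Rightarrow> complex" and k
  proof -
    have "(\<Sum>i<n. (cmod (\<zeta> (i, k)))\<^sup>2) = (\<Sum>x\<in>{..<n} \<times> {k}. (cmod (\<zeta> x))\<^sup>2)"
      by (simp add: sum.cartesian_product' )
    also have "\<dots> \<le> (\<Sum>x\<in>?P. (cmod (\<zeta> x))\<^sup>2)"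
      using that by (intro sum_mono2) auto
    finally show ?thesis
      using that(1) unfolding L2_set_def by (meson order_trans real_sqrt_le_iff)
  qed
  have "(\<Sum>x\<in>?P. \<Sum>y\<in>?P. \<zeta> x * (case x of (i, k) \<Rightarrow> \<lambda>(j, l). A i j k l) y * \<xi> y)
      = (\<Sum>i<n. \<Sum>k<p. \<Sum>j<n. \<Sum>l<p. \<zeta> (i, k) * A i j k l * \<xi> (j, l))"
    by (simp add: sum.cartesian_product')
  also have "\<dots> = (\<Sum>k<p. \<Sum>i<n. \<Sum>j<n. \<Sum>l<p. \<zeta> (i, k) * A i j k l * \<xi> (j, l))"
    by (rule sum.swap)
  also have "\<dots> = (\<Sum>k<p. \<Sum>i<n. \<Sum>l<p. \<Sum>j<n. \<zeta> (i, k) * A i j k l * \<xi> (j, l))"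
    by (intro sum.cong refl sum.swap)
  also have "\<dots> = (\<Sum>k<p. \<Sum>l<p. \<Sum>i<n. \<Sum>j<n. \<zeta> (i, k) * A i j k l * \<xi> (j, l))"
    by (intro sum.cong refl sum.swap)
  also have "cmod \<dots> \<le> (\<Sum>k<p. \<Sum>l<p. scalar_mat_norm {..<n} (\<lambda>i j. A i j k l))"
  proof (intro sum_norm_le)
    fix k l assume "k \<in> {..<p}" "l \<in> {..<p}"
    then have "L2_set (\<lambda>i. cmod (\<zeta> (i, k))) {..<n} * L2_set (\<lambda>i. cmod (\<xi> (i, l))) {..<n} \<le> 1"
      using le by (simp add: mult_le_one part)
    then show "cmod (\<Sum>i<n. \<Sum>j<n. \<zeta> (i, k) * A i j k l * \<xi> (j, l)) \<le> scalar_mat_norm {..<n} (\<lambda>i j. A i j k l)"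
      using cmod_bilinear_le[of "{..<n}" "\<lambda>i. \<zeta> (i, k)" "\<lambda>i j. A i j k l" "\<lambda>j. \<xi> (j, l)"]
        mult_left_le[OF _ scalar_mat_norm_nonneg[of "{..<n}" "\<lambda>i j. A i j k l"]]
      by (meson finite_lessThan order_trans)
  qed
  finally show "cmod (\<Sum>x\<in>?P. \<Sum>y\<in>?P. \<zeta> x * (case x of (i, k) \<Rightarrow> \<lambda>(j, l). A i j k l) y * \<xi> y)
    \<le> (\<Sum>k<p. \<Sum>l<p. scalar_mat_norm {..<n} (\<lambda>i j. A i j k l))" .
qed simp

text \<open>The entrywise product is a compression of the Kronecker product: applying the second matrix
  to the second copy of the diagonal vector \<open>\<Sum> \<xi> j (e\<^sub>j \<otimes> e\<^sub>j)\<close>, then the first matrix to the first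
  copy, leaves the wanted vector on the diagonal.\<close>

lemma scalar_mat_norm_schur_le:
  assumes I: "finite I"
  shows "scalar_mat_norm I (\<lambda>i j. a i j * b i j) \<le> scalar_mat_norm I a * scalar_mat_norm I b"
  unfolding scalar_mat_norm_def[of I "\<lambda>i j. a i j * b i j"]
proof (rule cSup_least)
  show "{L2_set (\<lambda>i. cmod (\<Sum>j\<in>I. a i j * b i j * \<xi> j)) I |\<xi>. L2_set (\<lambda>j. cmod (\<xi> j)) I \<le> 1} \<noteq> {}"
    by (auto intro!: exI[of _ "\<lambda>_. 0"])
next
  fix r
  assume "r \<in> {L2_set (\<lambda>i. cmod (\<Sum>j\<in>I. a i j * b i j * \<xi> j)) I |\<xi>. L2_set (\<lambda>j. cmod (\<xi> j)) I \<le> 1}"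
  then obtain \<xi> where \<xi>: "L2_set (\<lambda>j. cmod (\<xi> j)) I \<le> 1"
    and r: "r = L2_set (\<lambda>i. cmod (\<Sum>j\<in>I. a i j * b i j * \<xi> j)) I"
    by auto
  let ?A = "scalar_mat_norm I a" and ?B = "scalar_mat_norm I b"
  have col: "(\<Sum>k\<in>I. (cmod (b k l))\<^sup>2) \<le> ?B\<^sup>2" if "l \<in> I" for l
  proof -
    have "L2_set (\<lambda>k. cmod (\<Sum>j\<in>I. b k j * (if j = l then 1 else 0))) I
        \<le> ?B * L2_set (\<lambda>j. cmod (if j = l then 1 else 0)) I"
      by (rule L2_set_scalar_mat_le[OF I])
    then have "L2_set (\<lambda>k. cmod (b k l)) I \<le> ?B"
      using that I by (simp only: L2_set_delta[OF I that]) (simp add: if_distrib cong: if_cong)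
    then show ?thesis
      using power_mono[of "L2_set (\<lambda>k. cmod (b k l)) I" ?B 2] by (simp add: L2_set_power2)
  qed
  have "r\<^sup>2 = (\<Sum>i\<in>I. (cmod (\<Sum>j\<in>I. a i j * (b i j * \<xi> j)))\<^sup>2)"
    by (simp add: r L2_set_power2 mult_ac)
  also have "\<dots> \<le> (\<Sum>i\<in>I. \<Sum>k\<in>I. (cmod (\<Sum>j\<in>I. a i j * (b k j * \<xi> j)))\<^sup>2)"
    using I by (intro sum_mono member_le_sum) auto
  also have "\<dots> = (\<Sum>k\<in>I. (L2_set (\<lambda>i. cmod (\<Sum>j\<in>I. a i j * (b k j * \<xi> j))) I)\<^sup>2)"
    unfolding L2_set_power2 by (rule sum.swap)
  also have "\<dots> \<le> (\<Sum>k\<in>I. (?A * L2_set (\<lambda>j. cmod (b k j * \<xi> j)) I)\<^sup>2)"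
    by (intro sum_mono power_mono L2_set_scalar_mat_le I) simp
  also have "\<dots> = ?A\<^sup>2 * (\<Sum>k\<in>I. \<Sum>j\<in>I. (cmod (b k j))\<^sup>2 * (cmod (\<xi> j))\<^sup>2)"
    by (simp add: power_mult_distrib L2_set_power2 sum_distrib_left norm_mult)
  also have "(\<Sum>k\<in>I. \<Sum>j\<in>I. (cmod (b k j))\<^sup>2 * (cmod (\<xi> j))\<^sup>2)
      = (\<Sum>j\<in>I. (\<Sum>k\<in>I. (cmod (b k j))\<^sup>2) * (cmod (\<xi> j))\<^sup>2)"
    unfolding sum_distrib_right by (rule sum.swap)
  also have "\<dots> \<le> (\<Sum>j\<in>I. ?B\<^sup>2 * (cmod (\<xi> j))\<^sup>2)"
    by (intro sum_mono mult_right_mono col) auto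
  also have "\<dots> = ?B\<^sup>2 * (L2_set (\<lambda>j. cmod (\<xi> j)) I)\<^sup>2"
    by (simp add: L2_set_power2 sum_distrib_left)
  also have "\<dots> \<le> ?B\<^sup>2"
    using \<xi> by (simp add: mult_left_le power_le_one)
  finally have "r\<^sup>2 \<le> (?A * ?B)\<^sup>2"
    by (simp add: power_mult_distrib mult_left_mono)
  then show "r \<le> ?A * ?B"
    by (rule power2_le_imp_le) (simp add: scalar_mat_norm_nonneg I)
qed

section \<open>Linear functionals between a cone and a sublinear functional\<close>

definition sublinear :: "('a::complex_vector \<Rightarrow> real) \<Rightarrow> bool"
  where "sublinear q \<longleftrightarrow> (\<forall>x y. q (x + y) \<le> q x + q y) \<and>
    (\<forall>t>0. \<forall>x. q (complex_of_real t *\<^sub>C x) \<le> t * q x)"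

lemma sublinear_add: "sublinear q \<Longrightarrow> q (x + y) \<le> q x + q y"
  and sublinear_scale_le: "sublinear q \<Longrightarrow> 0 < t \<Longrightarrow> q (complex_of_real t *\<^sub>C x) \<le> t * q x"
  by (simp_all add: sublinear_def)

lemma sublinear_scale:
  assumes "sublinear q" "0 < t"
  shows "q (complex_of_real t *\<^sub>C x) = t * q x"
proof (rule antisym[OF sublinear_scale_le[OF assms]])
  have "x = complex_of_real (1 / t) *\<^sub>C complex_of_real t *\<^sub>C x"
    using assms(2) by (simp add: scaleC_scaleC scaleC_one)
  then have "q x \<le> 1 / t * q (complex_of_real t *\<^sub>C x)"
    using sublinear_scale_le[OF assms(1), of "1 / t" "complex_of_real t *\<^sub>C x"] assms(2) by simp
  then show "t * q x \<le> q (complex_of_real t *\<^sub>C x)"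
    using assms(2) by (simp add: field_simps)
qed

lemma sublinear_zero: "sublinear q \<Longrightarrow> q 0 = 0"
  using sublinear_scale[of q 2 0] by simp

lemma sublinear_minus: "sublinear q \<Longrightarrow> - q (- x) \<le> q x"
  using sublinear_add[of q x "- x"] sublinear_zero[of q] by simp

definition real_cone :: "('a::complex_vector \<times> real) set \<Rightarrow> bool"
  where "real_cone G \<longleftrightarrow> (0, 0) \<in> G \<and>
    (\<forall>g r h s. (g, r) \<in> G \<longrightarrow> (h, s) \<in> G \<longrightarrow> (g + h, r + s) \<in> G) \<and>
    (\<forall>t>0. \<forall>g r. (g, r) \<in> G \<longrightarrow> (complex_of_real t *\<^sub>C g, t * r) \<in> G)"

text \<open>For sublinear \<open>q\<close> and a convex cone \<open>G\<close> of pairs with \<open>r \<le> q g\<close>, this is the largest sublinear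
  functional below \<open>q\<close> whose value at \<open>- g\<close> is at most \<open>- r\<close> for all
  \<open>(g, r)\<close> in \<open>G\<close>.\<close>

definition shift_inf :: "('a::complex_vector \<Rightarrow> real) \<Rightarrow> ('a \<times> real) set \<Rightarrow> 'a \<Rightarrow> real"
  where "shift_inf q G x = (INF (g, r)\<in>G. q (x + g) - r)"

lemma shift_inf:
  assumes q: "sublinear q" and G: "real_cone G"
    and le: "\<And>g r. (g, r) \<in> G \<Longrightarrow> r \<le> q g"
  shows sublinear_shift_inf: "sublinear (shift_inf q G)"
    and shift_inf_le: "\<And>x. shift_inf q G x \<le> q x"
    and shift_inf_minus_le: "\<And>g r. (g, r) \<in> G \<Longrightarrow> shift_inf q G (- g) \<le> - r"
proof -
  have bdd: "bdd_below ((\<lambda>(g, r). q (x + g) - r) ` G)" for x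
  proof (rule bdd_belowI2[of _ "- q (- x)"], clarify)
    fix g r assume "(g, r) \<in> G"
    then have "r \<le> q g" by (rule le)
    also have "q g \<le> q (x + g) + q (- x)"
      using sublinear_add[OF q, of "x + g" "- x"] by simp
    finally show "- q (- x) \<le> q (x + g) - r" by simp
  qed
  have ne: "G \<noteq> {}" and zero: "(0, 0) \<in> G"
    using G by (auto simp: real_cone_def)
  have lower: "shift_inf q G x \<le> q (x + g) - r" if "(g, r) \<in> G" for x g r
    unfolding shift_inf_def using cINF_lower[OF bdd that, of x] by simp
  have greatest: "c \<le> shift_inf q G x" if "\<And>g r. (g, r) \<in> G \<Longrightarrow> c \<le> q (x + g) - r" for c x
    unfolding shift_inf_def using that by (intro cINF_greatest ne) auto
  show "shift_inf q G x \<le> q x" for x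
    using lower[OF zero, of x] by simp
  show "shift_inf q G (- g) \<le> - r" if "(g, r) \<in> G" for g r
    using lower[OF that, of "- g"] sublinear_zero[OF q] by simp
  show "sublinear (shift_inf q G)"
    unfolding sublinear_def
  proof safe
    fix x y
    have 1: "shift_inf q G (x + y) - (q (y + h) - s) \<le> shift_inf q G x" if h: "(h, s) \<in> G" for h s
    proof (rule greatest)
      fix g r assume g: "(g, r) \<in> G"
      have "(g + h, r + s) \<in> G" using G g h unfolding real_cone_def by blast
      then have "shift_inf q G (x + y) \<le> q ((x + g) + (y + h)) - (r + s)"
        using lower[of "g + h" "r + s" "x + y"] by (simp add: algebra_simps)
      then show "shift_inf q G (x + y) - (q (y + h) - s) \<le> q (x + g) - r"
        using sublinear_add[OF q, of "x + g" "y + h"] by linarith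
    qed
    have "shift_inf q G (x + y) - shift_inf q G x \<le> shift_inf q G y"
      using 1 by (intro greatest) force
    then show "shift_inf q G (x + y) \<le> shift_inf q G x + shift_inf q G y" by simp
  next
    fix t :: real and x assume t: "0 < t"
    have "1 / t * shift_inf q G (complex_of_real t *\<^sub>C x) \<le> shift_inf q G x"
    proof (rule greatest)
      fix g r assume "(g, r) \<in> G"
      then have "(complex_of_real t *\<^sub>C g, t * r) \<in> G"
        using G t unfolding real_cone_def by blast
      then have "shift_inf q G (complex_of_real t *\<^sub>C x) \<le> q (complex_of_real t *\<^sub>C (x + g)) - t * r"
        using lower[of _ _ "complex_of_real t *\<^sub>C x"] by (simp add: scaleC_add_right)
      then show "1 / t * shift_inf q G (complex_of_real t *\<^sub>C x) \<le> q (x + g) - r"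
        using t sublinear_scale[OF q t, of "x + g"] by (simp add: field_simps)
    qed
    then show "shift_inf q G (complex_of_real t *\<^sub>C x) \<le> t * shift_inf q G x"
      using t by (simp add: field_simps)
  qed
qed

text \<open>Zorn's lemma applies because a chain of sublinear functionals below \<open>q\<close> is bounded below at \<open>x\<close>
  by \<open>- q (- x)\<close>, so that its pointwise infimum exists.\<close>

lemma ex_minimal_sublinear:
  assumes q: "sublinear q"
  obtains p where "sublinear p" "p \<le> q" "\<And>p'. sublinear p' \<Longrightarrow> p' \<le> p \<Longrightarrow> p' = p"
proof -
  define A where "A = {p. sublinear p \<and> p \<le> q}"
  have "\<exists>m\<in>A. \<forall>a\<in>A. m \<ge> a \<longrightarrow> a = m"
  proof (rule predicate_Zorn)
    show "partial_order_on A (relation_of (\<ge>) A)"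
      by (rule partial_order_on_relation_ofI) auto
  next
    fix C assume "C \<in> Chains (relation_of (\<ge>) A)"
    then have CA: "C \<subseteq> A" and total: "\<And>a b. a \<in> C \<Longrightarrow> b \<in> C \<Longrightarrow> a \<le> b \<or> b \<le> a"
      unfolding Chains_def relation_of_def by auto
    show "\<exists>u\<in>A. \<forall>a\<in>C. a \<ge> u"
    proof (cases "C = {}")
      case True
      then show ?thesis using q by (auto simp: A_def intro!: bexI[of _ q])
    next
      case False
      define u where "u x = (INF p\<in>C. p x)" for x
      have sub: "sublinear p" "p \<le> q" if "p \<in> C" for p
        using that CA by (auto simp: A_def)
      have bdd: "bdd_below ((\<lambda>p. p x) ` C)" for x
      proof (rule bdd_belowI2[of _ "- q (- x)"])
        fix p assume "p \<in> C"
        then show "- q (- x) \<le> p x"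
          using sublinear_minus[OF sub(1), of p x] le_funD[OF sub(2), of p "- x"] by simp
      qed
      have lower: "u x \<le> p x" if "p \<in> C" for p x
        unfolding u_def by (rule cINF_lower[OF bdd that])
      have greatest: "c \<le> u x" if "\<And>p. p \<in> C \<Longrightarrow> c \<le> p x" for c x
        unfolding u_def using that by (intro cINF_greatest False)
      have "sublinear u"
        unfolding sublinear_def
      proof safe
        fix x y
        have 1: "u (x + y) - p' y \<le> u x" if p': "p' \<in> C" for p'
        proof (rule greatest)
          fix p assume p: "p \<in> C"
          obtain p0 where "p0 \<in> C" "p0 \<le> p" "p0 \<le> p'"
            using total[OF p p'] p p' by blast
          then have "u (x + y) \<le> p x + p' y"
            using lower[of p0 "x + y"] sublinear_add[OF sub(1), of p0 x y]
            by (smt (verit) le_funD)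
          then show "u (x + y) - p' y \<le> p x" by simp
        qed
        have "u (x + y) - u x \<le> u y"
          using 1 by (intro greatest) force
        then show "u (x + y) \<le> u x + u y" by simp
      next
        fix t :: real and x assume t: "0 < t"
        have "1 / t * u (complex_of_real t *\<^sub>C x) \<le> u x"
        proof (rule greatest)
          fix p assume "p \<in> C"
          then have "u (complex_of_real t *\<^sub>C x) \<le> t * p x"
            using lower[of p "complex_of_real t *\<^sub>C x"] sublinear_scale[OF sub(1) t, of p x] by simp
          then show "1 / t * u (complex_of_real t *\<^sub>C x) \<le> p x"
            using t by (simp add: field_simps)
        qed
        then show "u (complex_of_real t *\<^sub>C x) \<le> t * u x"
          using t by (simp add: field_simps)
      qed
      moreover obtain p where "p \<in> C" using False by blast
      then have "u \<le> q"
        using lower[of p] sub(2)[of p] by (auto simp: le_fun_def intro: order_trans)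
      ultimately have "u \<in> A" by (simp add: A_def)
      then show ?thesis using lower by (auto simp: le_fun_def)
    qed
  qed
  then obtain m where m: "sublinear m" "m \<le> q" "\<forall>a\<in>A. a \<le> m \<longrightarrow> a = m"
    by (auto simp: A_def)
  show thesis
  proof (rule that[OF m(1,2)])
    fix p' :: "'a \<Rightarrow> real" assume "sublinear p'" "p' \<le> m"
    then show "p' = m" using m(2,3) by (auto simp: A_def intro: order_trans)
  qed
qed

text \<open>The pairs \<open>(t y, t p y)\<close> form a cone.  Absorbing it into \<open>p\<close> pushes the value at \<open>- y\<close> down to
  \<open>- p y\<close>, but by minimality it does not change \<open>p\<close>.\<close>

lemma minimal_sublinear_minus:
  assumes p: "sublinear p" and min: "\<And>p'. sublinear p' \<Longrightarrow> p' \<le> p \<Longrightarrow> p' = p"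
  shows "p (- y) = - p y"
proof -
  define G where "G = {(complex_of_real t *\<^sub>C y, t * p y) | t. 0 \<le> t}"
  have G: "real_cone G"
    unfolding real_cone_def
  proof (intro conjI allI impI)
    show "(0, 0) \<in> G"
      by (auto simp: G_def intro!: exI[of _ 0])
  next
    fix g h r s assume "(g, r) \<in> G" "(h, s) \<in> G"
    then obtain t t' where "0 \<le> t" "0 \<le> t'" "g = complex_of_real t *\<^sub>C y" "r = t * p y"
      "h = complex_of_real t' *\<^sub>C y" "s = t' * p y"
      by (auto simp: G_def)
    then show "(g + h, r + s) \<in> G"
      by (auto simp: G_def scaleC_add_left distrib_right intro!: exI[of _ "t + t'"])
  next
    fix t :: real and g r assume t: "0 < t" and "(g, r) \<in> G"
    then obtain t' where "0 \<le> t'" "g = complex_of_real t' *\<^sub>C y" "r = t' * p y"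
      by (auto simp: G_def)
    then show "(complex_of_real t *\<^sub>C g, t * r) \<in> G"
      using t by (auto simp: G_def scaleC_scaleC intro!: exI[of _ "t * t'"])
  qed
  have le: "r \<le> p g" if gr: "(g, r) \<in> G" for g r
  proof -
    obtain t where t: "0 \<le> t" "g = complex_of_real t *\<^sub>C y" "r = t * p y"
      using gr by (auto simp: G_def)
    then show ?thesis
      using sublinear_scale[OF p, of t y] sublinear_zero[OF p] by (cases "t = 0") auto
  qed
  have "shift_inf p G = p"
    using shift_inf[OF p G le] by (intro min) (auto simp: le_fun_def)
  moreover have "(y, p y) \<in> G"
    by (auto simp: G_def scaleC_one intro!: exI[of _ 1])
  ultimately have "p (- y) \<le> - p y"
    using shift_inf_minus_le[OF p G le, of y "p y"] by simp
  then show ?thesis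
    using sublinear_minus[OF p, of y] by simp
qed

text \<open>A form of the Hahn--Banach theorem going back to Mazur and Orlicz.  Absorbing the cone into
  the sublinear functional reduces it to the existence of a linear functional below a sublinear
  one, and a minimal sublinear functional is linear because absorbing any ray cannot lower it.\<close>

theorem ex_linear_between_cone_and_sublinear:
  assumes q: "sublinear q" and G: "real_cone G"
    and le: "\<And>g r. (g, r) \<in> G \<Longrightarrow> r \<le> q g"
  obtains L :: "'a::complex_vector \<Rightarrow> real"
  where "\<And>x y. L (x + y) = L x + L y" "\<And>x. L (- x) = - L x"
    and "\<And>t x. 0 \<le> t \<Longrightarrow> L (complex_of_real t *\<^sub>C x) = t * L x"
    and "\<And>x. L x \<le> q x" "\<And>g r. (g, r) \<in> G \<Longrightarrow> r \<le> L g"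
proof -
  obtain L where L: "sublinear L" "L \<le> shift_inf q G"
    and min: "\<And>p'. sublinear p' \<Longrightarrow> p' \<le> L \<Longrightarrow> p' = L"
    using ex_minimal_sublinear[OF sublinear_shift_inf[OF q G le]] by metis
  have minus: "L (- x) = - L x" for x
    using minimal_sublinear_minus[OF L(1) min] .
  show thesis
  proof (rule that[of L])
    fix x y :: 'a
    show "L (x + y) = L x + L y"
      using sublinear_add[OF L(1), of x y] sublinear_add[OF L(1), of "x + y" "- y"] minus[of y] by simp
    show "L (- x) = - L x" by (rule minus)
    show "L x \<le> q x"
      using L(2) shift_inf_le[OF q G le, of x] by (auto simp: le_fun_def intro: order_trans)
  next
    fix t :: real and x :: 'a assume "0 \<le> t"
    then show "L (complex_of_real t *\<^sub>C x) = t * L x"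
      using sublinear_scale[OF L(1), of t x] sublinear_zero[OF L(1)] by (cases "t = 0") auto
  next
    fix g r assume "(g, r) \<in> G"
    then have "L (- g) \<le> - r"
      using L(2) shift_inf_minus_le[OF q G le, of g r] by (auto simp: le_fun_def intro: order_trans)
    then show "r \<le> L g" using minus[of g] by simp
  qed
qed

section \<open>Orthonormalisation for semi-inner products\<close>

locale semi_inner =
  fixes s :: "'a::complex_vector \<Rightarrow> 'a \<Rightarrow> complex"
  assumes commute: "s x y = cnj (s y x)"
    and add_right: "s x (y + z) = s x y + s x z"
    and scale_right: "s x (a *\<^sub>C y) = a * s x y"
    and nonneg: "0 \<le> Re (s x x)"
begin

lemma zero_right [simp]: "s x 0 = 0"
  using scale_right[of x 0 0] by simp

lemma zero_left [simp]: "s 0 x = 0"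
  using commute[of 0 x] by simp

lemma self: "s x x = complex_of_real (Re (s x x))"
  using commute[of x x] by (metis Reals_cnj_iff of_real_Re)

lemma diff_right: "s x (y - z) = s x y - s x z"
  using add_right[of x "y - z" z] by simp

lemma sum_right: "s x (\<Sum>i\<in>I. a i *\<^sub>C y i) = (\<Sum>i\<in>I. a i * s x (y i))"
  by (induction I rule: infinite_finite_induct) (simp_all add: add_right scale_right)

lemma sum_left: "s (\<Sum>i\<in>I. a i *\<^sub>C y i) x = (\<Sum>i\<in>I. cnj (a i) * s (y i) x)"
  by (subst commute, subst sum_right) (simp add: commute[symmetric])

lemma scale_left: "s (a *\<^sub>C y) x = cnj a * s y x"
  by (subst commute, subst scale_right) (simp add: commute[symmetric])

lemma add_left: "s (y + z) x = s y x + s z x"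
  by (subst commute, subst add_right) (simp add: commute[symmetric])

text \<open>Vectors of seminorm zero are replaced by \<open>0\<close>; keeping them in the family makes its length
  independent of the rank of the form.\<close>

definition orthosystem :: "nat \<Rightarrow> (nat \<Rightarrow> 'a) \<Rightarrow> bool"
  where "orthosystem n e \<longleftrightarrow> (\<forall>i<n. \<forall>j<n. i \<noteq> j \<longrightarrow> s (e i) (e j) = 0) \<and>
    (\<forall>i<n. e i = 0 \<or> s (e i) (e i) = 1)"

lemma orthosystem_sum_self:
  assumes "orthosystem n e"
  shows "s (\<Sum>i<n. a i *\<^sub>C e i) (\<Sum>i<n. a i *\<^sub>C e i) = (\<Sum>i<n. (cmod (a i))\<^sup>2 * Re (s (e i) (e i)))"
proof -
  have "s (\<Sum>i<n. a i *\<^sub>C e i) (\<Sum>i<n. a i *\<^sub>C e i)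
      = (\<Sum>i<n. cnj (a i) * (\<Sum>j<n. a j * s (e i) (e j)))"
    unfolding sum_left by (simp add: sum_right)
  also have "\<dots> = (\<Sum>i<n. cnj (a i) * (\<Sum>j<n. if j = i then a i * s (e i) (e i) else 0))"
    using assms by (intro sum.cong refl arg_cong2[of _ _ _ _ "(*)"]) (auto simp: orthosystem_def)
  also have "\<dots> = (\<Sum>i<n. complex_of_real ((cmod (a i))\<^sup>2 * Re (s (e i) (e i))))"
    unfolding of_real_mult complex_norm_square
    by (intro sum.cong refl) (simp add: mult_ac self[symmetric])
  finally show ?thesis by simp
qed

lemma orthosystem_sum_le:
  assumes "orthosystem n e"
  shows "Re (s (\<Sum>i<n. a i *\<^sub>C e i) (\<Sum>i<n. a i *\<^sub>C e i)) \<le> (\<Sum>i<n. (cmod (a i))\<^sup>2)"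
proof -
  have "(cmod (a i))\<^sup>2 * Re (s (e i) (e i)) \<le> (cmod (a i))\<^sup>2" if "i < n" for i
    using assms that by (auto simp: orthosystem_def)
  then show ?thesis
    unfolding orthosystem_sum_self[OF assms] by (auto intro: sum_mono)
qed

text \<open>The Gram--Schmidt process.  Each \<open>v k\<close> is reproduced up to a vector of seminorm zero, and its
  coefficients have exactly the size of \<open>v k\<close>, since a coefficient against a zero member is zero.\<close>

lemma ex_orthosystem:
  "\<exists>e c. orthosystem n e \<and> (\<forall>k<n.
    (let w = v k - (\<Sum>i<n. c i k *\<^sub>C e i) in s w w = 0) \<and>
    (\<Sum>i<n. (cmod (c i k))\<^sup>2) = Re (s (v k) (v k)))"
proof (induction n)
  case 0
  then show ?case by (simp add: orthosystem_def)
next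
  case (Suc n)
  then obtain e c where e: "orthosystem n e"
    and null: "\<And>k. k < n \<Longrightarrow> let w = v k - (\<Sum>i<n. c i k *\<^sub>C e i) in s w w = 0"
    and size: "\<And>k. k < n \<Longrightarrow> (\<Sum>i<n. (cmod (c i k))\<^sup>2) = Re (s (v k) (v k))"
    by blast
  define b where "b i = s (e i) (v n)" for i
  define w where "w = v n - (\<Sum>i<n. b i *\<^sub>C e i)"
  define r where "r = sqrt (Re (s w w))"
  have r2: "r\<^sup>2 = Re (s w w)" by (simp add: r_def nonneg)
  define e' where "e' = e(n := if r = 0 then 0 else complex_of_real (1 / r) *\<^sub>C w)"
  define c' where "c' i k = (if k < n then if i < n then c i k else 0
    else if i < n then b i else complex_of_real r)" for i k
  have orth: "s (e i) w = 0" if "i < n" for i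
  proof -
    have "(\<Sum>j<n. b j * s (e i) (e j)) = (\<Sum>j<n. if j = i then b i * s (e i) (e i) else 0)"
      using e that by (intro sum.cong) (auto simp: orthosystem_def)
    then have "s (e i) w = b i - b i * s (e i) (e i)"
      using that by (simp add: w_def diff_right sum_right b_def)
    then show ?thesis
      using e that by (auto simp: orthosystem_def b_def)
  qed
  have orth': "s w (e i) = 0" if "i < n" for i
    using orth[OF that] commute[of w "e i"] by simp
  have unit: "s (e' n) (e' n) = 1" if "r \<noteq> 0"
  proof -
    have "s (e' n) (e' n) = complex_of_real (1 / r) * (complex_of_real (1 / r) * s w w)"
      using that by (simp add: e'_def scale_left scale_right)
    also have "s w w = complex_of_real (r\<^sup>2)"
      unfolding r2 by (rule self)
    finally show ?thesis using that by (simp add: power2_eq_square)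
  qed
  have "orthosystem (Suc n) e'"
    unfolding orthosystem_def
  proof (intro conjI allI impI)
    fix i j assume "i < Suc n" "j < Suc n" "i \<noteq> j"
    then show "s (e' i) (e' j) = 0"
      using e orth orth' by (auto simp: e'_def orthosystem_def scale_left scale_right less_Suc_eq)
  next
    fix i assume "i < Suc n"
    then show "e' i = 0 \<or> s (e' i) (e' i) = 1"
      using e unit by (cases "i = n") (auto simp: e'_def orthosystem_def less_Suc_eq)
  qed
  moreover have "let w = v k - (\<Sum>i<Suc n. c' i k *\<^sub>C e' i) in s w w = 0" if "k < Suc n" for k
  proof (cases "k = n")
    case True
    have "v k - (\<Sum>i<Suc n. c' i k *\<^sub>C e' i) = (if r = 0 then w else 0)"
      using True by (simp add: c'_def e'_def w_def scaleC_scaleC scaleC_one)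
    moreover have "s w w = 0" if "r = 0"
      using r2 that by (subst self) simp
    ultimately show ?thesis by simp
  next
    case False
    then have "(\<Sum>i<Suc n. c' i k *\<^sub>C e' i) = (\<Sum>i<n. c i k *\<^sub>C e i)"
      using that by (simp add: c'_def e'_def)
    then show ?thesis using null[of k] False that by simp
  qed
  moreover have "(\<Sum>i<Suc n. (cmod (c' i k))\<^sup>2) = Re (s (v k) (v k))" if "k < Suc n" for k
  proof (cases "k = n")
    case True
    let ?u = "\<Sum>i<n. b i *\<^sub>C e i"
    have v: "v n = ?u + w" by (simp add: w_def)
    have "s ?u w = 0" "s w ?u = 0"
      using orth orth' by (simp_all add: sum_left sum_right)
    then have "s (v n) (v n) = s ?u ?u + s w w"
      by (simp add: v add_left add_right)
    moreover have "Re (s ?u ?u) = (\<Sum>i<n. (cmod (b i))\<^sup>2)"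
      unfolding orthosystem_sum_self[OF e] using e
      by (auto simp: orthosystem_def b_def intro!: sum.cong)
    ultimately have "Re (s (v n) (v n)) = (\<Sum>i<n. (cmod (b i))\<^sup>2) + r\<^sup>2"
      by (simp add: r2)
    then show ?thesis using True by (simp add: c'_def)
  next
    case False
    then show ?thesis using size[of k] that by (simp add: c'_def)
  qed
  ultimately show ?case by blast
qed

end

interpretation cinner: semi_inner "cinner :: 'a::complex_hilbert \<Rightarrow> 'a \<Rightarrow> complex"
proof
  fix x :: 'a
  have "0 \<le> sqrt (Re (cinner x x))"
    unfolding norm_eq_sqrt_cinner[symmetric] by simp
  then show "0 \<le> Re (cinner x x)" by simp
qed (rule cinner_commute cinner_add_right cinner_scaleC_right)+

lemma norm_power2_eq_cinner: "(norm x)\<^sup>2 = Re (cinner x x)"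
  by (simp add: norm_eq_sqrt_cinner cinner.nonneg)

text \<open>A scalar matrix acts on tuples of vectors with the norm it has on scalars: expand the
  vectors in an orthonormal system and apply the scalar estimate to each coordinate.\<close>

lemma scalar_bound_vectors:
  fixes h :: "nat \<Rightarrow> 'a::complex_hilbert"
  assumes bound: "\<And>z. (\<Sum>j\<in>J. (cmod (\<Sum>l<n. b j l * z l))\<^sup>2) \<le> T * (\<Sum>l<n. (cmod (z l))\<^sup>2)"
  shows "(\<Sum>j\<in>J. (norm (\<Sum>l<n. b j l *\<^sub>C h l))\<^sup>2) \<le> T * (\<Sum>l<n. (norm (h l))\<^sup>2)"
proof -
  obtain e c where e: "cinner.orthosystem n e"
    and null: "\<And>k. k < n \<Longrightarrow> let w = h k - (\<Sum>i<n. c i k *\<^sub>C e i) in cinner w w = 0"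
    and size: "\<And>k. k < n \<Longrightarrow> (\<Sum>i<n. (cmod (c i k))\<^sup>2) = Re (cinner (h k) (h k))"
    using cinner.ex_orthosystem[of n h] by blast
  have h: "h k = (\<Sum>i<n. c i k *\<^sub>C e i)" if "k < n" for k
  proof -
    have "norm (h k - (\<Sum>i<n. c i k *\<^sub>C e i)) = 0"
      using null[OF that] by (simp add: norm_eq_sqrt_cinner Let_def)
    then show ?thesis by simp
  qed
  have "(\<Sum>l<n. b j l *\<^sub>C h l) = (\<Sum>i<n. (\<Sum>l<n. b j l * c i l) *\<^sub>C e i)" for j
  proof -
    have "(\<Sum>l<n. b j l *\<^sub>C h l) = (\<Sum>l<n. \<Sum>i<n. (b j l * c i l) *\<^sub>C e i)"
      by (simp add: h complex_vector.scale_sum_right scaleC_scaleC)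
    also have "\<dots> = (\<Sum>i<n. \<Sum>l<n. (b j l * c i l) *\<^sub>C e i)"
      by (rule sum.swap)
    finally show ?thesis by (simp add: complex_vector.scale_sum_left)
  qed
  then have "(\<Sum>j\<in>J. (norm (\<Sum>l<n. b j l *\<^sub>C h l))\<^sup>2) \<le> (\<Sum>j\<in>J. \<Sum>i<n. (cmod (\<Sum>l<n. b j l * c i l))\<^sup>2)"
    using cinner.orthosystem_sum_le[OF e]
    by (simp add: sum_mono norm_power2_eq_cinner[where 'a = 'a])
  also have "\<dots> = (\<Sum>i<n. \<Sum>j\<in>J. (cmod (\<Sum>l<n. b j l * c i l))\<^sup>2)"
    by (rule sum.swap)
  also have "\<dots> \<le> (\<Sum>i<n. T * (\<Sum>l<n. (cmod (c i l))\<^sup>2))"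
    by (intro sum_mono bound)
  also have "\<dots> = T * (\<Sum>l<n. \<Sum>i<n. (cmod (c i l))\<^sup>2)"
    unfolding sum_distrib_left[symmetric] by (subst sum.swap) simp
  also have "\<dots> = T * (\<Sum>l<n. (norm (h l))\<^sup>2)"
    by (simp add: size norm_power2_eq_cinner[where 'a = 'a])
  finally show ?thesis .
qed

section \<open>Matrices over operator spaces and over their duals\<close>

lemma L2_set_norm_scaleR:
  "L2_set (\<lambda>i. norm (r *\<^sub>R f i)) I = \<bar>r\<bar> * L2_set (\<lambda>i. norm (f i)) I"
  by (simp add: L2_set_right_distrib)

lemma bdd_above_op_mat:
  fixes T :: "nat \<Rightarrow> nat \<Rightarrow> 'h::complex_hilbert \<Rightarrow>\<^sub>L 'h"
  shows "bdd_above {L2_set (\<lambda>i. norm (\<Sum>j<n. blinfun_apply (T i j) (\<xi> j))) {..<n} | \<xi>.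
    L2_set (\<lambda>j. norm (\<xi> j)) {..<n} \<le> 1}"
proof (rule bdd_aboveI, clarify)
  fix \<xi> :: "nat \<Rightarrow> 'h"
  assume le: "L2_set (\<lambda>j. norm (\<xi> j)) {..<n} \<le> 1"
  have "L2_set (\<lambda>i. norm (\<Sum>j<n. T i j (\<xi> j))) {..<n} \<le> (\<Sum>i<n. norm (\<Sum>j<n. T i j (\<xi> j)))"
    by (rule L2_set_le_sum) simp
  also have "\<dots> \<le> (\<Sum>i<n. \<Sum>j<n. norm (T i j))"
  proof (intro sum_mono order_trans[OF norm_sum])
    fix i j assume "j \<in> {..<n}"
    then have "norm (\<xi> j) \<le> 1"
      using member_le_L2_set[of "{..<n}" j "\<lambda>j. norm (\<xi> j)"] le by simp
    then show "norm (T i j (\<xi> j)) \<le> norm (T i j)"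
      using norm_blinfun[of "T i j" "\<xi> j"] mult_left_le[of "norm (\<xi> j)" "norm (T i j)"] by simp
  qed
  finally show "L2_set (\<lambda>i. norm (\<Sum>j<n. T i j (\<xi> j))) {..<n} \<le> (\<Sum>i<n. \<Sum>j<n. norm (T i j))" .
qed

lemma L2_set_op_mat_le:
  fixes T :: "nat \<Rightarrow> nat \<Rightarrow> 'h::complex_hilbert \<Rightarrow>\<^sub>L 'h"
  shows "L2_set (\<lambda>i. norm (\<Sum>j<n. T i j (\<xi> j))) {..<n} \<le> op_mat_norm n T * L2_set (\<lambda>j. norm (\<xi> j)) {..<n}"
proof (cases "L2_set (\<lambda>j. norm (\<xi> j)) {..<n} = 0")
  case True
  then have "\<forall>j<n. \<xi> j = 0"
    by (simp add: L2_set_eq_0_iff)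
  then show ?thesis
    by (simp add: True)
next
  case False
  define t where "t = L2_set (\<lambda>j. norm (\<xi> j)) {..<n}"
  have t: "t > 0"
    using False L2_set_nonneg[of "\<lambda>j. norm (\<xi> j)" "{..<n}"] unfolding t_def by linarith
  define \<eta> where "\<eta> j = (1 / t) *\<^sub>R \<xi> j" for j
  have "L2_set (\<lambda>j. norm (\<eta> j)) {..<n} \<le> 1"
    unfolding \<eta>_def L2_set_norm_scaleR using t by (simp add: t_def)
  then have "L2_set (\<lambda>i. norm (\<Sum>j<n. T i j (\<eta> j))) {..<n} \<le> op_mat_norm n T"
    unfolding op_mat_norm_def by (intro cSup_upper bdd_above_op_mat) auto
  moreover have "L2_set (\<lambda>i. norm (\<Sum>j<n. T i j (\<eta> j))) {..<n}
      = L2_set (\<lambda>i. norm ((1 / t) *\<^sub>R (\<Sum>j<n. T i j (\<xi> j)))) {..<n}"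
    by (simp add: \<eta>_def scaleR_right.sum blinfun.scaleR_right del: norm_scaleR)
  ultimately have "(1 / t) * L2_set (\<lambda>i. norm (\<Sum>j<n. T i j (\<xi> j))) {..<n} \<le> op_mat_norm n T"
    unfolding L2_set_norm_scaleR using t by simp
  then show ?thesis
    using t by (simp add: t_def[symmetric] field_simps)
qed

lemma op_mat_norm_le:
  fixes T :: "nat \<Rightarrow> nat \<Rightarrow> 'h::complex_hilbert \<Rightarrow>\<^sub>L 'h"
  assumes "\<And>\<xi>. L2_set (\<lambda>j. norm (\<xi> j)) {..<n} \<le> 1 \<Longrightarrow>
    L2_set (\<lambda>i. norm (\<Sum>j<n. T i j (\<xi> j))) {..<n} \<le> c"
  shows "op_mat_norm n T \<le> c"
  unfolding op_mat_norm_def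
proof (rule cSup_least)
  show "{L2_set (\<lambda>i. norm (\<Sum>j<n. T i j (\<xi> j))) {..<n} |\<xi>. L2_set (\<lambda>j. norm (\<xi> j)) {..<n} \<le> 1} \<noteq> {}"
    by (auto intro!: exI[of _ "\<lambda>_. 0"])
qed (use assms in auto)

lemma points_opspace [simp]: "points (opspace X) = X"
  and mnorm_opspace [simp]: "mnorm (opspace X) = op_mat_norm"
  by (simp_all add: opspace_def)

lemma mat_ball_opspaceD:
  assumes "x \<in> mat_ball (opspace X) n"
  shows "i < n \<Longrightarrow> j < n \<Longrightarrow> x i j \<in> X"
    and "L2_set (\<lambda>i. norm (\<Sum>j<n. x i j (\<xi> j))) {..<n} \<le> L2_set (\<lambda>j. norm (\<xi> j)) {..<n}"
proof -
  have "op_mat_norm n x * L2_set (\<lambda>j. norm (\<xi> j)) {..<n} \<le> 1 * L2_set (\<lambda>j. norm (\<xi> j)) {..<n}"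
    using assms by (intro mult_right_mono) (auto simp: mat_ball_def)
  then show "L2_set (\<lambda>i. norm (\<Sum>j<n. x i j (\<xi> j))) {..<n} \<le> L2_set (\<lambda>j. norm (\<xi> j)) {..<n}"
    using L2_set_op_mat_le[where n = n and T = x and \<xi> = \<xi>] by simp
qed (use assms in \<open>auto simp: mat_ball_def matrices_def\<close>)

lemma mat_ball_opspaceI:
  fixes x :: "nat \<Rightarrow> nat \<Rightarrow> 'h::complex_hilbert \<Rightarrow>\<^sub>L 'h"
  assumes "\<And>i j. i < n \<Longrightarrow> j < n \<Longrightarrow> x i j \<in> X"
    and "\<And>\<xi>. L2_set (\<lambda>i. norm (\<Sum>j<n. x i j (\<xi> j))) {..<n} \<le> L2_set (\<lambda>j. norm (\<xi> j)) {..<n}"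
  shows "x \<in> mat_ball (opspace X) n"
  using assms(1) order_trans[OF assms(2)]
  by (auto simp: mat_ball_def matrices_def intro!: op_mat_norm_le)

lemma operator_spaceD:
  assumes "operator_space X"
  shows "csubspace X" "T \<in> X \<Longrightarrow> T (a *\<^sub>C \<xi>) = a *\<^sub>C T \<xi>"
  using assms by (auto simp: operator_space_def clinear_on_def)

lemma blinfun_apply_scaleC: "blinfun_apply (a *\<^sub>C T) \<xi> = a *\<^sub>C blinfun_apply T \<xi>"
  by (simp add: scaleC_blinfun.rep_eq)

lemma zero_in_mat_ball_opspace:
  assumes "operator_space X"
  shows "(\<lambda>_ _. 0) \<in> mat_ball (opspace X) n"
  using complex_vector.subspace_0[OF operator_spaceD(1)[OF assms]]
  by (intro mat_ball_opspaceI) simp_all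

lemma scaled_in_mat_ball_opspace:
  assumes "operator_space X" "x \<in> X"
  obtains t where "0 < t" "(\<lambda>_ _. complex_of_real t *\<^sub>C x) \<in> mat_ball (opspace X) 1"
proof (rule that)
  define t where "t = 1 / (norm x + 1)"
  show t: "0 < t" by (simp add: t_def add_nonneg_pos)
  show "(\<lambda>_ _. complex_of_real t *\<^sub>C x) \<in> mat_ball (opspace X) 1"
  proof (rule mat_ball_opspaceI)
    show "complex_of_real t *\<^sub>C x \<in> X"
      using assms by (intro complex_vector.subspace_scale operator_spaceD)
  next
    fix \<xi> :: "nat \<Rightarrow> 'a"
    have "t * norm (x (\<xi> 0)) \<le> t * (norm x * norm (\<xi> 0))"
      using t by (intro mult_left_mono norm_blinfun) simp
    also have "\<dots> \<le> norm (\<xi> 0)"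
      by (simp add: t_def divide_simps add_nonneg_pos) (simp add: algebra_simps)
    finally show "L2_set (\<lambda>i. norm (\<Sum>j<1. (complex_of_real t *\<^sub>C x) (\<xi> j))) {..<1::nat} \<le> L2_set (\<lambda>j. norm (\<xi> j)) {..<1}"
      using t by (simp add: L2_set_def blinfun_apply_scaleC norm_scaleC)
  qed
qed

lemma clinear_on_sum:
  assumes "csubspace S" "clinear_on S f" "\<And>i. i \<in> I \<Longrightarrow> x i \<in> S"
  shows "f (\<Sum>i\<in>I. a i *\<^sub>C x i) = (\<Sum>i\<in>I. a i *\<^sub>C f (x i))"
proof -
  have zero: "f 0 = 0"
    using assms(2) complex_vector.subspace_0[OF assms(1)]
    by (metis clinear_on_def complex_vector.scale_zero_left)
  show ?thesis
    using assms(3)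
  proof (induction I rule: infinite_finite_induct)
    case (insert i I)
    then have "(\<Sum>i\<in>I. a i *\<^sub>C x i) \<in> S" "a i *\<^sub>C x i \<in> S"
      using assms(1) by (auto intro: complex_vector.subspace_sum complex_vector.subspace_scale)
    then show ?case
      using insert assms(2) by (simp add: clinear_on_def)
  qed (simp_all add: zero)
qed

lemma clinear_on_add_fun:
  "clinear_on S f \<Longrightarrow> clinear_on S g \<Longrightarrow> clinear_on S (f + g)"
  by (auto simp: clinear_on_def complex_vector.scale_right_distrib)

lemma clinear_on_scale_fun:
  "clinear_on S f \<Longrightarrow> clinear_on S (a *\<^sub>C f)"
  by (auto simp: clinear_on_def scaleC_fun_def complex_vector.scale_right_distrib scaleC_scaleC mult.commute)

lemma points_dual:
  "f \<in> points (dual V) \<longleftrightarrow> clinear_on (points V) f \<and> (\<forall>x. x \<notin> points V \<longrightarrow> f x = 0) \<and>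
    (\<exists>C. \<forall>n>0. \<forall>v\<in>mat_ball V n. scalar_mat_norm {..<n} (\<lambda>i j. f (v i j)) \<le> C)"
proof -
  have "bdd_above (cb_values V 1 (\<lambda>_ _. f)) \<longleftrightarrow>
    (\<exists>C. \<forall>n>0. \<forall>v\<in>mat_ball V n. scalar_mat_norm {..<n} (\<lambda>i j. f (v i j)) \<le> C)"
    unfolding cb_values_def block_norm_one_right bdd_above_def by blast
  then show ?thesis
    by (auto simp: dual_def CB_def)
qed

lemma csubspace_points_dual: "csubspace (points (dual V))"
proof (rule complex_vector.subspaceI)
  show "0 \<in> points (dual V)"
    by (auto simp: points_dual clinear_on_def intro!: exI[of _ 0] scalar_mat_norm_le_bilinear)
next
  fix f g assume f: "f \<in> points (dual V)" and g: "g \<in> points (dual V)"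
  obtain C D where
    C: "\<And>n v. n > 0 \<Longrightarrow> v \<in> mat_ball V n \<Longrightarrow> scalar_mat_norm {..<n} (\<lambda>i j. f (v i j)) \<le> C" and
    D: "\<And>n v. n > 0 \<Longrightarrow> v \<in> mat_ball V n \<Longrightarrow> scalar_mat_norm {..<n} (\<lambda>i j. g (v i j)) \<le> D"
    using f g unfolding points_dual by metis
  have "scalar_mat_norm {..<n} (\<lambda>i j. (f + g) (v i j)) \<le> C + D" if "n > 0" "v \<in> mat_ball V n" for n v
    using scalar_mat_norm_add_le[of "{..<n}" "\<lambda>i j. f (v i j)" "\<lambda>i j. g (v i j)"] C[OF that] D[OF that]
    by simp
  then show "f + g \<in> points (dual V)"
    using f g unfolding points_dual by (auto intro: clinear_on_add_fun)
next
  fix a f assume f: "f \<in> points (dual V)"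
  obtain C where
    C: "\<And>n v. n > 0 \<Longrightarrow> v \<in> mat_ball V n \<Longrightarrow> scalar_mat_norm {..<n} (\<lambda>i j. f (v i j)) \<le> C"
    using f unfolding points_dual by metis
  have "scalar_mat_norm {..<n} (\<lambda>i j. (a *\<^sub>C f) (v i j)) \<le> cmod a * C" if "n > 0" "v \<in> mat_ball V n" for n v
    using scalar_mat_norm_cmult_le[of "{..<n}" a "\<lambda>i j. f (v i j)"] mult_left_mono[OF C[OF that], of "cmod a"]
    by (simp add: scaleC_fun_def scaleC_complex_def)
  then show "a *\<^sub>C f \<in> points (dual V)"
    using f clinear_on_scale_fun[of "points V" f a] unfolding points_dual
    by (auto simp: scaleC_fun_def[of a f])
qed

lemma CB_entries_dual:
  assumes "\<And>k l. k < p \<Longrightarrow> l < p \<Longrightarrow> f k l \<in> points (dual V)"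
  shows "f \<in> CB V p"
proof -
  have "\<forall>k l. \<exists>C. k < p \<longrightarrow> l < p \<longrightarrow> (\<forall>n>0. \<forall>v\<in>mat_ball V n. scalar_mat_norm {..<n} (\<lambda>i j. f k l (v i j)) \<le> C)"
    using assms unfolding points_dual by blast
  then obtain C where C: "\<And>k l n v. k < p \<Longrightarrow> l < p \<Longrightarrow> n > 0 \<Longrightarrow> v \<in> mat_ball V n \<Longrightarrow>
      scalar_mat_norm {..<n} (\<lambda>i j. f k l (v i j)) \<le> C k l"
    by metis
  have "block_norm n p (\<lambda>i j k l. f k l (v i j)) \<le> (\<Sum>k<p. \<Sum>l<p. C k l)" if "n > 0" "v \<in> mat_ball V n" for n v
    using C that by (intro order_trans[OF block_norm_le_sum_entries] sum_mono) simp
  then have "bdd_above (cb_values V p f)"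
    unfolding cb_values_def bdd_above_def by blast
  then show ?thesis
    using assms by (simp add: CB_def points_dual)
qed

lemma cb_norm_le_iff:
  assumes "mat_ball V 1 \<noteq> {}" "bdd_above (cb_values V p F)"
  shows "cb_norm V p F \<le> c \<longleftrightarrow> (\<forall>n>0. \<forall>v\<in>mat_ball V n. block_norm n p (\<lambda>i j k l. F k l (v i j)) \<le> c)"
proof -
  have "cb_values V p F \<noteq> {}"
    using assms(1) by (fastforce simp: cb_values_def)
  then have "cb_norm V p F \<le> c \<longleftrightarrow> (\<forall>r\<in>cb_values V p F. r \<le> c)"
    unfolding cb_norm_def using assms(2) by (rule cSup_le_iff)
  then show ?thesis by (auto simp: cb_values_def)
qed

lemma CB_ball_iff:
  assumes "mat_ball V 1 \<noteq> {}"
  shows "F \<in> CB_ball V p \<longleftrightarrow> (\<forall>k<p. \<forall>l<p. clinear_on (points V) (F k l)) \<and>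
    (\<forall>n>0. \<forall>v\<in>mat_ball V n. block_norm n p (\<lambda>i j k l. F k l (v i j)) \<le> 1)"
    (is "_ \<longleftrightarrow> ?lin \<and> ?bound")
proof -
  have "?bound \<Longrightarrow> bdd_above (cb_values V p F)"
    unfolding cb_values_def bdd_above_def by blast
  then show ?thesis
    using cb_norm_le_iff[OF assms, of p F 1] by (auto simp: CB_ball_def CB_def)
qed

lemma mat_ball_dual_iff:
  assumes "mat_ball V 1 \<noteq> {}"
  shows "f \<in> mat_ball (dual V) p \<longleftrightarrow> (\<forall>k<p. \<forall>l<p. f k l \<in> points (dual V)) \<and>
    (\<forall>n>0. \<forall>v\<in>mat_ball V n. block_norm n p (\<lambda>i j k l. f k l (v i j)) \<le> 1)"
proof -
  have "mnorm (dual V) = cb_norm V" by (simp add: dual_def)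
  moreover have "bdd_above (cb_values V p f)" if "\<forall>k<p. \<forall>l<p. f k l \<in> points (dual V)"
    using CB_entries_dual[of p f V] that by (simp add: CB_def)
  ultimately show ?thesis
    using cb_norm_le_iff[OF assms, of p f 1] by (auto simp: mat_ball_def matrices_def)
qed

lemma mat_ball_dual_nonempty:
  assumes "mat_ball V 1 \<noteq> {}"
  shows "mat_ball (dual V) 1 \<noteq> {}"
proof -
  have "(\<lambda>_ _. 0) \<in> mat_ball (dual V) 1"
    unfolding mat_ball_dual_iff[OF assms]
    using complex_vector.subspace_0[OF csubspace_points_dual]
    by (auto simp: block_norm_def intro!: scalar_mat_norm_le_bilinear)
  then show ?thesis by blast
qed

text \<open>Evaluation at a matrix in the ball of \<open>V\<close> is completely contractive on the dual: the norm of
  the matrix of all values does not depend on which of the two index pairs is the outer one.\<close>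

lemma evaluation_in_CB_ball:
  assumes "0 < n" "x \<in> mat_ball V n"
    and ne: "mat_ball V 1 \<noteq> {}"
  shows "(\<lambda>k l f. f (x k l)) \<in> CB_ball (dual V) n"
  unfolding CB_ball_iff[OF mat_ball_dual_nonempty[OF ne]]
proof (intro conjI allI impI ballI)
  fix m :: nat and f assume "0 < m" "f \<in> mat_ball (dual V) m"
  then have "block_norm n m (\<lambda>i j k l. f k l (x i j)) \<le> 1"
    using assms by (simp add: mat_ball_dual_iff[OF ne])
  then show "block_norm m n (\<lambda>i j k l. f i j (x k l)) \<le> 1"
    by (subst block_norm_swap)
qed (simp add: clinear_on_def scaleC_fun_def)

lemma mat_ball_pair:
  assumes "mat_ball V 1 \<noteq> {}" "f \<in> mat_ball (dual V) m" "0 < m" "F \<in> CB_ball (dual V) p"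
  shows "block_norm m p (\<lambda>i j k l. F k l (f i j)) \<le> 1"
  using assms by (simp add: CB_ball_iff[OF mat_ball_dual_nonempty[OF assms(1)]])

section \<open>Quadratic forms dominating a functional on matrices\<close>

definition qform :: "nat \<Rightarrow> (nat \<Rightarrow> nat \<Rightarrow> complex) \<Rightarrow> (nat \<Rightarrow> complex) \<Rightarrow> real"
  where "qform p A z = Re (\<Sum>k<p. \<Sum>l<p. cnj (z k) * A k l * z l)"

text \<open>The positive part of the largest eigenvalue of the self-adjoint part of a matrix.\<close>

definition herm_max :: "nat \<Rightarrow> (nat \<Rightarrow> nat \<Rightarrow> complex) \<Rightarrow> real"
  where "herm_max p A = Sup {qform p A z | z. L2_set (\<lambda>k. cmod (z k)) {..<p} \<le> 1}"

lemma qform_add: "qform p (A + B) z = qform p A z + qform p B z"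
  by (simp add: qform_def ring_distribs sum.distrib)

lemma qform_scale: "qform p (complex_of_real t *\<^sub>C A) z = t * qform p A z"
proof -
  have "(\<Sum>k<p. \<Sum>l<p. cnj (z k) * (complex_of_real t *\<^sub>C A) k l * z l)
      = complex_of_real t * (\<Sum>k<p. \<Sum>l<p. cnj (z k) * A k l * z l)"
    by (simp add: scaleC_fun_def scaleC_complex_def sum_distrib_left mult_ac)
  then show ?thesis by (simp add: qform_def)
qed

lemma herm_max_upper:
  assumes "L2_set (\<lambda>k. cmod (z k)) {..<p} \<le> 1"
  shows "qform p A z \<le> herm_max p A"
proof -
  have "bdd_above {qform p A z | z. L2_set (\<lambda>k. cmod (z k)) {..<p} \<le> 1}"
  proof (rule bdd_aboveI, clarify)
    fix z :: "nat \<Rightarrow> complex"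
    assume le: "L2_set (\<lambda>k. cmod (z k)) {..<p} \<le> 1"
    have "qform p A z \<le> cmod (\<Sum>k<p. \<Sum>l<p. cnj (z k) * A k l * z l)"
      unfolding qform_def by (rule complex_Re_le_cmod)
    also have "\<dots> \<le> scalar_mat_norm {..<p} A
        * (L2_set (\<lambda>k. cmod (cnj (z k))) {..<p} * L2_set (\<lambda>k. cmod (z k)) {..<p})"
      by (rule cmod_bilinear_le) simp
    also have "\<dots> \<le> scalar_mat_norm {..<p} A"
      using le by (simp add: mult_left_le mult_le_one scalar_mat_norm_nonneg)
    finally show "qform p A z \<le> scalar_mat_norm {..<p} A" .
  qed
  then show ?thesis
    unfolding herm_max_def using assms by (intro cSup_upper) auto
qed

lemma herm_max_le:
  assumes "\<And>z. L2_set (\<lambda>k. cmod (z k)) {..<p} \<le> 1 \<Longrightarrow> qform p A z \<le> c"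
  shows "herm_max p A \<le> c"
  unfolding herm_max_def
proof (rule cSup_least)
  show "{qform p A z |z. L2_set (\<lambda>k. cmod (z k)) {..<p} \<le> 1} \<noteq> {}"
    by (auto intro!: exI[of _ "\<lambda>_. 0"])
qed (use assms in auto)

lemma herm_max_nonneg: "0 \<le> herm_max p A"
  using herm_max_upper[of "\<lambda>_. 0" p A] by (simp add: qform_def)

lemma herm_max_zero [simp]: "herm_max p 0 = 0"
  by (rule antisym[OF herm_max_le herm_max_nonneg]) (simp add: qform_def)

lemma sublinear_herm_max: "sublinear (herm_max p)"
  unfolding sublinear_def
proof safe
  show "herm_max p (A + B) \<le> herm_max p A + herm_max p B" for A B
    by (rule herm_max_le) (simp add: qform_add add_mono herm_max_upper)
  show "herm_max p (complex_of_real t *\<^sub>C A) \<le> t * herm_max p A" if "0 < t" for t A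
    using that by (intro herm_max_le) (simp add: qform_scale herm_max_upper)
qed

lemma qform_le_herm_max:
  "qform p A z \<le> herm_max p A * (\<Sum>k<p. (cmod (z k))\<^sup>2)"
proof (cases "L2_set (\<lambda>k. cmod (z k)) {..<p} = 0")
  case True
  then have "\<forall>k<p. z k = 0"
    by (simp add: L2_set_eq_0_iff)
  then show ?thesis by (simp add: qform_def)
next
  case False
  define t where "t = L2_set (\<lambda>k. cmod (z k)) {..<p}"
  have t: "t > 0"
    using False L2_set_nonneg[of "\<lambda>k. cmod (z k)" "{..<p}"] unfolding t_def by linarith
  have "L2_set (\<lambda>k. cmod (complex_of_real (1 / t) * z k)) {..<p} \<le> 1"
    unfolding L2_set_cmod_mult using t by (simp add: t_def norm_divide)
  then have "qform p A (\<lambda>k. complex_of_real (1 / t) * z k) \<le> herm_max p A"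
    by (rule herm_max_upper)
  moreover have "qform p A (\<lambda>k. complex_of_real (1 / t) * z k) = (1 / t)\<^sup>2 * qform p A z"
  proof -
    have "(\<Sum>k<p. \<Sum>l<p. cnj (complex_of_real (1 / t) * z k) * A k l * (complex_of_real (1 / t) * z l))
        = complex_of_real ((1 / t)\<^sup>2) * (\<Sum>k<p. \<Sum>l<p. cnj (z k) * A k l * z l)"
      by (simp add: sum_distrib_left power2_eq_square mult_ac)
    then show ?thesis by (simp add: qform_def)
  qed
  ultimately have "(1 / t)\<^sup>2 * qform p A z \<le> herm_max p A"
    by (simp only:)
  then have "qform p A z \<le> herm_max p A * t\<^sup>2"
    using t by (simp add: power_divide pos_divide_le_eq)
  then show ?thesis by (simp add: t_def L2_set_power2)
qed

text \<open>The matrix \<open>\<alpha>\<^sup>* \<alpha>\<close>, where the rows of \<open>\<alpha>\<close> are \<open>\<alpha> 0, \<dots>, \<alpha> (m - 1)\<close>.\<close>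

definition gram :: "nat \<Rightarrow> (nat \<Rightarrow> nat \<Rightarrow> complex) \<Rightarrow> nat \<Rightarrow> nat \<Rightarrow> complex"
  where "gram m \<alpha> k l = (\<Sum>i<m. cnj (\<alpha> i k) * \<alpha> i l)"

definition rank_one :: "(nat \<Rightarrow> complex) \<Rightarrow> (nat \<Rightarrow> complex) \<Rightarrow> nat \<Rightarrow> nat \<Rightarrow> complex"
  where "rank_one a b k l = cnj (a k) * b l"

lemma rank_one_form:
  "(\<Sum>k<p. \<Sum>l<p. cnj (z k) * rank_one a b k l * z l) = cnj (\<Sum>k<p. a k * z k) * (\<Sum>k<p. b k * z k)"
  unfolding cnj_sum sum_product by (simp add: rank_one_def mult_ac)

lemma qform_rank_one:
  "qform p (rank_one a b) z = Re (cnj (\<Sum>k<p. a k * z k) * (\<Sum>k<p. b k * z k))"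
  by (simp only: qform_def rank_one_form)

lemma qform_scale_rank_one:
  "qform p (c *\<^sub>C rank_one a b) z = Re (c * (cnj (\<Sum>k<p. a k * z k) * (\<Sum>k<p. b k * z k)))"
  unfolding qform_def rank_one_form[symmetric]
  by (simp add: scaleC_fun_def scaleC_complex_def sum_distrib_left mult_ac)

lemma gram_Suc: "gram (Suc m) \<alpha> = gram m \<alpha> + rank_one (\<alpha> m) (\<alpha> m)"
  by (simp add: fun_eq_iff gram_def rank_one_def)

lemma gram_zero: "gram 0 \<alpha> = 0"
  by (simp add: fun_eq_iff gram_def)

lemma qform_gram: "qform p (gram m \<alpha>) z = (\<Sum>i<m. (cmod (\<Sum>k<p. \<alpha> i k * z k))\<^sup>2)"
proof (induction m)
  case 0
  then show ?case by (simp add: gram_zero qform_def)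
next
  case (Suc m)
  have "cnj w * w = complex_of_real ((cmod w)\<^sup>2)" for w
    unfolding complex_norm_square by (simp add: mult.commute)
  then show ?case
    using Suc unfolding gram_Suc qform_add qform_rank_one by (simp del: cnj_sum)
qed

lemma gram_bound:
  "(\<Sum>i<m. (cmod (\<Sum>k<p. \<alpha> i k * z k))\<^sup>2) \<le> herm_max p (gram m \<alpha>) * (\<Sum>k<p. (cmod (z k))\<^sup>2)"
  unfolding qform_gram[symmetric] by (rule qform_le_herm_max)

lemma transpose_bound:
  assumes bound: "\<And>z. (\<Sum>j\<in>J. (cmod (\<Sum>l\<in>L. b j l * z l))\<^sup>2) \<le> T * (\<Sum>l\<in>L. (cmod (z l))\<^sup>2)"
    and "0 \<le> T"
  shows "(\<Sum>l\<in>L. (cmod (\<Sum>j\<in>J. b j l * w j))\<^sup>2) \<le> T * (\<Sum>j\<in>J. (cmod (w j))\<^sup>2)"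
proof -
  define u where "u l = (\<Sum>j\<in>J. b j l * w j)" for l
  define U where "U = (\<Sum>l\<in>L. (cmod (u l))\<^sup>2)"
  define W where "W = (\<Sum>j\<in>J. (cmod (w j))\<^sup>2)"
  have U0: "0 \<le> U" and W0: "0 \<le> W"
    by (simp_all add: U_def W_def sum_nonneg)
  have "complex_of_real U = (\<Sum>l\<in>L. cnj (u l) * u l)"
    unfolding sum_mult_cnj_self L2_set_power2 U_def ..
  also have "\<dots> = (\<Sum>l\<in>L. \<Sum>j\<in>J. cnj (u l) * (b j l * w j))"
    by (simp add: u_def sum_distrib_left)
  also have "\<dots> = (\<Sum>j\<in>J. \<Sum>l\<in>L. cnj (u l) * (b j l * w j))"
    by (rule sum.swap)
  also have "\<dots> = (\<Sum>j\<in>J. w j * (\<Sum>l\<in>L. b j l * cnj (u l)))"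
    by (simp add: sum_distrib_left mult_ac)
  finally have "U \<le> cmod (\<Sum>j\<in>J. w j * (\<Sum>l\<in>L. b j l * cnj (u l)))"
    using U0 by (metis norm_of_real abs_of_nonneg order_refl)
  also have "\<dots> \<le> L2_set (\<lambda>j. cmod (w j)) J * L2_set (\<lambda>j. cmod (\<Sum>l\<in>L. b j l * cnj (u l))) J"
    by (rule cmod_sum_mult_le)
  finally have "U\<^sup>2 \<le> (L2_set (\<lambda>j. cmod (w j)) J * L2_set (\<lambda>j. cmod (\<Sum>l\<in>L. b j l * cnj (u l))) J)\<^sup>2"
    using U0 by (intro power_mono)
  also have "\<dots> = W * (\<Sum>j\<in>J. (cmod (\<Sum>l\<in>L. b j l * cnj (u l)))\<^sup>2)"
    by (simp only: power_mult_distrib L2_set_power2 W_def)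
  also have "\<dots> \<le> W * (T * U)"
    using bound[of "\<lambda>l. cnj (u l)"] W0 unfolding complex_mod_cnj U_def by (intro mult_left_mono)
  finally have "U * U \<le> (T * W) * U"
    by (simp add: power2_eq_square mult_ac)
  then have "U \<le> T * W"
    using U0 W0 \<open>0 \<le> T\<close> by (cases "U = 0") (auto simp: mult_le_cancel_right)
  then show ?thesis by (simp add: U_def W_def u_def)
qed

lemma sum_swap4:
  "(\<Sum>k\<in>A. \<Sum>l\<in>B. \<Sum>i\<in>C. \<Sum>j\<in>D. g k l i j) = (\<Sum>i\<in>C. \<Sum>j\<in>D. \<Sum>k\<in>A. \<Sum>l\<in>B. g k l i j)"
proof -
  have "(\<Sum>k\<in>A. \<Sum>l\<in>B. \<Sum>i\<in>C. \<Sum>j\<in>D. g k l i j) = (\<Sum>k\<in>A. \<Sum>i\<in>C. \<Sum>l\<in>B. \<Sum>j\<in>D. g k l i j)"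
    by (intro sum.cong refl sum.swap)
  also have "\<dots> = (\<Sum>i\<in>C. \<Sum>k\<in>A. \<Sum>l\<in>B. \<Sum>j\<in>D. g k l i j)"
    by (rule sum.swap)
  also have "\<dots> = (\<Sum>i\<in>C. \<Sum>k\<in>A. \<Sum>j\<in>D. \<Sum>l\<in>B. g k l i j)"
    by (intro sum.cong refl sum.swap)
  also have "\<dots> = (\<Sum>i\<in>C. \<Sum>j\<in>D. \<Sum>k\<in>A. \<Sum>l\<in>B. g k l i j)"
    by (intro sum.cong refl sum.swap)
  finally show ?thesis .
qed

text \<open>\<open>pairing p f x a b\<close> is the value of \<open>f\<close>, as a functional on matrices, at the matrix with
  entries \<open>a k * b l * x\<close>.\<close>

definition pairing :: "nat \<Rightarrow> (nat \<Rightarrow> nat \<Rightarrow> 'a \<Rightarrow> complex) \<Rightarrow> 'a \<Rightarrow> (nat \<Rightarrow> complex) \<Rightarrow> (nat \<Rightarrow> complex) \<Rightarrow> complex"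
  where "pairing p f x a b = (\<Sum>k<p. \<Sum>l<p. a k * b l * f k l x)"

lemma pairing_add_left: "pairing p f x (a + a') b = pairing p f x a b + pairing p f x a' b"
  and pairing_add_right: "pairing p f x a (b + b') = pairing p f x a b + pairing p f x a b'"
  by (simp_all add: pairing_def ring_distribs sum.distrib)

lemma pairing_scale_left: "pairing p f x (c *\<^sub>C a) b = c * pairing p f x a b"
  and pairing_scale_right: "pairing p f x a (c *\<^sub>C b) = c * pairing p f x a b"
  by (simp_all add: pairing_def scaleC_fun_def scaleC_complex_def sum_distrib_left mult_ac)

lemma pairing_zero_left [simp]: "pairing p f x 0 b = 0"
  and pairing_zero_right [simp]: "pairing p f x a 0 = 0"
  by (simp_all add: pairing_def)

lemma pairing_sum_left: "pairing p f x (\<Sum>i\<in>I. c i *\<^sub>C a i) b = (\<Sum>i\<in>I. c i * pairing p f x (a i) b)"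
  by (induction I rule: infinite_finite_induct)
    (simp_all only: sum.infinite sum.empty sum.insert pairing_zero_left pairing_add_left pairing_scale_left not_False_eq_True)

lemma pairing_sum_right: "pairing p f x a (\<Sum>i\<in>I. c i *\<^sub>C b i) = (\<Sum>i\<in>I. c i * pairing p f x a (b i))"
  by (induction I rule: infinite_finite_induct)
    (simp_all only: sum.infinite sum.empty sum.insert pairing_zero_right pairing_add_right pairing_scale_right not_False_eq_True)

text \<open>The norm of \<open>\<alpha>\<^sup>t x \<beta>\<close> is at most \<open>\<parallel>\<alpha>\<parallel> \<parallel>\<beta>\<parallel>\<close>: a scalar matrix and its transpose have the same norm,
  also on tuples of vectors of the Hilbert space.\<close>

lemma op_mat_compression_le:
  fixes x :: "nat \<Rightarrow> nat \<Rightarrow> 'h::complex_hilbert \<Rightarrow>\<^sub>L 'h"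
  assumes X: "operator_space X" and x: "x \<in> mat_ball (opspace X) m"
  shows "L2_set (\<lambda>k. norm (\<Sum>l<p. (\<Sum>i<m. \<Sum>j<m. (\<alpha> i k * \<beta> j l) *\<^sub>C x i j) (\<xi> l))) {..<p}
    \<le> sqrt (herm_max p (gram m \<alpha>)) * sqrt (herm_max p (gram m \<beta>)) * L2_set (\<lambda>l. norm (\<xi> l)) {..<p}"
proof -
  define \<eta> where "\<eta> j = (\<Sum>l<p. \<beta> j l *\<^sub>C \<xi> l)" for j
  define w where "w i = (\<Sum>j<m. x i j (\<eta> j))" for i
  let ?S = "herm_max p (gram m \<alpha>)" and ?T = "herm_max p (gram m \<beta>)"
  have y: "(\<Sum>l<p. (\<Sum>i<m. \<Sum>j<m. (\<alpha> i k * \<beta> j l) *\<^sub>C x i j) (\<xi> l)) = (\<Sum>i<m. \<alpha> i k *\<^sub>C w i)" for k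
  proof -
    have "(\<Sum>l<p. (\<Sum>i<m. \<Sum>j<m. (\<alpha> i k * \<beta> j l) *\<^sub>C x i j) (\<xi> l))
        = (\<Sum>l<p. \<Sum>i<m. \<Sum>j<m. (\<alpha> i k * \<beta> j l) *\<^sub>C x i j (\<xi> l))"
      by (simp add: blinfun.sum_left blinfun_apply_scaleC)
    also have "\<dots> = (\<Sum>i<m. \<Sum>l<p. \<Sum>j<m. (\<alpha> i k * \<beta> j l) *\<^sub>C x i j (\<xi> l))"
      by (rule sum.swap)
    also have "\<dots> = (\<Sum>i<m. \<Sum>j<m. \<Sum>l<p. (\<alpha> i k * \<beta> j l) *\<^sub>C x i j (\<xi> l))"
      by (intro sum.cong refl sum.swap)
    also have "\<dots> = (\<Sum>i<m. \<alpha> i k *\<^sub>C w i)"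
      by (simp add: w_def \<eta>_def blinfun.sum_right complex_vector.scale_sum_right scaleC_scaleC
          operator_spaceD(2)[OF X mat_ball_opspaceD(1)[OF x]])
    finally show ?thesis .
  qed
  have "(\<Sum>k<p. (norm (\<Sum>i<m. \<alpha> i k *\<^sub>C w i))\<^sup>2) \<le> ?S * (\<Sum>i<m. (norm (w i))\<^sup>2)"
    by (rule scalar_bound_vectors, rule transpose_bound, rule gram_bound, rule herm_max_nonneg)
  also have "\<dots> \<le> ?S * (\<Sum>j<m. (norm (\<eta> j))\<^sup>2)"
  proof (intro mult_left_mono herm_max_nonneg)
    have "(L2_set (\<lambda>i. norm (w i)) {..<m})\<^sup>2 \<le> (L2_set (\<lambda>j. norm (\<eta> j)) {..<m})\<^sup>2"
      unfolding w_def by (intro power_mono mat_ball_opspaceD(2)[OF x]) simp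
    then show "(\<Sum>i<m. (norm (w i))\<^sup>2) \<le> (\<Sum>j<m. (norm (\<eta> j))\<^sup>2)"
      by (simp only: L2_set_power2)
  qed
  also have "\<dots> \<le> ?S * (?T * (\<Sum>l<p. (norm (\<xi> l))\<^sup>2))"
    unfolding \<eta>_def
    by (rule mult_left_mono, rule scalar_bound_vectors, rule gram_bound, rule herm_max_nonneg)
  finally have "sqrt (\<Sum>k<p. (norm (\<Sum>i<m. \<alpha> i k *\<^sub>C w i))\<^sup>2) \<le> sqrt (?S * (?T * (\<Sum>l<p. (norm (\<xi> l))\<^sup>2)))"
    by simp
  then show ?thesis
    unfolding y L2_set_def by (simp add: real_sqrt_mult mult_ac)
qed

lemma functional_le_scaled:
  fixes y :: "nat \<Rightarrow> nat \<Rightarrow> 'h::complex_hilbert \<Rightarrow>\<^sub>L 'h"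
  assumes X: "operator_space X"
    and f: "\<And>k l. k < p \<Longrightarrow> l < p \<Longrightarrow> clinear_on X (f k l)"
    and M: "\<And>x. x \<in> mat_ball (opspace X) p \<Longrightarrow> cmod (\<Sum>k<p. \<Sum>l<p. f k l (x k l)) \<le> M"
    and y: "\<And>k l. k < p \<Longrightarrow> l < p \<Longrightarrow> y k l \<in> X"
    and c: "\<And>\<xi>. L2_set (\<lambda>k. norm (\<Sum>l<p. y k l (\<xi> l))) {..<p} \<le> c * L2_set (\<lambda>l. norm (\<xi> l)) {..<p}"
      "0 \<le> c"
  shows "cmod (\<Sum>k<p. \<Sum>l<p. f k l (y k l)) \<le> M * c"
proof (rule field_le_epsilon)
  fix \<epsilon> :: real assume \<epsilon>: "0 < \<epsilon>"
  have M0: "0 \<le> M"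
    using order_trans[OF norm_ge_zero M[OF zero_in_mat_ball_opspace[OF X]]] .
  \<comment> \<open>The bound \<open>c\<close> may be zero, so that \<open>y\<close> is normalised by a slightly larger number.\<close>
  define d where "d = c + \<epsilon> / (M + 1)"
  have d: "0 < d" "c \<le> d"
    using \<epsilon> c(2) M0 by (simp_all add: d_def add_nonneg_pos)
  define r where "r = complex_of_real (1 / d)"
  have "(\<lambda>k l. r *\<^sub>C y k l) \<in> mat_ball (opspace X) p"
  proof (rule mat_ball_opspaceI)
    show "r *\<^sub>C y k l \<in> X" if "k < p" "l < p" for k l
      using y[OF that] by (intro complex_vector.subspace_scale operator_spaceD X)
  next
    fix \<xi> :: "nat \<Rightarrow> 'h"
    have "L2_set (\<lambda>k. norm (\<Sum>l<p. (r *\<^sub>C y k l) (\<xi> l))) {..<p}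
        = L2_set (\<lambda>k. norm ((1 / d) *\<^sub>R (\<Sum>l<p. y k l (\<xi> l)))) {..<p}"
      by (simp add: r_def blinfun_apply_scaleC complex_vector.scale_sum_right scaleR_scaleC del: norm_scaleR)
    also have "\<dots> = 1 / d * L2_set (\<lambda>k. norm (\<Sum>l<p. y k l (\<xi> l))) {..<p}"
      unfolding L2_set_norm_scaleR using d by simp
    also have "\<dots> \<le> 1 / d * (d * L2_set (\<lambda>l. norm (\<xi> l)) {..<p})"
      using d by (intro mult_left_mono order_trans[OF c(1)] mult_right_mono) auto
    finally show "L2_set (\<lambda>k. norm (\<Sum>l<p. (r *\<^sub>C y k l) (\<xi> l))) {..<p} \<le> L2_set (\<lambda>l. norm (\<xi> l)) {..<p}"
      using d by simp
  qed
  then have "cmod (\<Sum>k<p. \<Sum>l<p. f k l (r *\<^sub>C y k l)) \<le> M" by (rule M)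
  moreover have "(\<Sum>k<p. \<Sum>l<p. f k l (r *\<^sub>C y k l)) = r * (\<Sum>k<p. \<Sum>l<p. f k l (y k l))"
    using f y by (simp add: clinear_on_def scaleC_complex_def sum_distrib_left)
  ultimately have "cmod r * cmod (\<Sum>k<p. \<Sum>l<p. f k l (y k l)) \<le> M"
    by (simp only: norm_mult)
  then have "cmod (\<Sum>k<p. \<Sum>l<p. f k l (y k l)) \<le> M * d"
    using d by (simp add: r_def norm_divide pos_divide_le_eq)
  also have "\<dots> = M * c + \<epsilon> * (M / (M + 1))"
    using M0 by (simp add: d_def field_simps)
  also have "\<dots> \<le> M * c + \<epsilon>"
    using mult_left_le[of "M / (M + 1)" \<epsilon>] \<epsilon> M0 by simp
  finally show "cmod (\<Sum>k<p. \<Sum>l<p. f k l (y k l)) \<le> M * c + \<epsilon>" .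
qed

text \<open>The value of the functional at \<open>\<alpha>\<^sup>t x \<beta>\<close> is at most \<open>M \<parallel>\<alpha>\<parallel> \<parallel>\<beta>\<parallel>\<close>; passing to the mean of
  \<open>\<parallel>\<alpha>\<parallel>\<^sup>2\<close> and \<open>\<parallel>\<beta>\<parallel>\<^sup>2\<close> makes the bound sublinear in the pair of Gram matrices.\<close>

lemma pairing_sum_le_herm_max:
  assumes X: "operator_space X"
    and f: "\<And>k l. k < p \<Longrightarrow> l < p \<Longrightarrow> clinear_on X (f k l)"
    and M: "\<And>x. x \<in> mat_ball (opspace X) p \<Longrightarrow> cmod (\<Sum>k<p. \<Sum>l<p. f k l (x k l)) \<le> M"
    and x: "x \<in> mat_ball (opspace X) m"
  shows "2 * Re (\<Sum>i<m. \<Sum>j<m. pairing p f (x i j) (\<alpha> i) (\<beta> j))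
    \<le> M * (herm_max p (gram m \<alpha>) + herm_max p (gram m \<beta>))"
proof -
  let ?S = "herm_max p (gram m \<alpha>)" and ?T = "herm_max p (gram m \<beta>)"
  define y where "y k l = (\<Sum>i<m. \<Sum>j<m. (\<alpha> i k * \<beta> j l) *\<^sub>C x i j)" for k l
  have sub: "csubspace X" by (rule operator_spaceD[OF X])
  have M0: "0 \<le> M"
    using order_trans[OF norm_ge_zero M[OF zero_in_mat_ball_opspace[OF X]]] .
  have xX: "x i j \<in> X" if "i < m" "j < m" for i j
    using mat_ball_opspaceD(1)[OF x that] .
  have yX: "y k l \<in> X" for k l
    unfolding y_def
    by (intro complex_vector.subspace_sum complex_vector.subspace_scale sub xX) auto
  have fy: "f k l (y k l) = (\<Sum>i<m. \<Sum>j<m. \<alpha> i k * \<beta> j l * f k l (x i j))" if "k < p" "l < p" for k l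
  proof -
    have "f k l (y k l) = f k l (\<Sum>i<m. 1 *\<^sub>C (\<Sum>j<m. (\<alpha> i k * \<beta> j l) *\<^sub>C x i j))"
      by (simp add: y_def scaleC_one)
    also have "\<dots> = (\<Sum>i<m. 1 *\<^sub>C f k l (\<Sum>j<m. (\<alpha> i k * \<beta> j l) *\<^sub>C x i j))"
      by (intro clinear_on_sum[OF sub f[OF that]] complex_vector.subspace_sum
          complex_vector.subspace_scale sub xX) auto
    also have "\<dots> = (\<Sum>i<m. \<Sum>j<m. \<alpha> i k * \<beta> j l * f k l (x i j))"
      unfolding scaleC_one
      by (intro sum.cong refl, subst clinear_on_sum[OF sub f[OF that]])
        (auto intro: xX simp: scaleC_complex_def)
    finally show ?thesis .
  qed
  have "(\<Sum>k<p. \<Sum>l<p. f k l (y k l)) = (\<Sum>k<p. \<Sum>l<p. \<Sum>i<m. \<Sum>j<m. \<alpha> i k * \<beta> j l * f k l (x i j))"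
    by (simp add: fy)
  also have "\<dots> = (\<Sum>i<m. \<Sum>j<m. pairing p f (x i j) (\<alpha> i) (\<beta> j))"
    unfolding pairing_def by (rule sum_swap4)
  finally have eq: "(\<Sum>k<p. \<Sum>l<p. f k l (y k l)) = (\<Sum>i<m. \<Sum>j<m. pairing p f (x i j) (\<alpha> i) (\<beta> j))" .
  have "cmod (\<Sum>k<p. \<Sum>l<p. f k l (y k l)) \<le> M * (sqrt ?S * sqrt ?T)"
    using op_mat_compression_le[OF X x, where p = p and \<alpha> = \<alpha> and \<beta> = \<beta>]
    by (intro functional_le_scaled[OF X f M yX]) (auto simp: y_def herm_max_nonneg)
  moreover have "2 * (sqrt ?S * sqrt ?T) \<le> ?S + ?T"
    using sum_squares_bound[of "sqrt ?S" "sqrt ?T"] herm_max_nonneg by (simp add: power2_eq_square[symmetric])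
  then have "M * (2 * (sqrt ?S * sqrt ?T)) \<le> M * (?S + ?T)"
    using M0 by (rule mult_left_mono)
  ultimately show ?thesis
    using complex_Re_le_cmod[of "\<Sum>k<p. \<Sum>l<p. f k l (y k l)"] unfolding eq by linarith
qed

lemma sum_lessThan_add:
  fixes g :: "nat \<Rightarrow> 'a::comm_monoid_add"
  shows "(\<Sum>i<m + n. g i) = (\<Sum>i<m. g i) + (\<Sum>i<n. g (m + i))"
  by (induction n) (simp_all add: add.assoc)

definition append_rows :: "nat \<Rightarrow> (nat \<Rightarrow> 'a) \<Rightarrow> (nat \<Rightarrow> 'a) \<Rightarrow> nat \<Rightarrow> 'a"
  where "append_rows m \<alpha> \<alpha>' i = (if i < m then \<alpha> i else \<alpha>' (i - m))"

definition block_diag :: "nat \<Rightarrow> (nat \<Rightarrow> nat \<Rightarrow> 'a::zero) \<Rightarrow> (nat \<Rightarrow> nat \<Rightarrow> 'a) \<Rightarrow> nat \<Rightarrow> nat \<Rightarrow> 'a"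
  where "block_diag m x x' i j = (if i < m then if j < m then x i j else 0
    else if j < m then 0 else x' (i - m) (j - m))"

lemma append_rows_simps [simp]:
  "i < m \<Longrightarrow> append_rows m \<alpha> \<alpha>' i = \<alpha> i"
  "append_rows m \<alpha> \<alpha>' (m + i) = \<alpha>' i"
  by (simp_all add: append_rows_def)

lemma block_diag_simps [simp]:
  "i < m \<Longrightarrow> j < m \<Longrightarrow> block_diag m x x' i j = x i j"
  "i < m \<Longrightarrow> block_diag m x x' i (m + j) = 0"
  "j < m \<Longrightarrow> block_diag m x x' (m + i) j = 0"
  "block_diag m x x' (m + i) (m + j) = x' i j"
  by (simp_all add: block_diag_def)

lemma gram_append_rows: "gram (m + n) (append_rows m \<alpha> \<alpha>') = gram m \<alpha> + gram n \<alpha>'"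
  by (simp add: fun_eq_iff gram_def sum_lessThan_add)

lemma block_diag_in_mat_ball:
  fixes x x' :: "nat \<Rightarrow> nat \<Rightarrow> 'h::complex_hilbert \<Rightarrow>\<^sub>L 'h"
  assumes X: "operator_space X"
    and x: "x \<in> mat_ball (opspace X) m" and x': "x' \<in> mat_ball (opspace X) n"
  shows "block_diag m x x' \<in> mat_ball (opspace X) (m + n)"
proof (rule mat_ball_opspaceI)
  show "block_diag m x x' i j \<in> X" if "i < m + n" "j < m + n" for i j
    using that mat_ball_opspaceD(1)[OF x] mat_ball_opspaceD(1)[OF x']
      complex_vector.subspace_0[OF operator_spaceD(1)[OF X]]
    by (auto simp: block_diag_def)
next
  fix \<xi> :: "nat \<Rightarrow> 'h"
  have sq: "(\<Sum>i<m. (norm (\<Sum>j<m. x i j (\<xi> j)))\<^sup>2) \<le> (\<Sum>j<m. (norm (\<xi> j))\<^sup>2)"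
    if "x \<in> mat_ball (opspace X) m" for x m and \<xi> :: "nat \<Rightarrow> 'h"
    using mat_ball_opspaceD(2)[OF that, of \<xi>] by (simp add: L2_set_def)
  have "(\<Sum>i<m + n. (norm (\<Sum>j<m + n. block_diag m x x' i j (\<xi> j)))\<^sup>2)
      = (\<Sum>i<m. (norm (\<Sum>j<m. x i j (\<xi> j)))\<^sup>2) + (\<Sum>i<n. (norm (\<Sum>j<n. x' i j (\<xi> (m + j))))\<^sup>2)"
    by (simp add: sum_lessThan_add)
  also have "\<dots> \<le> (\<Sum>j<m + n. (norm (\<xi> j))\<^sup>2)"
    using sq[OF x, of \<xi>] sq[OF x', of "\<lambda>j. \<xi> (m + j)"] by (simp add: sum_lessThan_add)
  finally show "L2_set (\<lambda>i. norm (\<Sum>j<m + n. block_diag m x x' i j (\<xi> j))) {..<m + n}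
    \<le> L2_set (\<lambda>j. norm (\<xi> j)) {..<m + n}"
    by (simp add: L2_set_def)
qed

text \<open>The pair \<open>(\<alpha>\<^sup>* \<alpha>, \<beta>\<^sup>* \<beta>)\<close> is a function on \<open>bool\<close>, because such functions already form a complex
  vector space; with it goes twice the real part of the functional at \<open>\<alpha>\<^sup>t x \<beta>\<close>.\<close>

definition dominated_cone ::
    "nat \<Rightarrow> ('h::complex_hilbert \<Rightarrow>\<^sub>L 'h) set \<Rightarrow> (nat \<Rightarrow> nat \<Rightarrow> ('h \<Rightarrow>\<^sub>L 'h) \<Rightarrow> complex)
      \<Rightarrow> ((bool \<Rightarrow> nat \<Rightarrow> nat \<Rightarrow> complex) \<times> real) set"
  where "dominated_cone p X f = {((\<lambda>b. if b then gram m \<alpha> else gram m \<beta>),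
      2 * Re (\<Sum>i<m. \<Sum>j<m. pairing p f (x i j) (\<alpha> i) (\<beta> j))) | m \<alpha> \<beta> x. x \<in> mat_ball (opspace X) m}"

text \<open>Sums correspond to block diagonal matrices \<open>x \<oplus> x'\<close>, which is why the size \<open>m\<close> has to vary.\<close>

lemma real_cone_dominated_cone:
  fixes X :: "('h::complex_hilbert \<Rightarrow>\<^sub>L 'h) set"
  assumes X: "operator_space X"
    and f: "\<And>k l. k < p \<Longrightarrow> l < p \<Longrightarrow> clinear_on X (f k l)"
  shows "real_cone (dominated_cone p X f)"
  unfolding real_cone_def
proof (intro conjI allI impI)
  have "((\<lambda>b. if b then gram 0 (\<lambda>_ _. 0) else gram 0 (\<lambda>_ _. 0)), 0) \<in> dominated_cone p X f"
    unfolding dominated_cone_def mem_Collect_eq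
    using zero_in_mat_ball_opspace[OF X, of 0]
    by (intro exI[of _ "0 :: nat"] exI[of _ "(\<lambda>_ _. 0) :: nat \<Rightarrow> nat \<Rightarrow> complex"]
        exI[of _ "(\<lambda>_ _. 0) :: nat \<Rightarrow> nat \<Rightarrow> 'h \<Rightarrow>\<^sub>L 'h"]) simp
  moreover have "(\<lambda>b. if b then gram 0 (\<lambda>_ _. 0) else gram 0 (\<lambda>_ _. 0)) = (0 :: bool \<Rightarrow> nat \<Rightarrow> nat \<Rightarrow> complex)"
    by (simp add: fun_eq_iff gram_zero)
  ultimately show "(0, 0) \<in> dominated_cone p X f" by simp
next
  have zero: "pairing p f 0 a b = 0" for a b
  proof -
    have "f k l 0 = 0" if "k < p" "l < p" for k l
      using clinear_on_sum[OF operator_spaceD(1)[OF X] f[OF that], of "{}"] by simp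
    then show ?thesis by (simp add: pairing_def)
  qed
  fix g h r s
  assume "(g, r) \<in> dominated_cone p X f" "(h, s) \<in> dominated_cone p X f"
  then obtain m \<alpha> \<beta> x n \<alpha>' \<beta>' x' where x: "x \<in> mat_ball (opspace X) m"
    and g: "g = (\<lambda>b. if b then gram m \<alpha> else gram m \<beta>)"
    and r: "r = 2 * Re (\<Sum>i<m. \<Sum>j<m. pairing p f (x i j) (\<alpha> i) (\<beta> j))"
    and x': "x' \<in> mat_ball (opspace X) n"
    and h: "h = (\<lambda>b. if b then gram n \<alpha>' else gram n \<beta>')"
    and s: "s = 2 * Re (\<Sum>i<n. \<Sum>j<n. pairing p f (x' i j) (\<alpha>' i) (\<beta>' j))"
    by (auto simp: dominated_cone_def)
  have "g + h = (\<lambda>b. if b then gram (m + n) (append_rows m \<alpha> \<alpha>') else gram (m + n) (append_rows m \<beta> \<beta>'))"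
    by (simp add: g h fun_eq_iff gram_append_rows)
  moreover have "r + s = 2 * Re (\<Sum>i<m + n. \<Sum>j<m + n.
      pairing p f (block_diag m x x' i j) (append_rows m \<alpha> \<alpha>' i) (append_rows m \<beta> \<beta>' j))"
    by (simp add: r s sum_lessThan_add zero)
  ultimately show "(g + h, r + s) \<in> dominated_cone p X f"
    unfolding dominated_cone_def using block_diag_in_mat_ball[OF X x x'] by blast
next
  fix t :: real and g r
  assume t: "0 < t" and "(g, r) \<in> dominated_cone p X f"
  then obtain m \<alpha> \<beta> x where x: "x \<in> mat_ball (opspace X) m"
    and g: "g = (\<lambda>b. if b then gram m \<alpha> else gram m \<beta>)"
    and r: "r = 2 * Re (\<Sum>i<m. \<Sum>j<m. pairing p f (x i j) (\<alpha> i) (\<beta> j))"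
    by (auto simp: dominated_cone_def)
  define c where "c = complex_of_real (sqrt t)"
  have c: "c * c = complex_of_real t" "cnj c = c"
    using t by (simp_all add: c_def flip: of_real_mult)
  have gram: "gram m (\<lambda>i. c *\<^sub>C \<alpha> i) = complex_of_real t *\<^sub>C gram m \<alpha>" for \<alpha>
    unfolding c(1)[symmetric]
    by (simp add: fun_eq_iff gram_def scaleC_fun_def scaleC_complex_def sum_distrib_left c(2) mult_ac)
  have "complex_of_real t *\<^sub>C g
      = (\<lambda>b. if b then gram m (\<lambda>i. c *\<^sub>C \<alpha> i) else gram m (\<lambda>i. c *\<^sub>C \<beta> i))"
    unfolding gram by (simp add: g fun_eq_iff scaleC_fun_def)
  moreover have "(\<Sum>i<m. \<Sum>j<m. pairing p f (x i j) (c *\<^sub>C \<alpha> i) (c *\<^sub>C \<beta> j))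
      = complex_of_real t * (\<Sum>i<m. \<Sum>j<m. pairing p f (x i j) (\<alpha> i) (\<beta> j))"
    unfolding c(1)[symmetric]
    by (simp add: pairing_scale_left pairing_scale_right sum_distrib_left mult_ac)
  then have "t * r = 2 * Re (\<Sum>i<m. \<Sum>j<m. pairing p f (x i j) (c *\<^sub>C \<alpha> i) (c *\<^sub>C \<beta> j))"
    by (simp add: r)
  ultimately show "(complex_of_real t *\<^sub>C g, t * r) \<in> dominated_cone p X f"
    unfolding dominated_cone_def using x by blast
qed

definition unit_vec :: "nat \<Rightarrow> nat \<Rightarrow> complex"
  where "unit_vec k l = (if l = k then 1 else 0)"

text \<open>A real-linear functional below a multiple of \<open>herm_max\<close> annihilates skew-adjoint matrices and is
  nonnegative at \<open>a\<^sup>* a\<close>.  Hence the value of its complexification at \<open>a\<^sup>* b\<close> is a semi-inner product of the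
  row vectors \<open>a\<close> and \<open>b\<close>.\<close>

lemma semi_inner_of_functional:
  fixes L :: "(nat \<Rightarrow> nat \<Rightarrow> complex) \<Rightarrow> real"
  assumes add: "\<And>A B. L (A + B) = L A + L B" and minus: "\<And>A. L (- A) = - L A"
    and scale: "\<And>t A. 0 \<le> t \<Longrightarrow> L (complex_of_real t *\<^sub>C A) = t * L A"
    and le: "\<And>A. L A \<le> M * herm_max p A" and M: "0 \<le> M"
  obtains \<rho> where "semi_inner \<rho>"
    and "\<And>m \<alpha>. L (gram m \<alpha>) = (\<Sum>i<m. Re (\<rho> (\<alpha> i) (\<alpha> i)))"
    and "(\<Sum>k<p. Re (\<rho> (unit_vec k) (unit_vec k))) \<le> M"
proof -
  have scale: "L (complex_of_real r *\<^sub>C A) = r * L A" for r A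
  proof (cases "0 \<le> r")
    case False
    have "complex_of_real r *\<^sub>C A = - (complex_of_real (- r) *\<^sub>C A)"
      by simp
    then show ?thesis using False scale[of "- r" A] by (simp only: minus)
  qed (rule scale)
  have nonpos: "L A \<le> 0" if "\<And>z. qform p A z \<le> 0" for A
  proof -
    have "herm_max p A \<le> 0" by (rule herm_max_le) (rule that)
    then have "herm_max p A = 0" using herm_max_nonneg[of p A] by simp
    then show ?thesis using le[of A] by simp
  qed
  have qform_minus: "qform p (- A) z = - qform p A z" for A z
    by (simp add: qform_def sum_negf)
  have null: "L A = 0" if "\<And>z. qform p A z = 0" for A
    using nonpos[of A] nonpos[of "- A"] minus[of A] that by (simp add: qform_minus)
  define Lc where "Lc A = complex_of_real (L A) - \<i> * complex_of_real (L (\<i> *\<^sub>C A))" for A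
  have Lc_add: "Lc (A + B) = Lc A + Lc B" for A B
    unfolding Lc_def scaleC_add_right add by (simp add: algebra_simps)
  have Lc_scale: "Lc (c *\<^sub>C A) = c * Lc A" for c A
  proof -
    have c: "c = complex_of_real (Re c) + complex_of_real (Im c) * \<i>"
      by (simp add: complex_eq mult.commute)
    have "c *\<^sub>C A = complex_of_real (Re c) *\<^sub>C A + complex_of_real (Im c) *\<^sub>C \<i> *\<^sub>C A"
      by (subst c, simp only: scaleC_add_left scaleC_scaleC)
    then have 1: "L (c *\<^sub>C A) = Re c * L A + Im c * L (\<i> *\<^sub>C A)"
      by (simp only: add scale)
    have "\<i> * c = complex_of_real (Re c) * \<i> + complex_of_real (- Im c)"
      by (simp add: complex_eq_iff)
    then have "\<i> *\<^sub>C c *\<^sub>C A = complex_of_real (Re c) *\<^sub>C \<i> *\<^sub>C A + complex_of_real (- Im c) *\<^sub>C A"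
      by (simp only: scaleC_add_left scaleC_scaleC)
    then have 2: "L (\<i> *\<^sub>C c *\<^sub>C A) = Re c * L (\<i> *\<^sub>C A) - Im c * L A"
      by (simp only: add scale)
    show ?thesis
      unfolding Lc_def 1 2 by (simp add: complex_eq_iff)
  qed
  define \<rho> where "\<rho> a b = Lc (rank_one a b)" for a b
  have Re_\<rho>: "Re (\<rho> a b) = L (rank_one a b)" for a b
    by (simp add: \<rho>_def Lc_def)
  have "semi_inner \<rho>"
  proof
    fix a b c :: "nat \<Rightarrow> complex" and r :: complex
    have "rank_one a (b + c) = rank_one a b + rank_one a c"
      by (simp add: fun_eq_iff rank_one_def distrib_left)
    then show "\<rho> a (b + c) = \<rho> a b + \<rho> a c"
      by (simp only: \<rho>_def Lc_add)
    have "rank_one a (r *\<^sub>C b) = r *\<^sub>C rank_one a b"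
      by (simp add: fun_eq_iff rank_one_def scaleC_fun_def scaleC_complex_def)
    then show "\<rho> a (r *\<^sub>C b) = r * \<rho> a b"
      by (simp only: \<rho>_def Lc_scale)
    have "qform p (- rank_one a a) z \<le> 0" for z
      unfolding qform_minus qform_rank_one by (simp del: cnj_sum)
    then show "0 \<le> Re (\<rho> a a)"
      unfolding Re_\<rho> using nonpos[of "- rank_one a a"] by (simp only: minus) simp
    have "qform p (rank_one a b + - rank_one b a) z = 0" for z
      unfolding qform_add qform_minus qform_rank_one by (simp del: cnj_sum)
    then have 1: "L (rank_one b a) = L (rank_one a b)"
      using null[of "rank_one a b + - rank_one b a"] by (simp only: add minus) simp
    have "qform p (\<i> *\<^sub>C rank_one a b + \<i> *\<^sub>C rank_one b a) z = 0" for z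
      unfolding qform_add qform_scale_rank_one by (simp del: cnj_sum)
    then have 2: "L (\<i> *\<^sub>C rank_one b a) = - L (\<i> *\<^sub>C rank_one a b)"
      using null[of "\<i> *\<^sub>C rank_one a b + \<i> *\<^sub>C rank_one b a"] by (simp only: add) simp
    show "\<rho> a b = cnj (\<rho> b a)"
      unfolding \<rho>_def Lc_def 1 2 by simp
  qed
  moreover have "L (gram m \<alpha>) = (\<Sum>i<m. Re (\<rho> (\<alpha> i) (\<alpha> i)))" for m \<alpha>
  proof (induction m)
    case 0
    show ?case unfolding gram_zero by (subst null) (simp_all add: qform_def)
  next
    case (Suc m)
    then show ?case by (simp only: gram_Suc add Re_\<rho>) simp
  qed
  moreover have "(\<Sum>k<p. Re (\<rho> (unit_vec k) (unit_vec k))) \<le> M"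
  proof -
    have "herm_max p (gram p unit_vec) \<le> 1"
    proof (rule herm_max_le)
      fix z :: "nat \<Rightarrow> complex" assume z: "L2_set (\<lambda>k. cmod (z k)) {..<p} \<le> 1"
      have "(\<Sum>l<p. unit_vec k l * z l) = z k" if "k < p" for k
      proof -
        have "(\<Sum>l<p. unit_vec k l * z l) = (\<Sum>l<p. if l = k then z k else 0)"
          by (intro sum.cong) (auto simp: unit_vec_def)
        then show ?thesis using that by simp
      qed
      then have "qform p (gram p unit_vec) z = (L2_set (\<lambda>k. cmod (z k)) {..<p})\<^sup>2"
        by (simp add: qform_gram L2_set_power2)
      also have "\<dots> \<le> 1" using z by (simp add: power_le_one)
      finally show "qform p (gram p unit_vec) z \<le> 1" .
    qed
    then have "L (gram p unit_vec) \<le> M"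
      using le[of "gram p unit_vec"] M mult_left_le[of "herm_max p (gram p unit_vec)" M] by simp
    then show ?thesis using calculation(2)[of p unit_vec] by simp
  qed
  ultimately show thesis by (rule that)
qed

text \<open>The two semi-inner products stand for positive functionals on \<open>p \<times> p\<close> matrices; the sums over
  the unit vectors are their values at the identity matrix.\<close>

lemma ex_dominating_forms:
  assumes X: "operator_space X"
    and f: "\<And>k l. k < p \<Longrightarrow> l < p \<Longrightarrow> clinear_on X (f k l)"
    and M: "\<And>x. x \<in> mat_ball (opspace X) p \<Longrightarrow> cmod (\<Sum>k<p. \<Sum>l<p. f k l (x k l)) \<le> M"
  obtains \<rho> \<sigma> where "semi_inner \<rho>" "semi_inner \<sigma>"
    and "(\<Sum>k<p. Re (\<rho> (unit_vec k) (unit_vec k))) \<le> M"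
    and "(\<Sum>k<p. Re (\<sigma> (unit_vec k) (unit_vec k))) \<le> M"
    and "\<And>m x \<alpha> \<beta>. x \<in> mat_ball (opspace X) m \<Longrightarrow>
      2 * Re (\<Sum>i<m. \<Sum>j<m. pairing p f (x i j) (\<alpha> i) (\<beta> j))
        \<le> (\<Sum>i<m. Re (\<rho> (\<alpha> i) (\<alpha> i))) + (\<Sum>j<m. Re (\<sigma> (\<beta> j) (\<beta> j)))"
proof -
  have M0: "0 \<le> M"
    using order_trans[OF norm_ge_zero M[OF zero_in_mat_ball_opspace[OF X]]] .
  define q :: "(bool \<Rightarrow> nat \<Rightarrow> nat \<Rightarrow> complex) \<Rightarrow> real"
    where "q P = M * (herm_max p (P True) + herm_max p (P False))" for P
  have q: "sublinear q"
    unfolding sublinear_def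
  proof safe
    show "q (P + Q) \<le> q P + q Q" for P Q
      using mult_left_mono[OF add_mono[OF sublinear_add[OF sublinear_herm_max, of p "P True" "Q True"]
          sublinear_add[OF sublinear_herm_max, of p "P False" "Q False"]] M0]
      unfolding q_def plus_fun_apply[of P Q] by (simp add: algebra_simps)
    show "q (complex_of_real t *\<^sub>C P) \<le> t * q P" if "0 < t" for t P
      using sublinear_scale[OF sublinear_herm_max that]
      unfolding q_def scaleC_fun_def[of _ P] by (simp add: algebra_simps)
  qed
  have le: "r \<le> q g" if "(g, r) \<in> dominated_cone p X f" for g r
    using that pairing_sum_le_herm_max[where f = f, OF X f M] by (auto simp: dominated_cone_def q_def)
  obtain L where L: "\<And>P Q. L (P + Q) = L P + L Q" "\<And>P. L (- P) = - L P"
      "\<And>t P. 0 \<le> t \<Longrightarrow> L (complex_of_real t *\<^sub>C P) = t * L P"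
    and Lq: "\<And>P. L P \<le> q P" and cone: "\<And>g r. (g, r) \<in> dominated_cone p X f \<Longrightarrow> r \<le> L g"
  proof (rule ex_linear_between_cone_and_sublinear[OF q real_cone_dominated_cone[where f = f, OF X f] le])
    fix L :: "(bool \<Rightarrow> nat \<Rightarrow> nat \<Rightarrow> complex) \<Rightarrow> real"
    assume L: "\<And>P Q. L (P + Q) = L P + L Q" "\<And>P. L (- P) = - L P"
      "\<And>t P. 0 \<le> t \<Longrightarrow> L (complex_of_real t *\<^sub>C P) = t * L P"
      "\<And>P. L P \<le> q P" "\<And>g r. (g, r) \<in> dominated_cone p X f \<Longrightarrow> r \<le> L g"
    show thesis by (rule that[OF L])
  qed
  define in1 :: "(nat \<Rightarrow> nat \<Rightarrow> complex) \<Rightarrow> bool \<Rightarrow> nat \<Rightarrow> nat \<Rightarrow> complex"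
    where "in1 A b = (if b then A else 0)" for A b
  define in2 :: "(nat \<Rightarrow> nat \<Rightarrow> complex) \<Rightarrow> bool \<Rightarrow> nat \<Rightarrow> nat \<Rightarrow> complex"
    where "in2 A b = (if b then 0 else A)" for A b
  have in_add: "in1 (A + B) = in1 A + in1 B" "in2 (A + B) = in2 A + in2 B" for A B
    by (simp_all add: in1_def in2_def fun_eq_iff)
  have in_minus: "in1 (- A) = - in1 A" "in2 (- A) = - in2 A" for A
    by (simp_all add: in1_def in2_def fun_eq_iff)
  have in_scale: "in1 (c *\<^sub>C A) = c *\<^sub>C in1 A" "in2 (c *\<^sub>C A) = c *\<^sub>C in2 A" for c A
    by (simp_all add: in1_def in2_def fun_eq_iff scaleC_fun_def scaleC_complex_def)
  have q_in: "q (in1 A) = M * herm_max p A" "q (in2 A) = M * herm_max p A" for A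
    unfolding q_def in1_def in2_def by (simp_all only: if_True if_False herm_max_zero add_0_left add_0_right)
  obtain \<rho> where \<rho>: "semi_inner \<rho>" "\<And>m \<alpha>. L (in1 (gram m \<alpha>)) = (\<Sum>i<m. Re (\<rho> (\<alpha> i) (\<alpha> i)))"
    "(\<Sum>k<p. Re (\<rho> (unit_vec k) (unit_vec k))) \<le> M"
  proof (rule semi_inner_of_functional[of "\<lambda>A. L (in1 A)" M p])
    show "L (in1 A) \<le> M * herm_max p A" for A using Lq[of "in1 A"] by (simp only: q_in)
  qed (simp_all only: in_add in_minus in_scale L M0)
  obtain \<sigma> where \<sigma>: "semi_inner \<sigma>" "\<And>m \<alpha>. L (in2 (gram m \<alpha>)) = (\<Sum>i<m. Re (\<sigma> (\<alpha> i) (\<alpha> i)))"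
    "(\<Sum>k<p. Re (\<sigma> (unit_vec k) (unit_vec k))) \<le> M"
  proof (rule semi_inner_of_functional[of "\<lambda>A. L (in2 A)" M p])
    show "L (in2 A) \<le> M * herm_max p A" for A using Lq[of "in2 A"] by (simp only: q_in)
  qed (simp_all only: in_add in_minus in_scale L M0)
  show thesis
  proof (rule that[OF \<rho>(1) \<sigma>(1) \<rho>(3) \<sigma>(3)])
    fix m x and \<alpha> \<beta> :: "nat \<Rightarrow> nat \<Rightarrow> complex"
    assume x: "x \<in> mat_ball (opspace X) m"
    have "2 * Re (\<Sum>i<m. \<Sum>j<m. pairing p f (x i j) (\<alpha> i) (\<beta> j))
        \<le> L (\<lambda>b. if b then gram m \<alpha> else gram m \<beta>)"
      using x by (intro cone) (auto simp: dominated_cone_def)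
    also have "(\<lambda>b. if b then gram m \<alpha> else gram m \<beta>) = in1 (gram m \<alpha>) + in2 (gram m \<beta>)"
      by (simp add: in1_def in2_def fun_eq_iff)
    finally show "2 * Re (\<Sum>i<m. \<Sum>j<m. pairing p f (x i j) (\<alpha> i) (\<beta> j))
        \<le> (\<Sum>i<m. Re (\<rho> (\<alpha> i) (\<alpha> i))) + (\<Sum>j<m. Re (\<sigma> (\<beta> j) (\<beta> j)))"
      by (simp only: L(1) \<rho>(2) \<sigma>(2))
  qed
qed

lemma sum_apply: "(\<Sum>i\<in>I. g i) x = (\<Sum>i\<in>I. g i x)"
  by (induction I rule: infinite_finite_induct) simp_all

lemma block_form_sum:
  fixes A :: "nat \<Rightarrow> nat \<Rightarrow> nat \<Rightarrow> nat \<Rightarrow> complex"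
  shows "(\<Sum>x\<in>{..<n} \<times> {..<p}. \<Sum>y\<in>{..<n} \<times> {..<p}. \<zeta> x * (case x of (i, k) \<Rightarrow> \<lambda>(j, l). A i j k l) y * \<xi> y)
      = (\<Sum>i<n. \<Sum>k<p. \<Sum>j<n. \<Sum>l<p. \<zeta> (i, k) * A i j k l * \<xi> (j, l))"
  by (simp add: sum.cartesian_product')

lemma ex_unimodular: "\<exists>u. cmod u = 1 \<and> u * z = complex_of_real (cmod z)"
proof (cases "z = 0")
  case True
  then show ?thesis by (auto intro!: exI[of _ 1])
next
  case False
  have "cnj z * z = (complex_of_real (cmod z))\<^sup>2"
    using complex_norm_square[of z] by (simp add: mult.commute)
  with False show ?thesis
    by (intro exI[of _ "cnj z / complex_of_real (cmod z)"])
      (simp add: norm_divide power2_eq_square)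
qed

lemma eq_zero_if_Re_mult_le:
  assumes "\<And>a. Re (a * z) \<le> c"
  shows "z = 0"
proof (rule ccontr)
  assume z: "z \<noteq> 0"
  define N where "N = (\<bar>c\<bar> + 1) / (cmod z)\<^sup>2"
  have "Re (complex_of_real N * cnj z * z) = N * (cmod z)\<^sup>2"
    unfolding mult.assoc mult.commute[of "cnj z"] complex_norm_square[symmetric] by simp
  then show False
    using assms[of "complex_of_real N * cnj z"] z by (simp add: N_def)
qed

text \<open>The unit ball of \<open>M\<^sub>p(X)\<close> is weak* dense in the unit ball of \<open>CB(X\<^sup>*, M\<^sub>p)\<close>, in the form of
  the estimate on functionals that is dual to it.  The dominating forms, orthonormalised, write
  \<open>f = c\<^sup>t f' d\<close> with \<open>f'\<close> in the unit ball of \<open>M\<^sub>p(X\<^sup>*)\<close> and with \<open>c\<close>, \<open>d\<close> of Hilbert--Schmidt norm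
  at most \<open>\<surd>M\<close>.\<close>

theorem dual_pairing_le:
  assumes X: "operator_space X" and p: "0 < p"
    and f: "\<And>k l. k < p \<Longrightarrow> l < p \<Longrightarrow> f k l \<in> points (dual (opspace X))"
    and M: "\<And>x. x \<in> mat_ball (opspace X) p \<Longrightarrow> cmod (\<Sum>k<p. \<Sum>l<p. f k l (x k l)) \<le> M"
    and F: "F \<in> CB_ball (dual (opspace X)) p"
  shows "cmod (\<Sum>k<p. \<Sum>l<p. F k l (f k l)) \<le> M"
proof -
  have M0: "0 \<le> M"
    using order_trans[OF norm_ge_zero M[OF zero_in_mat_ball_opspace[OF X]]] .
  have lin: "clinear_on X (f k l)" if "k < p" "l < p" for k l
    using f[OF that] by (simp add: points_dual)
  obtain \<rho> \<sigma> where \<rho>: "semi_inner \<rho>" and \<sigma>: "semi_inner \<sigma>"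
    and mass: "(\<Sum>k<p. Re (\<rho> (unit_vec k) (unit_vec k))) \<le> M"
      "(\<Sum>k<p. Re (\<sigma> (unit_vec k) (unit_vec k))) \<le> M"
    and dom: "\<And>m x \<alpha> \<beta>. x \<in> mat_ball (opspace X) m \<Longrightarrow>
      2 * Re (\<Sum>i<m. \<Sum>j<m. pairing p f (x i j) (\<alpha> i) (\<beta> j))
        \<le> (\<Sum>i<m. Re (\<rho> (\<alpha> i) (\<alpha> i))) + (\<Sum>j<m. Re (\<sigma> (\<beta> j) (\<beta> j)))"
  proof (rule ex_dominating_forms[where f = f, OF X lin M])
    fix \<rho> \<sigma> :: "(nat \<Rightarrow> complex) \<Rightarrow> (nat \<Rightarrow> complex) \<Rightarrow> complex"
    assume forms: "semi_inner \<rho>" "semi_inner \<sigma>" "(\<Sum>k<p. Re (\<rho> (unit_vec k) (unit_vec k))) \<le> M"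
      "(\<Sum>k<p. Re (\<sigma> (unit_vec k) (unit_vec k))) \<le> M"
      "\<And>m x \<alpha> \<beta>. x \<in> mat_ball (opspace X) m \<Longrightarrow>
        2 * Re (\<Sum>i<m. \<Sum>j<m. pairing p f (x i j) (\<alpha> i) (\<beta> j))
          \<le> (\<Sum>i<m. Re (\<rho> (\<alpha> i) (\<alpha> i))) + (\<Sum>j<m. Re (\<sigma> (\<beta> j) (\<beta> j)))"
    show thesis by (rule that[OF forms])
  qed
  interpret \<rho>: semi_inner \<rho> by (rule \<rho>)
  interpret \<sigma>: semi_inner \<sigma> by (rule \<sigma>)
  obtain e c where e: "\<rho>.orthosystem p e"
    and e_null: "\<And>k. k < p \<Longrightarrow> let w = unit_vec k - (\<Sum>i<p. c i k *\<^sub>C e i) in \<rho> w w = 0"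
    and c: "\<And>k. k < p \<Longrightarrow> (\<Sum>i<p. (cmod (c i k))\<^sup>2) = Re (\<rho> (unit_vec k) (unit_vec k))"
    using \<rho>.ex_orthosystem[of p unit_vec] by blast
  obtain e' d where e': "\<sigma>.orthosystem p e'"
    and e'_null: "\<And>k. k < p \<Longrightarrow> let w = unit_vec k - (\<Sum>i<p. d i k *\<^sub>C e' i) in \<sigma> w w = 0"
    and d: "\<And>k. k < p \<Longrightarrow> (\<Sum>i<p. (cmod (d i k))\<^sup>2) = Re (\<sigma> (unit_vec k) (unit_vec k))"
    using \<sigma>.ex_orthosystem[of p unit_vec] by blast
  define f' where "f' i j = (\<Sum>k<p. \<Sum>l<p. (e i k * e' j l) *\<^sub>C f k l)" for i j
  have f'_apply: "f' i j x = pairing p f x (e i) (e' j)" for i j x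
    by (simp add: f'_def pairing_def sum_apply scaleC_fun_def scaleC_complex_def)
  have sub: "csubspace (points (dual (opspace X)))" by (rule csubspace_points_dual)
  have f'_dual: "f' i j \<in> points (dual (opspace X))" for i j
    unfolding f'_def
    by (intro complex_vector.subspace_sum complex_vector.subspace_scale sub f) auto
  have ne: "mat_ball (opspace X) 1 \<noteq> {}"
    using zero_in_mat_ball_opspace[OF X, of 1] by blast
  have pairing_scale: "pairing p f (t *\<^sub>C x) a b = t * pairing p f x a b" if "x \<in> X" for t x a b
    using that lin by (simp add: pairing_def clinear_on_def scaleC_complex_def sum_distrib_left mult_ac)
  \<comment> \<open>Scaling a vector of seminorm zero leaves the bound on its pairings fixed, so they vanish.\<close>
  have dom1: "pairing p f x a b = 0"
    if x: "x \<in> X" and null: "\<rho> a a = 0 \<or> \<sigma> b b = 0" for x a b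
  proof -
    obtain t where t: "0 < t" and ball: "(\<lambda>_ _. complex_of_real t *\<^sub>C x) \<in> mat_ball (opspace X) 1"
      using scaled_in_mat_ball_opspace[OF X x] .
    have "2 * complex_of_real t * pairing p f x a b = 0"
    proof (rule eq_zero_if_Re_mult_le)
      fix r :: complex
      \<comment> \<open>The factor \<open>r\<close> is put on the side on which it does not change the bound.\<close>
      have "Re (r * (2 * complex_of_real t * pairing p f x a b))
          = 2 * Re (pairing p f (complex_of_real t *\<^sub>C x) (r *\<^sub>C a) b)"
        "Re (r * (2 * complex_of_real t * pairing p f x a b))
          = 2 * Re (pairing p f (complex_of_real t *\<^sub>C x) a (r *\<^sub>C b))"
        unfolding pairing_scale[OF x] pairing_scale_left pairing_scale_right
        by (simp_all add: algebra_simps)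
      moreover have "2 * Re (pairing p f (complex_of_real t *\<^sub>C x) a' b') \<le> Re (\<rho> a' a') + Re (\<sigma> b' b')" for a' b'
        using dom[OF ball, of "\<lambda>_. a'" "\<lambda>_. b'"] by simp
      ultimately have "Re (r * (2 * complex_of_real t * pairing p f x a b)) \<le> Re (\<rho> (r *\<^sub>C a) (r *\<^sub>C a)) + Re (\<sigma> b b)"
        "Re (r * (2 * complex_of_real t * pairing p f x a b)) \<le> Re (\<rho> a a) + Re (\<sigma> (r *\<^sub>C b) (r *\<^sub>C b))"
        by metis+
      then show "Re (r * (2 * complex_of_real t * pairing p f x a b)) \<le> Re (\<rho> a a) + Re (\<sigma> b b)"
        using null by (auto simp: \<rho>.scale_left \<rho>.scale_right \<sigma>.scale_left \<sigma>.scale_right)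
    qed
    then show ?thesis using t by simp
  qed
  have expand: "f k l = (\<Sum>i<p. 1 *\<^sub>C (\<Sum>j<p. (c i k * d j l) *\<^sub>C f' i j))" if kl: "k < p" "l < p" for k l
  proof
    fix x
    have combine: "(\<Sum>i<p. 1 *\<^sub>C (\<Sum>j<p. (c i k * d j l) *\<^sub>C f' i j)) x = (\<Sum>i<p. \<Sum>j<p. c i k * d j l * f' i j x)"
      by (simp add: scaleC_one sum_apply scaleC_fun_def scaleC_complex_def)
    show "f k l x = (\<Sum>i<p. 1 *\<^sub>C (\<Sum>j<p. (c i k * d j l) *\<^sub>C f' i j)) x"
    proof (cases "x \<in> X")
      case False
      then have "f k l x = 0" "\<And>i j. f' i j x = 0"
        using f[OF kl] f'_dual by (auto simp: points_dual)
      then show ?thesis unfolding combine by simp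
    next
      case True
      define w where "w = unit_vec k - (\<Sum>i<p. c i k *\<^sub>C e i)"
      define w' where "w' = unit_vec l - (\<Sum>j<p. d j l *\<^sub>C e' j)"
      have "f k l x = (\<Sum>k'<p. if k' = k then (\<Sum>l'<p. if l' = l then f k l x else 0) else 0)"
        using kl by simp
      also have "\<dots> = pairing p f x (unit_vec k) (unit_vec l)"
        unfolding pairing_def using kl by (intro sum.cong refl) (auto simp: unit_vec_def mult_delta_left)
      also have "\<dots> = pairing p f x ((\<Sum>i<p. c i k *\<^sub>C e i) + w) ((\<Sum>j<p. d j l *\<^sub>C e' j) + w')"
        unfolding w_def w'_def add_diff_eq add_diff_cancel_left' ..
      also have "\<dots> = pairing p f x (\<Sum>i<p. c i k *\<^sub>C e i) (\<Sum>j<p. d j l *\<^sub>C e' j)"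
        using dom1[OF True] e_null[OF kl(1)] e'_null[OF kl(2)]
        unfolding pairing_add_left pairing_add_right by (simp add: w_def w'_def Let_def)
      also have "\<dots> = (\<Sum>i<p. \<Sum>j<p. c i k * d j l * f' i j x)"
        unfolding pairing_sum_left unfolding pairing_sum_right
        by (simp add: f'_apply sum_distrib_left mult_ac)
      finally show ?thesis unfolding combine .
    qed
  qed
  have f'_ball: "f' \<in> mat_ball (dual (opspace X)) p"
    unfolding mat_ball_dual_iff[OF ne]
  proof (intro conjI allI impI ballI f'_dual)
    fix n v assume v: "v \<in> mat_ball (opspace X) n"
    show "block_norm n p (\<lambda>i j k l. f' k l (v i j)) \<le> 1"
      unfolding block_norm_def
    proof (rule scalar_mat_norm_le_bilinear, simp)
      fix \<zeta> \<xi> :: "nat \<times> nat \<Rightarrow> complex"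
      let ?P = "{..<n} \<times> {..<p}"
      assume \<zeta>: "L2_set (\<lambda>x. cmod (\<zeta> x)) ?P \<le> 1" and \<xi>: "L2_set (\<lambda>x. cmod (\<xi> x)) ?P \<le> 1"
      define z where "z = (\<Sum>x\<in>?P. \<Sum>y\<in>?P. \<zeta> x * (case x of (i, k) \<Rightarrow> \<lambda>(j, l). f' k l (v i j)) y * \<xi> y)"
      \<comment> \<open>The phase \<open>u\<close> turns the bound on real parts into one on moduli.\<close>
      obtain u where u: "cmod u = 1" "u * z = complex_of_real (cmod z)"
        using ex_unimodular[of z] by blast
      define \<alpha> where "\<alpha> i = (\<Sum>k<p. (u * \<zeta> (i, k)) *\<^sub>C e k)" for i
      define \<beta> where "\<beta> j = (\<Sum>l<p. \<xi> (j, l) *\<^sub>C e' l)" for j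
      have "u * z = (\<Sum>i<n. \<Sum>k<p. \<Sum>j<n. \<Sum>l<p. u * \<zeta> (i, k) * f' k l (v i j) * \<xi> (j, l))"
        unfolding z_def block_form_sum by (simp add: sum_distrib_left mult_ac)
      also have "\<dots> = (\<Sum>i<n. \<Sum>j<n. \<Sum>k<p. \<Sum>l<p. u * \<zeta> (i, k) * f' k l (v i j) * \<xi> (j, l))"
        by (intro sum.cong refl sum.swap)
      also have "\<dots> = (\<Sum>i<n. \<Sum>j<n. pairing p f (v i j) (\<alpha> i) (\<beta> j))"
        unfolding \<alpha>_def \<beta>_def pairing_sum_left unfolding pairing_sum_right
        by (simp add: f'_apply sum_distrib_left mult_ac)
      finally have "2 * cmod z = 2 * Re (\<Sum>i<n. \<Sum>j<n. pairing p f (v i j) (\<alpha> i) (\<beta> j))"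
        unfolding u(2) by (metis Re_complex_of_real)
      also have "\<dots> \<le> (\<Sum>i<n. Re (\<rho> (\<alpha> i) (\<alpha> i))) + (\<Sum>j<n. Re (\<sigma> (\<beta> j) (\<beta> j)))"
        by (rule dom[OF v])
      also have "\<dots> \<le> (\<Sum>i<n. \<Sum>k<p. (cmod (u * \<zeta> (i, k)))\<^sup>2) + (\<Sum>j<n. \<Sum>l<p. (cmod (\<xi> (j, l)))\<^sup>2)"
        unfolding \<alpha>_def \<beta>_def
        by (intro add_mono sum_mono \<rho>.orthosystem_sum_le[OF e] \<sigma>.orthosystem_sum_le[OF e'])
      also have "\<dots> = (L2_set (\<lambda>x. cmod (\<zeta> x)) ?P)\<^sup>2 + (L2_set (\<lambda>x. cmod (\<xi> x)) ?P)\<^sup>2"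
        by (simp add: L2_set_power2 norm_mult u(1) sum.cartesian_product')
      also have "\<dots> \<le> 1 + 1"
        using \<zeta> \<xi> by (intro add_mono power_le_one) auto
      finally show "cmod z \<le> 1" by simp
    qed
  qed
  have F_lin: "clinear_on (points (dual (opspace X))) (F k l)" if "k < p" "l < p" for k l
    using F that by (simp add: CB_ball_def CB_def)
  have F_expand: "F k l (f k l) = (\<Sum>i<p. \<Sum>j<p. c i k * F k l (f' i j) * d j l)" if kl: "k < p" "l < p" for k l
  proof -
    have "F k l (f k l) = (\<Sum>i<p. 1 *\<^sub>C F k l (\<Sum>j<p. (c i k * d j l) *\<^sub>C f' i j))"
      by (subst expand[OF kl], rule clinear_on_sum[OF sub F_lin[OF kl]])
        (intro complex_vector.subspace_sum complex_vector.subspace_scale sub f'_dual)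
    also have "\<dots> = (\<Sum>i<p. \<Sum>j<p. c i k * F k l (f' i j) * d j l)"
      unfolding scaleC_one clinear_on_sum[OF sub F_lin[OF kl] f'_dual]
      by (simp add: scaleC_complex_def mult_ac)
    finally show ?thesis .
  qed
  let ?P = "{..<p} \<times> {..<p}"
  have size: "(L2_set (\<lambda>x. cmod (case x of (i, k) \<Rightarrow> c i k)) ?P)\<^sup>2 \<le> M"
    if c: "\<And>k. k < p \<Longrightarrow> (\<Sum>i<p. (cmod (c i k))\<^sup>2) = Re (s (unit_vec k) (unit_vec k))"
      and "(\<Sum>k<p. Re (s (unit_vec k) (unit_vec k))) \<le> M" for c :: "nat \<Rightarrow> nat \<Rightarrow> complex" and s
  proof -
    have "(L2_set (\<lambda>x. cmod (case x of (i, k) \<Rightarrow> c i k)) ?P)\<^sup>2 = (\<Sum>i<p. \<Sum>k<p. (cmod (c i k))\<^sup>2)"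
      by (simp add: L2_set_power2 sum.cartesian_product')
    also have "\<dots> = (\<Sum>k<p. \<Sum>i<p. (cmod (c i k))\<^sup>2)"
      by (rule sum.swap)
    also have "\<dots> \<le> M" using that by simp
    finally show ?thesis .
  qed
  let ?\<zeta> = "\<lambda>(i, k). c i k" and ?\<xi> = "\<lambda>(j, l). d j l"
  have "(\<Sum>k<p. \<Sum>l<p. F k l (f k l)) = (\<Sum>k<p. \<Sum>l<p. \<Sum>i<p. \<Sum>j<p. c i k * F k l (f' i j) * d j l)"
    by (simp add: F_expand)
  also have "\<dots> = (\<Sum>i<p. \<Sum>j<p. \<Sum>k<p. \<Sum>l<p. c i k * F k l (f' i j) * d j l)"
    by (rule sum_swap4)
  also have "\<dots> = (\<Sum>i<p. \<Sum>k<p. \<Sum>j<p. \<Sum>l<p. c i k * F k l (f' i j) * d j l)"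
    by (intro sum.cong refl sum.swap)
  also have "\<dots> = (\<Sum>x\<in>?P. \<Sum>y\<in>?P. ?\<zeta> x * (case x of (i, k) \<Rightarrow> \<lambda>(j, l). F k l (f' i j)) y * ?\<xi> y)"
    unfolding block_form_sum by simp
  finally have "cmod (\<Sum>k<p. \<Sum>l<p. F k l (f k l)) = cmod (\<Sum>x\<in>?P. \<Sum>y\<in>?P.
      ?\<zeta> x * (case x of (i, k) \<Rightarrow> \<lambda>(j, l). F k l (f' i j)) y * ?\<xi> y)"
    by (rule arg_cong)
  also have "\<dots> \<le> block_norm p p (\<lambda>i j k l. F k l (f' i j))
      * (L2_set (\<lambda>x. cmod (?\<zeta> x)) ?P * L2_set (\<lambda>x. cmod (?\<xi> x)) ?P)"
    unfolding block_norm_def by (rule cmod_bilinear_le) simp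
  also have "\<dots> \<le> 1 * (sqrt M * sqrt M)"
    using mat_ball_pair[OF ne f'_ball p F] size[where c = c and s = \<rho>, OF c mass(1)]
      size[where c = d and s = \<sigma>, OF d mass(2)] M0
    by (intro mult_mono real_le_rsqrt) auto
  finally show ?thesis using M0 by simp
qed

section \<open>The norm of an algebraic tensor\<close>

lemma cspan_induct [consumes 1, case_names zero step]:
  assumes "u \<in> cspan B" and "P 0"
    and "\<And>c b u. b \<in> B \<Longrightarrow> u \<in> cspan B \<Longrightarrow> P u \<Longrightarrow> P (c *\<^sub>C b + u)"
  shows "P u"
proof -
  have "u \<in> cspan B \<and> P u"
    using assms(1)
  proof (induction rule: complex_vector.span_induct_alt)
    case base
    then show ?case using assms(2) complex_vector.span_zero by blast
  next
    case (step c b u)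
    then show ?case
      using assms(3) by (blast intro: complex_vector.span_add complex_vector.span_scale complex_vector.span_base)
  qed
  then show ?thesis by blast
qed

lemma csubspace_tensor_product: "csubspace (tensor_product V W)"
  unfolding tensor_product_def by (rule complex_vector.subspace_span)

text \<open>Contracting a tensor with a functional on one factor leaves an element of the other factor.\<close>

lemma tensor_contract_right:
  assumes V: "csubspace (points V)" and u: "u \<in> tensor_product V W"
    and G: "clinear_on (points W) G"
  shows "\<exists>h\<in>points V. \<forall>F. clinear_on (points V) F \<longrightarrow> F h = u (\<lambda>v w. F v * G w)"
  using u unfolding tensor_product_def
proof (induction rule: cspan_induct)
  case zero
  have "F 0 = 0" if "clinear_on (points V) F" for F :: "_ \<Rightarrow> complex"
    using clinear_on_sum[OF V that, of "{}"] by simp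
  then show ?case
    using complex_vector.subspace_0[OF V] by (intro bexI[of _ 0]) auto
next
  case (step c b u)
  then obtain h v w where h: "h \<in> points V" "\<And>F. clinear_on (points V) F \<Longrightarrow> F h = u (\<lambda>v w. F v * G w)"
    and b: "b = elem_tensor V W v w" "v \<in> points V" "w \<in> points W"
    by auto
  have "F ((c * G w) *\<^sub>C v + h) = (c *\<^sub>C b + u) (\<lambda>v w. F v * G w)" if F: "clinear_on (points V) F" for F
  proof -
    have "cbilinear_on (points V) (points W) (\<lambda>v w. F v * G w)"
      using F G by (auto simp: cbilinear_on_def clinear_on_def scaleC_complex_def algebra_simps)
    moreover have "F ((c * G w) *\<^sub>C v + h) = c * G w * F v + F h"
      using F b(2) h(1) complex_vector.subspace_scale[OF V b(2)]
      by (simp add: clinear_on_def scaleC_complex_def)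
    ultimately show ?thesis
      by (simp add: b(1) elem_tensor_def scaleC_fun_def scaleC_complex_def h(2)[OF F])
  qed
  moreover have "(c * G w) *\<^sub>C v + h \<in> points V"
    using V b(2) h(1) by (intro complex_vector.subspace_add complex_vector.subspace_scale)
  ultimately show ?case by blast
qed

lemma tensor_contract_left:
  assumes W: "csubspace (points W)" and u: "u \<in> tensor_product V W"
    and F: "clinear_on (points V) F"
  shows "\<exists>h\<in>points W. \<forall>G. clinear_on (points W) G \<longrightarrow> G h = u (\<lambda>v w. F v * G w)"
  using u unfolding tensor_product_def
proof (induction rule: cspan_induct)
  case zero
  have "G 0 = 0" if "clinear_on (points W) G" for G :: "_ \<Rightarrow> complex"
    using clinear_on_sum[OF W that, of "{}"] by simp
  then show ?case
    using complex_vector.subspace_0[OF W] by (intro bexI[of _ 0]) auto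
next
  case (step c b u)
  then obtain h v w where h: "h \<in> points W" "\<And>G. clinear_on (points W) G \<Longrightarrow> G h = u (\<lambda>v w. F v * G w)"
    and b: "b = elem_tensor V W v w" "v \<in> points V" "w \<in> points W"
    by auto
  have "G ((c * F v) *\<^sub>C w + h) = (c *\<^sub>C b + u) (\<lambda>v w. F v * G w)" if G: "clinear_on (points W) G" for G
  proof -
    have "cbilinear_on (points V) (points W) (\<lambda>v w. F v * G w)"
      using F G by (auto simp: cbilinear_on_def clinear_on_def scaleC_complex_def algebra_simps)
    moreover have "G ((c * F v) *\<^sub>C w + h) = c * F v * G w + G h"
      using G b(3) h(1) complex_vector.subspace_scale[OF W b(3)]
      by (simp add: clinear_on_def scaleC_complex_def)
    ultimately show ?thesis
      by (simp add: b(1) elem_tensor_def scaleC_fun_def scaleC_complex_def h(2)[OF G])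
  qed
  moreover have "(c * F v) *\<^sub>C w + h \<in> points W"
    using W b(3) h(1) by (intro complex_vector.subspace_add complex_vector.subspace_scale)
  ultimately show ?case by blast
qed

text \<open>The bilinear form that the natural embedding assigns to an algebraic tensor.\<close>

definition tensor_form ::
    "('a::complex_vector, 'y) matrix_normed_scheme \<Rightarrow> ('b::complex_vector, 'z) matrix_normed_scheme
      \<Rightarrow> ('a \<Rightarrow> complex, 'b \<Rightarrow> complex) tensor \<Rightarrow> 'a \<Rightarrow> 'b \<Rightarrow> complex"
  where "tensor_form V W u x y = (if x \<in> points V \<and> y \<in> points W then u (\<lambda>f g. f x * g y) else 0)"

lemma tensor_form_add: "tensor_form V W (u + u') = tensor_form V W u + tensor_form V W u'"
  and tensor_form_diff: "tensor_form V W (u - u') = tensor_form V W u - tensor_form V W u'"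
  and tensor_form_scale: "tensor_form V W (c *\<^sub>C u) = c *\<^sub>C tensor_form V W u"
  and tensor_form_zero: "tensor_form V W 0 = 0"
  by (auto simp: fun_eq_iff tensor_form_def scaleC_fun_def scaleC_complex_def)

lemma cbilinear_evaluation:
  "cbilinear_on (points (dual V)) (points (dual W)) (\<lambda>f g. f x * g y)"
  by (simp add: cbilinear_on_def clinear_on_def scaleC_fun_def scaleC_complex_def algebra_simps)

lemma tensor_form_elem_tensor:
  assumes "f \<in> points (dual V)" "g \<in> points (dual W)"
  shows "tensor_form V W (elem_tensor (dual V) (dual W) f g) = (\<lambda>x y. f x * g y)"
  using assms by (auto simp: fun_eq_iff tensor_form_def elem_tensor_def cbilinear_evaluation points_dual)

lemma SB_I:
  assumes "cbilinear_on (points V) (points W) \<phi>"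
    and "\<And>x y. x \<notin> points V \<or> y \<notin> points W \<Longrightarrow> \<phi> x y = 0"
    and "\<And>n v w. 0 < n \<Longrightarrow> v \<in> mat_ball V n \<Longrightarrow> w \<in> mat_ball W n \<Longrightarrow>
      scalar_mat_norm {..<n} (\<lambda>i j. \<phi> (v i j) (w i j)) \<le> C"
  shows "\<phi> \<in> SB V W"
proof -
  have "bdd_above (sb_values V W \<phi>)"
    using assms(3) unfolding sb_values_def bdd_above_def by blast
  then show ?thesis using assms(1,2) by (simp add: SB_def)
qed

lemma sb_norm_upper:
  assumes "\<phi> \<in> SB V W" "0 < n" "v \<in> mat_ball V n" "w \<in> mat_ball W n"
  shows "scalar_mat_norm {..<n} (\<lambda>i j. \<phi> (v i j) (w i j)) \<le> sb_norm V W \<phi>"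
  unfolding sb_norm_def using assms by (intro cSup_upper) (auto simp: sb_values_def SB_def)

lemma sb_norm_least:
  assumes "mat_ball V 1 \<noteq> {}" "mat_ball W 1 \<noteq> {}"
    and "\<And>n v w. 0 < n \<Longrightarrow> v \<in> mat_ball V n \<Longrightarrow> w \<in> mat_ball W n \<Longrightarrow>
      scalar_mat_norm {..<n} (\<lambda>i j. \<phi> (v i j) (w i j)) \<le> C"
  shows "sb_norm V W \<phi> \<le> C"
  unfolding sb_norm_def
proof (rule cSup_least)
  show "sb_values V W \<phi> \<noteq> {}"
    using assms(1,2) by (fastforce simp: sb_values_def)
qed (use assms(3) in \<open>auto simp: sb_values_def\<close>)

lemma SB_add:
  assumes "\<phi> \<in> SB V W" "\<psi> \<in> SB V W"
  shows "\<phi> + \<psi> \<in> SB V W"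
proof (rule SB_I)
  show "cbilinear_on (points V) (points W) (\<phi> + \<psi>)"
    using assms by (simp add: SB_def cbilinear_on_def clinear_on_def scaleC_complex_def algebra_simps)
  show "scalar_mat_norm {..<n} (\<lambda>i j. (\<phi> + \<psi>) (v i j) (w i j)) \<le> sb_norm V W \<phi> + sb_norm V W \<psi>"
    if "0 < n" "v \<in> mat_ball V n" "w \<in> mat_ball W n" for n v w
    using scalar_mat_norm_add_le[of "{..<n}" "\<lambda>i j. \<phi> (v i j) (w i j)" "\<lambda>i j. \<psi> (v i j) (w i j)"]
      sb_norm_upper[OF assms(1) that] sb_norm_upper[OF assms(2) that] by simp
qed (use assms in \<open>auto simp: SB_def\<close>)

lemma SB_scale:
  assumes "\<phi> \<in> SB V W"
  shows "c *\<^sub>C \<phi> \<in> SB V W"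
proof (rule SB_I)
  show "cbilinear_on (points V) (points W) (c *\<^sub>C \<phi>)"
    using assms by (simp add: SB_def cbilinear_on_def clinear_on_def scaleC_fun_def scaleC_complex_def algebra_simps)
  show "scalar_mat_norm {..<n} (\<lambda>i j. (c *\<^sub>C \<phi>) (v i j) (w i j)) \<le> cmod c * sb_norm V W \<phi>"
    if "0 < n" "v \<in> mat_ball V n" "w \<in> mat_ball W n" for n v w
    using scalar_mat_norm_cmult_le[of "{..<n}" c "\<lambda>i j. \<phi> (v i j) (w i j)"]
      mult_left_mono[OF sb_norm_upper[OF assms that], of "cmod c"]
    by (simp add: scaleC_fun_def scaleC_complex_def)
qed (use assms in \<open>auto simp: SB_def scaleC_fun_def scaleC_complex_def\<close>)

lemma csubspace_SB: "csubspace (SB V W)"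
proof (rule complex_vector.subspaceI)
  show "0 \<in> SB V W"
    by (rule SB_I[of _ _ _ 0])
      (auto simp: cbilinear_on_def clinear_on_def scaleC_complex_def intro!: scalar_mat_norm_le_bilinear)
qed (auto intro: SB_add SB_scale)

text \<open>Boundedness uses that the entrywise product of scalar matrices is contractive.\<close>

lemma tensor_form_in_SB:
  assumes "u \<in> tensor_product (dual V) (dual W)"
  shows "tensor_form V W u \<in> SB V W"
  using assms unfolding tensor_product_def
proof (induction rule: cspan_induct)
  case zero
  show ?case
    unfolding tensor_form_zero by (rule complex_vector.subspace_0[OF csubspace_SB])
next
  case (step c b u)
  then obtain f g where b: "b = elem_tensor (dual V) (dual W) f g"
    and fg: "f \<in> points (dual V)" "g \<in> points (dual W)"
    by auto
  obtain C D where
    C: "\<And>n v. n > 0 \<Longrightarrow> v \<in> mat_ball V n \<Longrightarrow> scalar_mat_norm {..<n} (\<lambda>i j. f (v i j)) \<le> C" and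
    D: "\<And>n v. n > 0 \<Longrightarrow> v \<in> mat_ball W n \<Longrightarrow> scalar_mat_norm {..<n} (\<lambda>i j. g (v i j)) \<le> D"
    using fg unfolding points_dual by metis
  have "tensor_form V W b \<in> SB V W"
    unfolding b tensor_form_elem_tensor[OF fg]
  proof (rule SB_I)
    show "cbilinear_on (points V) (points W) (\<lambda>x y. f x * g y)"
      using fg by (simp add: points_dual cbilinear_on_def clinear_on_def scaleC_complex_def algebra_simps)
    show "f x * g y = 0" if "x \<notin> points V \<or> y \<notin> points W" for x y
      using that fg by (auto simp: points_dual)
    show "scalar_mat_norm {..<n} (\<lambda>i j. f (v i j) * g (w i j)) \<le> C * D"
      if "0 < n" "v \<in> mat_ball V n" "w \<in> mat_ball W n" for n v w
      using C[OF that(1,2)] D[OF that(1,3)]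
        scalar_mat_norm_nonneg[of "{..<n}" "\<lambda>i j. f (v i j)"]
        scalar_mat_norm_nonneg[of "{..<n}" "\<lambda>i j. g (w i j)"]
      by (intro order_trans[OF scalar_mat_norm_schur_le] mult_mono) auto
  qed
  then show ?case
    unfolding tensor_form_add tensor_form_scale using step(3) by (intro SB_add SB_scale)
qed

text \<open>Replacing first \<open>F\<close> and then \<open>G\<close> by evaluations at matrices in the unit balls: with the other
  map fixed, a matrix coefficient of \<open>F \<bar>\<circ> G\<close> is a functional of the kind that \<open>dual_pairing_le\<close>
  controls.\<close>

lemma schur_map_le_tensor_form:
  assumes X: "operator_space X" and Y: "operator_space Y"
    and u: "u \<in> tensor_product (dual (opspace X)) (dual (opspace Y))"
    and p: "0 < p" and F: "F \<in> CB_ball (dual (opspace X)) p" and G: "G \<in> CB_ball (dual (opspace Y)) p"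
    and C: "\<And>x y. x \<in> mat_ball (opspace X) p \<Longrightarrow> y \<in> mat_ball (opspace Y) p \<Longrightarrow>
      scalar_mat_norm {..<p} (\<lambda>k l. tensor_form (opspace X) (opspace Y) u (x k l) (y k l)) \<le> C"
  shows "scalar_mat_norm {..<p} (\<lambda>k l. schur_map F G k l u) \<le> C"
proof (rule scalar_mat_norm_le_bilinear)
  fix \<zeta> \<xi> :: "nat \<Rightarrow> complex"
  assume \<zeta>: "L2_set (\<lambda>k. cmod (\<zeta> k)) {..<p} \<le> 1" and \<xi>: "L2_set (\<lambda>l. cmod (\<xi> l)) {..<p} \<le> 1"
  let ?D = "dual (opspace X)" and ?E = "dual (opspace Y)"
  have sub: "csubspace (points ?D)" "csubspace (points ?E)"
    by (rule csubspace_points_dual)+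
  have F_lin: "clinear_on (points ?D) (F k l)" and G_lin: "clinear_on (points ?E) (G k l)"
    if "k < p" "l < p" for k l
    using F G that by (simp_all add: CB_ball_def CB_def)
  have ev: "clinear_on (points ?D) (\<lambda>f. f x)" "clinear_on (points ?E) (\<lambda>g. g y)" for x y
    by (simp_all add: clinear_on_def scaleC_fun_def)
  have one: "cmod (\<Sum>k<p. \<Sum>l<p. \<zeta> k * u (\<lambda>f g. f (x k l) * G k l g) * \<xi> l) \<le> C"
    if x: "x \<in> mat_ball (opspace X) p" for x
  proof -
    have "\<forall>k l. \<exists>h\<in>points ?E. \<forall>G. clinear_on (points ?E) G \<longrightarrow> G h = u (\<lambda>f g. f (x k l) * G g)"
      using tensor_contract_left[OF sub(2) u ev(1)] by blast
    then obtain h where h: "\<And>k l. h k l \<in> points ?E"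
      "\<And>k l G. clinear_on (points ?E) G \<Longrightarrow> G (h k l) = u (\<lambda>f g. f (x k l) * G g)"
      by metis
    have "cmod (\<Sum>k<p. \<Sum>l<p. G k l ((\<zeta> k * \<xi> l) *\<^sub>C h k l)) \<le> C"
    proof (rule dual_pairing_le[OF Y p _ _ G])
      show "(\<zeta> k * \<xi> l) *\<^sub>C h k l \<in> points ?E" for k l
        by (intro complex_vector.subspace_scale sub h)
    next
      fix y assume y: "y \<in> mat_ball (opspace Y) p"
      have "((\<zeta> k * \<xi> l) *\<^sub>C h k l) (y k l)
          = \<zeta> k * tensor_form (opspace X) (opspace Y) u (x k l) (y k l) * \<xi> l" if "k < p" "l < p" for k l
        using h(2)[OF ev(2), of k l "y k l"] mat_ball_opspaceD(1)[OF x that] mat_ball_opspaceD(1)[OF y that]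
        by (simp add: scaleC_fun_def scaleC_complex_def tensor_form_def)
      then have "cmod (\<Sum>k<p. \<Sum>l<p. ((\<zeta> k * \<xi> l) *\<^sub>C h k l) (y k l))
          = cmod (\<Sum>k<p. \<Sum>l<p. \<zeta> k * tensor_form (opspace X) (opspace Y) u (x k l) (y k l) * \<xi> l)"
        by simp
      also have "\<dots> \<le> scalar_mat_norm {..<p} (\<lambda>k l. tensor_form (opspace X) (opspace Y) u (x k l) (y k l))
          * (L2_set (\<lambda>k. cmod (\<zeta> k)) {..<p} * L2_set (\<lambda>l. cmod (\<xi> l)) {..<p})"
        by (rule cmod_bilinear_le) simp
      also have "\<dots> \<le> scalar_mat_norm {..<p} (\<lambda>k l. tensor_form (opspace X) (opspace Y) u (x k l) (y k l))"
        using \<zeta> \<xi> by (simp add: mult_left_le mult_le_one scalar_mat_norm_nonneg)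
      also have "\<dots> \<le> C" by (rule C[OF x y])
      finally show "cmod (\<Sum>k<p. \<Sum>l<p. ((\<zeta> k * \<xi> l) *\<^sub>C h k l) (y k l)) \<le> C" .
    qed
    moreover have "G k l ((\<zeta> k * \<xi> l) *\<^sub>C h k l) = \<zeta> k * u (\<lambda>f g. f (x k l) * G k l g) * \<xi> l"
      if "k < p" "l < p" for k l
    proof -
      have "G k l ((\<zeta> k * \<xi> l) *\<^sub>C h k l) = \<zeta> k * \<xi> l * G k l (h k l)"
        using G_lin[OF that] h(1) by (simp add: clinear_on_def scaleC_complex_def)
      then show ?thesis by (simp add: h(2)[OF G_lin[OF that]] mult_ac)
    qed
    ultimately show ?thesis by simp
  qed
  have "\<forall>k l. \<exists>h. k < p \<longrightarrow> l < p \<longrightarrow> h \<in> points ?D \<and>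
      (\<forall>F. clinear_on (points ?D) F \<longrightarrow> F h = u (\<lambda>f g. F f * G k l g))"
    using tensor_contract_right[OF sub(1) u G_lin] by blast
  then obtain h where h: "\<And>k l. k < p \<Longrightarrow> l < p \<Longrightarrow> h k l \<in> points ?D"
    "\<And>k l F. k < p \<Longrightarrow> l < p \<Longrightarrow> clinear_on (points ?D) F \<Longrightarrow> F (h k l) = u (\<lambda>f g. F f * G k l g)"
    by metis
  have "cmod (\<Sum>k<p. \<Sum>l<p. F k l ((\<zeta> k * \<xi> l) *\<^sub>C h k l)) \<le> C"
  proof (rule dual_pairing_le[OF X p _ _ F])
    show "(\<zeta> k * \<xi> l) *\<^sub>C h k l \<in> points ?D" if "k < p" "l < p" for k l
      by (intro complex_vector.subspace_scale sub h that)
  next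
    fix x assume x: "x \<in> mat_ball (opspace X) p"
    have "((\<zeta> k * \<xi> l) *\<^sub>C h k l) (x k l) = \<zeta> k * u (\<lambda>f g. f (x k l) * G k l g) * \<xi> l"
      if "k < p" "l < p" for k l
      using h(2)[OF that ev(1), of "x k l"] by (simp add: scaleC_fun_def scaleC_complex_def)
    then show "cmod (\<Sum>k<p. \<Sum>l<p. ((\<zeta> k * \<xi> l) *\<^sub>C h k l) (x k l)) \<le> C"
      using one[OF x] by simp
  qed
  moreover have "F k l ((\<zeta> k * \<xi> l) *\<^sub>C h k l) = \<zeta> k * schur_map F G k l u * \<xi> l"
    if "k < p" "l < p" for k l
  proof -
    have "F k l ((\<zeta> k * \<xi> l) *\<^sub>C h k l) = \<zeta> k * \<xi> l * F k l (h k l)"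
      using F_lin[OF that] h(1)[OF that] by (simp add: clinear_on_def scaleC_complex_def)
    then show ?thesis by (simp add: h(2)[OF that F_lin[OF that]] schur_map_def mult_ac)
  qed
  ultimately show "cmod (\<Sum>k<p. \<Sum>l<p. \<zeta> k * schur_map F G k l u * \<xi> l) \<le> C"
    by simp
qed simp

text \<open>Evaluations at matrices in the unit balls are among the maps over which the \<open>s'\<close>-norm is a supremum,
  and the preceding lemma shows that the other maps do not increase it.\<close>

theorem s'_norm1_eq_sb_norm:
  assumes X: "operator_space X" and Y: "operator_space Y"
    and u: "u \<in> tensor_product (dual (opspace X)) (dual (opspace Y))"
  shows "s'_norm1 (dual (opspace X)) (dual (opspace Y)) u
    = sb_norm (opspace X) (opspace Y) (tensor_form (opspace X) (opspace Y) u)"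
proof -
  let ?D = "dual (opspace X)" and ?E = "dual (opspace Y)"
  let ?\<phi> = "tensor_form (opspace X) (opspace Y) u"
  define A where "A = {block_norm 1 p (\<lambda>i j k l. schur_map F G k l u) | p F G.
    0 < p \<and> F \<in> CB_ball ?D p \<and> G \<in> CB_ball ?E p}"
  have ne: "mat_ball (opspace X) 1 \<noteq> {}" "mat_ball (opspace Y) 1 \<noteq> {}"
    using zero_in_mat_ball_opspace[OF X] zero_in_mat_ball_opspace[OF Y] by auto
  have SB: "?\<phi> \<in> SB (opspace X) (opspace Y)"
    by (rule tensor_form_in_SB[OF u])
  have upper: "r \<le> sb_norm (opspace X) (opspace Y) ?\<phi>" if r: "r \<in> A" for r
  proof -
    obtain p F G where p: "0 < p" "F \<in> CB_ball ?D p" "G \<in> CB_ball ?E p"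
      and "r = block_norm 1 p (\<lambda>i j k l. schur_map F G k l u)"
      using r by (auto simp: A_def)
    then show ?thesis
      unfolding block_norm_one_left
      using schur_map_le_tensor_form[OF X Y u p sb_norm_upper[OF SB p(1)]] by simp
  qed
  have mem: "scalar_mat_norm {..<n} (\<lambda>i j. ?\<phi> (v i j) (w i j)) \<in> A"
    if n: "0 < n" and v: "v \<in> mat_ball (opspace X) n" and w: "w \<in> mat_ball (opspace Y) n" for n v w
  proof -
    have "scalar_mat_norm {..<n} (\<lambda>i j. ?\<phi> (v i j) (w i j))
        = block_norm 1 n (\<lambda>i j k l. schur_map (\<lambda>k l f. f (v k l)) (\<lambda>k l g. g (w k l)) k l u)"
      unfolding block_norm_one_left
      using mat_ball_opspaceD(1)[OF v] mat_ball_opspaceD(1)[OF w]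
      by (intro scalar_mat_norm_cong) (auto simp: tensor_form_def schur_map_def)
    then show ?thesis
      unfolding A_def using n evaluation_in_CB_ball[OF n v ne(1)] evaluation_in_CB_ball[OF n w ne(2)]
      by blast
  qed
  have bdd: "bdd_above A" using upper by (auto simp: bdd_above_def)
  have "A \<noteq> {}" using mem[of 1] ne by fastforce
  then have "Sup A \<le> sb_norm (opspace X) (opspace Y) ?\<phi>"
    using upper by (rule cSup_least)
  moreover have "sb_norm (opspace X) (opspace Y) ?\<phi> \<le> Sup A"
    by (intro sb_norm_least ne cSup_upper mem bdd)
  ultimately show ?thesis
    unfolding s'_norm_def A_def by simp
qed

section \<open>Extension to the completion\<close>

lemma sb_norm_nonneg:
  assumes "mat_ball V 1 \<noteq> {}" "mat_ball W 1 \<noteq> {}" "\<phi> \<in> SB V W"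
  shows "0 \<le> sb_norm V W \<phi>"
proof -
  obtain v w where "v \<in> mat_ball V 1" "w \<in> mat_ball W 1" using assms by blast
  then have "scalar_mat_norm {..<1} (\<lambda>i j. \<phi> (v i j) (w i j)) \<le> sb_norm V W \<phi>"
    by (intro sb_norm_upper assms) auto
  then show ?thesis
    using scalar_mat_norm_nonneg[of "{..<1::nat}"] by (meson finite_lessThan order_trans)
qed

lemma sb_norm_add_le:
  assumes "mat_ball V 1 \<noteq> {}" "mat_ball W 1 \<noteq> {}" "\<phi> \<in> SB V W" "\<psi> \<in> SB V W"
  shows "sb_norm V W (\<phi> + \<psi>) \<le> sb_norm V W \<phi> + sb_norm V W \<psi>"
proof (rule sb_norm_least[OF assms(1,2)])
  show "scalar_mat_norm {..<n} (\<lambda>i j. (\<phi> + \<psi>) (v i j) (w i j)) \<le> sb_norm V W \<phi> + sb_norm V W \<psi>"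
    if "0 < n" "v \<in> mat_ball V n" "w \<in> mat_ball W n" for n v w
    using scalar_mat_norm_add_le[of "{..<n}" "\<lambda>i j. \<phi> (v i j) (w i j)" "\<lambda>i j. \<psi> (v i j) (w i j)"]
      sb_norm_upper[OF assms(3) that] sb_norm_upper[OF assms(4) that] by simp
qed

lemma sb_norm_scale_le:
  assumes "mat_ball V 1 \<noteq> {}" "mat_ball W 1 \<noteq> {}" "\<phi> \<in> SB V W"
  shows "sb_norm V W (c *\<^sub>C \<phi>) \<le> cmod c * sb_norm V W \<phi>"
proof (rule sb_norm_least[OF assms(1,2)])
  show "scalar_mat_norm {..<n} (\<lambda>i j. (c *\<^sub>C \<phi>) (v i j) (w i j)) \<le> cmod c * sb_norm V W \<phi>"
    if "0 < n" "v \<in> mat_ball V n" "w \<in> mat_ball W n" for n v w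
    using scalar_mat_norm_cmult_le[of "{..<n}" c "\<lambda>i j. \<phi> (v i j) (w i j)"]
      mult_left_mono[OF sb_norm_upper[OF assms(3) that], of "cmod c"]
    by (simp add: scaleC_fun_def scaleC_complex_def)
qed

locale operator_space_pair =
  fixes X :: "('h::complex_hilbert \<Rightarrow>\<^sub>L 'h) set" and Y :: "('k::complex_hilbert \<Rightarrow>\<^sub>L 'k) set"
  assumes X: "operator_space X" and Y: "operator_space Y"
begin

abbreviation "forms \<equiv> SB (opspace X) (opspace Y)"
abbreviation "sb \<equiv> sb_norm (opspace X) (opspace Y)"
abbreviation "tensors \<equiv> tensor_product (dual (opspace X)) (dual (opspace Y))"
abbreviation "tnorm \<equiv> s'_norm1 (dual (opspace X)) (dual (opspace Y))"
abbreviation "form \<equiv> tensor_form (opspace X) (opspace Y)"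
abbreviation "cauchy \<equiv> Cauchy_seqs tensors tnorm"
abbreviation "cls \<equiv> seq_class tensors tnorm"

(* Otherwise the 1 inside tnorm is rewritten to Suc 0, and facts about tnorm no longer match. *)
declare One_nat_def [simp del]

lemma ball_nonempty: "mat_ball (opspace X) 1 \<noteq> {}" "mat_ball (opspace Y) 1 \<noteq> {}"
  using zero_in_mat_ball_opspace[OF X] zero_in_mat_ball_opspace[OF Y] by auto

lemmas sb_nonneg = sb_norm_nonneg[OF ball_nonempty]
  and sb_add_le = sb_norm_add_le[OF ball_nonempty]
  and sb_scale_le = sb_norm_scale_le[OF ball_nonempty]

lemma forms_subspace:
  "\<phi> \<in> forms \<Longrightarrow> \<psi> \<in> forms \<Longrightarrow> \<phi> + \<psi> \<in> forms"
  "\<phi> \<in> forms \<Longrightarrow> \<psi> \<in> forms \<Longrightarrow> \<phi> - \<psi> \<in> forms"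
  "\<phi> \<in> forms \<Longrightarrow> c *\<^sub>C \<phi> \<in> forms" "0 \<in> forms"
  by (simp_all only: csubspace_SB complex_vector.subspace_add complex_vector.subspace_diff
      complex_vector.subspace_scale complex_vector.subspace_0)

lemma tensors_subspace:
  "u \<in> tensors \<Longrightarrow> w \<in> tensors \<Longrightarrow> u + w \<in> tensors"
  "u \<in> tensors \<Longrightarrow> w \<in> tensors \<Longrightarrow> u - w \<in> tensors"
  "u \<in> tensors \<Longrightarrow> c *\<^sub>C u \<in> tensors" "0 \<in> tensors"
  by (simp_all only: csubspace_tensor_product complex_vector.subspace_add complex_vector.subspace_diff
      complex_vector.subspace_scale complex_vector.subspace_0)

lemma form_in [simp]: "u \<in> tensors \<Longrightarrow> form u \<in> forms"
  by (rule tensor_form_in_SB)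

lemma tnorm_eq: "u \<in> tensors \<Longrightarrow> tnorm u = sb (form u)"
  by (rule s'_norm1_eq_sb_norm[OF X Y])

lemma sb_minus_le:
  assumes "\<phi> \<in> forms" "\<psi> \<in> forms"
  shows "sb (\<phi> - \<psi>) \<le> sb (\<psi> - \<phi>)"
proof -
  have "\<phi> - \<psi> = (- 1) *\<^sub>C (\<psi> - \<phi>)" by simp
  then show ?thesis
    using sb_scale_le[OF forms_subspace(2)[OF assms(2,1)], of "- 1"] by simp
qed

lemma sb_commute: "\<phi> \<in> forms \<Longrightarrow> \<psi> \<in> forms \<Longrightarrow> sb (\<phi> - \<psi>) = sb (\<psi> - \<phi>)"
  by (intro antisym sb_minus_le)

lemma sb_triangle:
  assumes "\<phi> \<in> forms" "\<eta> \<in> forms" "\<psi> \<in> forms"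
  shows "sb (\<phi> - \<psi>) \<le> sb (\<phi> - \<eta>) + sb (\<eta> - \<psi>)"
proof -
  have "\<phi> - \<psi> = (\<phi> - \<eta>) + (\<eta> - \<psi>)" by simp
  then show ?thesis
    using sb_add_le[OF forms_subspace(2)[OF assms(1,2)] forms_subspace(2)[OF assms(2,3)]]
    by (simp only:)
qed

lemma sb_zero: "sb 0 = 0"
  using sb_scale_le[OF forms_subspace(4), of 0] sb_nonneg[OF forms_subspace(4)] by simp

lemma sb_reverse_triangle:
  assumes "\<phi> \<in> forms" "\<psi> \<in> forms"
  shows "\<bar>sb \<phi> - sb \<psi>\<bar> \<le> sb (\<phi> - \<psi>)"
proof -
  have "sb \<phi> \<le> sb (\<phi> - \<psi>) + sb \<psi>" "sb \<psi> \<le> sb (\<psi> - \<phi>) + sb \<phi>"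
    using sb_triangle[of \<phi> \<psi> 0] sb_triangle[of \<psi> \<phi> 0] assms forms_subspace(4) by (simp_all only: diff_0_right)
  then show ?thesis using sb_commute[OF assms] by simp
qed

text \<open>The norm dominates the values because a multiple of any operator is a \<open>1 \<times> 1\<close> matrix in the
  unit ball.\<close>

lemma ex_value_bound: "\<exists>K\<ge>0. \<forall>\<phi>\<in>forms. cmod (\<phi> x y) \<le> K * sb \<phi>"
proof (cases "x \<in> X \<and> y \<in> Y")
  case False
  then have "\<phi> x y = 0" if "\<phi> \<in> forms" for \<phi> using that by (auto simp: SB_def)
  then show ?thesis by (intro exI[of _ 0]) auto
next
  case True
  obtain s where s: "0 < s" "(\<lambda>_ _. complex_of_real s *\<^sub>C x) \<in> mat_ball (opspace X) 1"
    using scaled_in_mat_ball_opspace[OF X] True by blast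
  obtain t where t: "0 < t" "(\<lambda>_ _. complex_of_real t *\<^sub>C y) \<in> mat_ball (opspace Y) 1"
    using scaled_in_mat_ball_opspace[OF Y] True by blast
  have "cmod (\<phi> x y) \<le> 1 / (s * t) * sb \<phi>" if \<phi>: "\<phi> \<in> forms" for \<phi>
  proof -
    have "cmod (\<phi> (complex_of_real s *\<^sub>C x) (complex_of_real t *\<^sub>C y)) \<le> sb \<phi>"
      using sb_norm_upper[OF \<phi> _ s(2) t(2)]
        scalar_mat_norm_entry[of "{..<1::nat}" 0 0 "\<lambda>i j. \<phi> (complex_of_real s *\<^sub>C x) (complex_of_real t *\<^sub>C y)"]
      by simp
    moreover have "\<phi> (complex_of_real s *\<^sub>C x) (complex_of_real t *\<^sub>C y) = complex_of_real (s * t) * \<phi> x y"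
    proof -
      have "complex_of_real t *\<^sub>C y \<in> Y"
        using True by (intro complex_vector.subspace_scale operator_spaceD Y) simp
      then show ?thesis
        using \<phi> True by (simp add: SB_def cbilinear_on_def clinear_on_def scaleC_complex_def)
    qed
    ultimately show ?thesis
      using s(1) t(1) by (simp add: norm_mult field_simps)
  qed
  then show ?thesis
    using s(1) t(1) by (intro exI[of _ "1 / (s * t)"]) auto
qed

lemma eq_if_sb_diff_zero:
  assumes "\<phi> \<in> forms" "\<psi> \<in> forms" "sb (\<phi> - \<psi>) \<le> 0"
  shows "\<phi> = \<psi>"
proof (intro ext)
  fix x y
  obtain K where K: "0 \<le> K" "\<forall>\<phi>\<in>forms. cmod (\<phi> x y) \<le> K * sb \<phi>"
    using ex_value_bound by blast
  then have "cmod ((\<phi> - \<psi>) x y) \<le> K * sb (\<phi> - \<psi>)"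
    using forms_subspace(2)[OF assms(1,2)] by blast
  also have "\<dots> \<le> 0" using K(1) assms(3) by (rule mult_nonneg_nonpos)
  finally show "\<phi> x y = \<psi> x y" by simp
qed

text \<open>Balls of forms are closed under pointwise limits, because each matrix norm in the definition involves
  finitely many values only.\<close>

lemma sb_limit_le:
  assumes \<phi>: "\<And>n. \<phi> n \<in> forms" and le: "\<And>n. n \<ge> N \<Longrightarrow> sb (\<phi> n) \<le> c"
    and lim: "\<And>x y. (\<lambda>n. \<phi> n x y) \<longlonglongrightarrow> \<psi> x y"
  shows "\<psi> \<in> forms" "sb \<psi> \<le> c"
proof -
  have bound: "scalar_mat_norm {..<m} (\<lambda>i j. \<psi> (v i j) (w i j)) \<le> c"
    if vw: "0 < m" "v \<in> mat_ball (opspace X) m" "w \<in> mat_ball (opspace Y) m" for m v w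
  proof (rule scalar_mat_norm_le_bilinear)
    fix \<zeta> \<xi> :: "nat \<Rightarrow> complex"
    assume \<zeta>: "L2_set (\<lambda>k. cmod (\<zeta> k)) {..<m} \<le> 1" and \<xi>: "L2_set (\<lambda>l. cmod (\<xi> l)) {..<m} \<le> 1"
    have "(\<lambda>n. cmod (\<Sum>i<m. \<Sum>j<m. \<zeta> i * \<phi> n (v i j) (w i j) * \<xi> j))
        \<longlonglongrightarrow> cmod (\<Sum>i<m. \<Sum>j<m. \<zeta> i * \<psi> (v i j) (w i j) * \<xi> j)"
      by (intro tendsto_intros lim)
    moreover have "cmod (\<Sum>i<m. \<Sum>j<m. \<zeta> i * \<phi> n (v i j) (w i j) * \<xi> j) \<le> c" if "n \<ge> N" for n
    proof -
      have "cmod (\<Sum>i<m. \<Sum>j<m. \<zeta> i * \<phi> n (v i j) (w i j) * \<xi> j)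
          \<le> scalar_mat_norm {..<m} (\<lambda>i j. \<phi> n (v i j) (w i j))
            * (L2_set (\<lambda>k. cmod (\<zeta> k)) {..<m} * L2_set (\<lambda>l. cmod (\<xi> l)) {..<m})"
        by (rule cmod_bilinear_le) simp
      also have "\<dots> \<le> scalar_mat_norm {..<m} (\<lambda>i j. \<phi> n (v i j) (w i j))"
        using \<zeta> \<xi> by (simp add: mult_left_le mult_le_one scalar_mat_norm_nonneg)
      also have "\<dots> \<le> c"
        using sb_norm_upper[OF \<phi> vw] le[OF that] by (rule order_trans)
      finally show ?thesis .
    qed
    ultimately show "cmod (\<Sum>i<m. \<Sum>j<m. \<zeta> i * \<psi> (v i j) (w i j) * \<xi> j) \<le> c"
      by (intro Lim_bounded[where M = N]) auto
  qed simp
  show "sb \<psi> \<le> c"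
    by (rule sb_norm_least[OF ball_nonempty bound])
  show "\<psi> \<in> forms"
  proof (rule SB_I[OF _ _ bound])
    have unique: "\<psi> x y = b" if "\<And>n. \<phi> n x y = a n" "a \<longlonglongrightarrow> b" for x y a b
      using lim[of x y] that by (simp add: LIMSEQ_unique)
    show "\<psi> x y = 0" if "x \<notin> points (opspace X) \<or> y \<notin> points (opspace Y)" for x y
      using \<phi> that by (intro unique[of _ _ "\<lambda>_. 0"]) (auto simp: SB_def)
    show "cbilinear_on (points (opspace X)) (points (opspace Y)) \<psi>"
      unfolding cbilinear_on_def clinear_on_def
    proof (intro conjI ballI allI)
      fix y x x' assume "y \<in> points (opspace Y)" "x \<in> points (opspace X)" "x' \<in> points (opspace X)"
      then show "\<psi> (x + x') y = \<psi> x y + \<psi> x' y"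
        using \<phi> by (intro unique[OF _ tendsto_add[OF lim lim]])
          (simp add: SB_def cbilinear_on_def clinear_on_def)
    next
      fix y a x assume "y \<in> points (opspace Y)" "x \<in> points (opspace X)"
      then show "\<psi> (a *\<^sub>C x) y = a *\<^sub>C \<psi> x y"
        unfolding scaleC_complex_def using \<phi> by (intro unique[OF _ tendsto_mult_left[OF lim]])
          (simp add: SB_def cbilinear_on_def clinear_on_def scaleC_complex_def)
    next
      fix x y y' assume "x \<in> points (opspace X)" "y \<in> points (opspace Y)" "y' \<in> points (opspace Y)"
      then show "\<psi> x (y + y') = \<psi> x y + \<psi> x y'"
        using \<phi> by (intro unique[OF _ tendsto_add[OF lim lim]])
          (simp add: SB_def cbilinear_on_def clinear_on_def)
    next
      fix x a y assume "x \<in> points (opspace X)" "y \<in> points (opspace Y)"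
      then show "\<psi> x (a *\<^sub>C y) = a *\<^sub>C \<psi> x y"
        unfolding scaleC_complex_def using \<phi> by (intro unique[OF _ tendsto_mult_left[OF lim]])
          (simp add: SB_def cbilinear_on_def clinear_on_def scaleC_complex_def)
    qed
  qed
qed

text \<open>The sequence \<open>u\<close> of tensors converges to \<open>\<phi>\<close> when tensors are identified with forms.\<close>

definition represents :: "(nat \<Rightarrow> (('h \<Rightarrow>\<^sub>L 'h) \<Rightarrow> complex, ('k \<Rightarrow>\<^sub>L 'k) \<Rightarrow> complex) tensor)
    \<Rightarrow> (('h \<Rightarrow>\<^sub>L 'h) \<Rightarrow> ('k \<Rightarrow>\<^sub>L 'k) \<Rightarrow> complex) \<Rightarrow> bool"
  where "represents u \<phi> \<longleftrightarrow> \<phi> \<in> forms \<and> (\<lambda>n. sb (form (u n) - \<phi>)) \<longlonglongrightarrow> 0"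

lemma cauchyD:
  assumes "u \<in> cauchy"
  shows "u n \<in> tensors" "0 < \<epsilon> \<Longrightarrow> \<exists>M. \<forall>m\<ge>M. \<forall>n\<ge>M. tnorm (u m - u n) < \<epsilon>"
  using assms by (auto simp: Cauchy_seqs_def)

lemma tnorm_diff: "u \<in> tensors \<Longrightarrow> w \<in> tensors \<Longrightarrow> tnorm (u - w) = sb (form u - form w)"
  by (simp only: tnorm_eq tensors_subspace tensor_form_diff)

text \<open>The forms of a Cauchy sequence converge pointwise, since the norm controls values; closedness of balls
  under pointwise limits turns this into convergence in norm.\<close>

lemma ex_represents:
  assumes u: "u \<in> cauchy"
  shows "\<exists>\<phi>. represents u \<phi>"
proof -
  have uS: "u n \<in> tensors" for n by (rule cauchyD(1)[OF u])
  have "convergent (\<lambda>n. form (u n) x y)" for x y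
  proof (rule Cauchy_convergent, rule CauchyI)
    fix \<epsilon> :: real assume \<epsilon>: "0 < \<epsilon>"
    obtain K where K: "0 \<le> K" "\<forall>\<phi>\<in>forms. cmod (\<phi> x y) \<le> K * sb \<phi>"
      using ex_value_bound by blast
    obtain M where M: "\<forall>m\<ge>M. \<forall>n\<ge>M. tnorm (u m - u n) < \<epsilon> / (K + 1)"
      using cauchyD(2)[OF u, of "\<epsilon> / (K + 1)"] \<epsilon> K(1) by auto
    have "norm (form (u m) x y - form (u n) x y) < \<epsilon>" if "m \<ge> M" "n \<ge> M" for m n
    proof -
      have "norm ((form (u m) - form (u n)) x y) \<le> K * sb (form (u m) - form (u n))"
        using K(2) forms_subspace(2)[OF form_in[OF uS] form_in[OF uS]] by blast
      also have "\<dots> \<le> K * (\<epsilon> / (K + 1))"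
        using M that K(1) unfolding tnorm_diff[OF uS uS] by (intro mult_left_mono) (auto intro: less_imp_le)
      also have "\<dots> < \<epsilon>"
        using \<epsilon> K(1) by (simp add: pos_divide_less_eq)
      finally show ?thesis by simp
    qed
    then show "\<exists>M. \<forall>m\<ge>M. \<forall>n\<ge>M. norm (form (u m) x y - form (u n) x y) < \<epsilon>"
      by blast
  qed
  then have "\<forall>x y. \<exists>l. (\<lambda>n. form (u n) x y) \<longlonglongrightarrow> l"
    by (simp add: convergent_def)
  then obtain \<phi> where \<phi>: "\<And>x y. (\<lambda>n. form (u n) x y) \<longlonglongrightarrow> \<phi> x y"
    by metis
  have tail: "\<exists>M. \<forall>m\<ge>M. form (u m) - \<phi> \<in> forms \<and> sb (form (u m) - \<phi>) \<le> \<epsilon>" if \<epsilon>: "0 < \<epsilon>" for \<epsilon>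
  proof -
    obtain M where M: "\<forall>m\<ge>M. \<forall>n\<ge>M. tnorm (u m - u n) < \<epsilon>"
      using cauchyD(2)[OF u \<epsilon>] by blast
    have "form (u m) - \<phi> \<in> forms \<and> sb (form (u m) - \<phi>) \<le> \<epsilon>" if m: "m \<ge> M" for m
    proof -
      have 1: "form (u m) - form (u n) \<in> forms" for n
        by (intro forms_subspace form_in uS)
      have 2: "sb (form (u m) - form (u n)) \<le> \<epsilon>" if "n \<ge> M" for n
        using M m that unfolding tnorm_diff[OF uS uS] by (intro less_imp_le) auto
      have 3: "(\<lambda>n. (form (u m) - form (u n)) x y) \<longlonglongrightarrow> (form (u m) - \<phi>) x y" for x y
        using tendsto_diff[OF tendsto_const \<phi>, of "form (u m) x y" x y] by simp
      show ?thesis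
        by (intro conjI sb_limit_le[where \<phi> = "\<lambda>n. form (u m) - form (u n)" and N = M, OF 1 2 3])
    qed
    then show ?thesis by blast
  qed
  have "\<phi> \<in> forms"
  proof -
    obtain m where "form (u m) - \<phi> \<in> forms" using tail[of 1] by auto
    then have "form (u m) - (form (u m) - \<phi>) \<in> forms"
      by (rule forms_subspace(2)[OF form_in[OF uS]])
    moreover have "form (u m) - (form (u m) - \<phi>) = \<phi>"
      by (rule trans[OF diff_diff_eq2 add_diff_cancel_left'])
    ultimately show ?thesis by (simp only:)
  qed
  moreover have "(\<lambda>n. sb (form (u n) - \<phi>)) \<longlonglongrightarrow> 0"
  proof (rule LIMSEQ_I)
    fix r :: real assume r: "0 < r"
    obtain M where M: "\<forall>m\<ge>M. form (u m) - \<phi> \<in> forms \<and> sb (form (u m) - \<phi>) \<le> r / 2"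
      using tail[of "r / 2"] r by auto
    have "norm (sb (form (u m) - \<phi>) - 0) < r" if "m \<ge> M" for m
    proof -
      have "form (u m) - \<phi> \<in> forms" "sb (form (u m) - \<phi>) \<le> r / 2" using M that by auto
      then show ?thesis using sb_nonneg[of "form (u m) - \<phi>"] r by simp
    qed
    then show "\<exists>no. \<forall>n\<ge>no. norm (sb (form (u n) - \<phi>) - 0) < r" by blast
  qed
  ultimately show ?thesis by (auto simp: represents_def)
qed

lemma sb_tendsto_zeroI:
  assumes "\<And>n. \<phi> n \<in> forms" "\<And>n. sb (\<phi> n) \<le> a n" "a \<longlonglongrightarrow> 0"
  shows "(\<lambda>n. sb (\<phi> n)) \<longlonglongrightarrow> 0"
  using assms sb_nonneg by (intro tendsto_sandwich[OF _ _ tendsto_const assms(3)]) auto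

lemma represents_unique:
  assumes uS: "\<And>n. u n \<in> tensors" and \<phi>: "represents u \<phi>" and \<psi>: "represents u \<psi>"
  shows "\<phi> = \<psi>"
proof (rule eq_if_sb_diff_zero)
  show "\<phi> \<in> forms" "\<psi> \<in> forms" using \<phi> \<psi> by (simp_all add: represents_def)
  then have "sb (\<phi> - \<psi>) \<le> sb (form (u n) - \<phi>) + sb (form (u n) - \<psi>)" for n
    using sb_triangle[of \<phi> "form (u n)" \<psi>] sb_commute[of \<phi> "form (u n)"] uS by simp
  moreover have "(\<lambda>n. sb (form (u n) - \<phi>) + sb (form (u n) - \<psi>)) \<longlonglongrightarrow> 0 + 0"
    using \<phi> \<psi> by (intro tendsto_add) (simp_all add: represents_def)
  ultimately show "sb (\<phi> - \<psi>) \<le> 0"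
    by (intro tendsto_lowerbound[of "\<lambda>n. sb (form (u n) - \<phi>) + sb (form (u n) - \<psi>)"]) auto
qed

lemma represents_norm:
  assumes uS: "\<And>n. u n \<in> tensors" and \<phi>: "represents u \<phi>"
  shows "(\<lambda>n. tnorm (u n)) \<longlonglongrightarrow> sb \<phi>"
proof -
  have "(\<lambda>n. sb (form (u n)) - sb \<phi>) \<longlonglongrightarrow> 0"
  proof (rule Lim_null_comparison)
    show "(\<lambda>n. sb (form (u n) - \<phi>)) \<longlonglongrightarrow> 0" using \<phi> by (simp add: represents_def)
    show "\<forall>\<^sub>F n in sequentially. norm (sb (form (u n)) - sb \<phi>) \<le> sb (form (u n) - \<phi>)"
      using \<phi> uS by (intro always_eventually allI) (simp add: sb_reverse_triangle represents_def)
  qed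
  then show ?thesis
    using uS by (simp add: tnorm_eq LIM_zero_iff)
qed

lemma represents_add:
  assumes u: "\<And>n. u n \<in> tensors" "represents u \<phi>" and w: "\<And>n. w n \<in> tensors" "represents w \<psi>"
  shows "represents (u + w) (\<phi> + \<psi>)"
  unfolding represents_def
proof
  have \<phi>\<psi>: "\<phi> \<in> forms" "\<psi> \<in> forms" using assms by (simp_all add: represents_def)
  then show "\<phi> + \<psi> \<in> forms" by (rule forms_subspace)
  have eq: "form ((u + w) n) - (\<phi> + \<psi>) = (form (u n) - \<phi>) + (form (w n) - \<psi>)" for n
    unfolding plus_fun_apply[of u w] tensor_form_add by (simp only: add_diff_add)
  show "(\<lambda>n. sb (form ((u + w) n) - (\<phi> + \<psi>))) \<longlonglongrightarrow> 0"
    unfolding eq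
  proof (rule sb_tendsto_zeroI)
    show "form (u n) - \<phi> + (form (w n) - \<psi>) \<in> forms" for n
      by (intro forms_subspace form_in u(1) w(1) \<phi>\<psi>)
    show "sb (form (u n) - \<phi> + (form (w n) - \<psi>)) \<le> sb (form (u n) - \<phi>) + sb (form (w n) - \<psi>)" for n
      by (intro sb_add_le forms_subspace form_in u(1) w(1) \<phi>\<psi>)
    show "(\<lambda>n. sb (form (u n) - \<phi>) + sb (form (w n) - \<psi>)) \<longlonglongrightarrow> 0"
      using tendsto_add[of "\<lambda>n. sb (form (u n) - \<phi>)" 0 sequentially "\<lambda>n. sb (form (w n) - \<psi>)" 0] u(2) w(2)
      by (simp add: represents_def)
  qed
qed

lemma represents_scale:
  assumes u: "\<And>n. u n \<in> tensors" "represents u \<phi>"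
  shows "represents (c *\<^sub>C u) (c *\<^sub>C \<phi>)"
  unfolding represents_def
proof
  have \<phi>: "\<phi> \<in> forms" using assms by (simp add: represents_def)
  then show "c *\<^sub>C \<phi> \<in> forms" by (rule forms_subspace)
  have eq: "form ((c *\<^sub>C u) n) - c *\<^sub>C \<phi> = c *\<^sub>C (form (u n) - \<phi>)" for n
    unfolding scaleC_fun_def[of c u] tensor_form_scale complex_vector.scale_right_diff_distrib ..
  show "(\<lambda>n. sb (form ((c *\<^sub>C u) n) - c *\<^sub>C \<phi>)) \<longlonglongrightarrow> 0"
    unfolding eq
  proof (rule sb_tendsto_zeroI)
    show "c *\<^sub>C (form (u n) - \<phi>) \<in> forms" for n
      by (intro forms_subspace form_in u(1) \<phi>)
    show "sb (c *\<^sub>C (form (u n) - \<phi>)) \<le> cmod c * sb (form (u n) - \<phi>)" for n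
      by (intro sb_scale_le forms_subspace form_in u(1) \<phi>)
    show "(\<lambda>n. cmod c * sb (form (u n) - \<phi>)) \<longlonglongrightarrow> 0"
      using tendsto_mult_right_zero[of "\<lambda>n. sb (form (u n) - \<phi>)" sequentially "cmod c"] u(2)
      by (simp add: represents_def)
  qed
qed

lemma cauchy_if_represents:
  assumes u: "\<And>n. u n \<in> tensors" "represents u \<phi>"
  shows "u \<in> cauchy"
  unfolding Cauchy_seqs_def
proof (intro CollectI conjI allI impI)
  show "range u \<subseteq> tensors" using u(1) by auto
  fix \<epsilon> :: real assume "0 < \<epsilon>"
  then obtain M where M: "\<forall>n\<ge>M. norm (sb (form (u n) - \<phi>) - 0) < \<epsilon> / 2"
    using u(2) LIMSEQ_D[of "\<lambda>n. sb (form (u n) - \<phi>)" 0 "\<epsilon> / 2"] by (auto simp: represents_def)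
  have "tnorm (u m - u n) < \<epsilon>" if "m \<ge> M" "n \<ge> M" for m n
  proof -
    have "sb (form (u m) - form (u n)) \<le> sb (form (u m) - \<phi>) + sb (form (u n) - \<phi>)"
      using sb_triangle[of "form (u m)" \<phi> "form (u n)"] sb_commute[of \<phi> "form (u n)"] u
      by (simp add: represents_def)
    moreover have "sb (form (u m) - \<phi>) < \<epsilon> / 2" "sb (form (u n) - \<phi>) < \<epsilon> / 2"
      using M that by auto
    ultimately show ?thesis by (simp add: tnorm_diff u(1))
  qed
  then show "\<exists>M. \<forall>m\<ge>M. \<forall>n\<ge>M. tnorm (u m - u n) < \<epsilon>" by blast
qed

lemma represents_const: "t \<in> tensors \<Longrightarrow> represents (\<lambda>_. t) (form t)"
  by (simp add: represents_def sb_zero)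

lemma represents_class:
  assumes u: "\<And>n. u n \<in> tensors" "represents u \<phi>" and w: "w \<in> cls u"
  shows "represents w \<phi>"
proof -
  have wS: "w n \<in> tensors" for n
    using w by (auto simp: seq_class_def Cauchy_seqs_def)
  have \<phi>: "\<phi> \<in> forms" using u(2) by (simp add: represents_def)
  have "(\<lambda>n. sb (form (w n) - \<phi>)) \<longlonglongrightarrow> 0"
  proof (rule sb_tendsto_zeroI)
    show "form (w n) - \<phi> \<in> forms" for n by (intro forms_subspace form_in wS \<phi>)
    show "sb (form (w n) - \<phi>) \<le> tnorm (w n - u n) + sb (form (u n) - \<phi>)" for n
      using sb_triangle[of "form (w n)" "form (u n)" \<phi>] \<phi> wS u(1) by (simp add: tnorm_diff)
    show "(\<lambda>n. tnorm (w n - u n) + sb (form (u n) - \<phi>)) \<longlonglongrightarrow> 0"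
      using tendsto_add[of "\<lambda>n. tnorm (w n - u n)" 0 sequentially "\<lambda>n. sb (form (u n) - \<phi>)" 0] u(2) w
      by (simp add: represents_def seq_class_def)
  qed
  then show ?thesis using \<phi> by (simp add: represents_def)
qed

lemma in_own_class: "u \<in> cauchy \<Longrightarrow> u \<in> cls u"
  by (simp add: seq_class_def tnorm_eq tensors_subspace tensor_form_zero sb_zero)

definition embedding :: "(nat \<Rightarrow> (('h \<Rightarrow>\<^sub>L 'h) \<Rightarrow> complex, ('k \<Rightarrow>\<^sub>L 'k) \<Rightarrow> complex) tensor) set
    \<Rightarrow> ('h \<Rightarrow>\<^sub>L 'h) \<Rightarrow> ('k \<Rightarrow>\<^sub>L 'k) \<Rightarrow> complex"
  where "embedding A = (if A \<in> completion tensors tnorm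
    then THE \<phi>. \<exists>u\<in>cauchy. A = cls u \<and> represents u \<phi> else 0)"

lemma embedding_class:
  assumes u: "\<And>n. u n \<in> tensors" "represents u \<phi>"
  shows "embedding (cls u) = \<phi>"
proof -
  have uC: "u \<in> cauchy" by (rule cauchy_if_represents[OF u])
  have "(THE \<phi>. \<exists>w\<in>cauchy. cls u = cls w \<and> represents w \<phi>) = \<phi>"
  proof (rule the_equality)
    show "\<exists>w\<in>cauchy. cls u = cls w \<and> represents w \<phi>" using uC u(2) by blast
    fix \<psi> assume "\<exists>w\<in>cauchy. cls u = cls w \<and> represents w \<psi>"
    then obtain w where w: "w \<in> cauchy" "cls u = cls w" "represents w \<psi>" by blast
    then have "w \<in> cls u" using in_own_class by simp
    then have "represents w \<phi>" by (rule represents_class[OF u])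
    then show "\<psi> = \<phi>" using w by (intro represents_unique[of w] cauchyD(1))
  qed
  then show ?thesis using uC by (simp add: embedding_def completion_def)
qed

lemma comp_norm_class:
  assumes u: "\<And>n. u n \<in> tensors" "represents u \<phi>"
  shows "comp_norm tnorm (cls u) = sb \<phi>"
  unfolding comp_norm_def
proof (rule the_equality)
  have uC: "u \<in> cauchy" by (rule cauchy_if_represents[OF u])
  show "\<forall>w\<in>cls u. (\<lambda>n. tnorm (w n)) \<longlonglongrightarrow> sb \<phi>"
  proof
    fix w assume w: "w \<in> cls u"
    then have "w \<in> cauchy" by (simp add: seq_class_def)
    then show "(\<lambda>n. tnorm (w n)) \<longlonglongrightarrow> sb \<phi>"
      by (intro represents_norm cauchyD(1) represents_class[OF u w])
  qed
  fix r assume "\<forall>w\<in>cls u. (\<lambda>n. tnorm (w n)) \<longlonglongrightarrow> r"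
  then have "(\<lambda>n. tnorm (u n)) \<longlonglongrightarrow> r" using in_own_class[OF uC] by blast
  then show "r = sb \<phi>" using represents_norm[OF u] by (rule LIMSEQ_unique)
qed

lemma completion_cases:
  assumes "A \<in> completion tensors tnorm"
  obtains u \<phi> where "u \<in> cauchy" "\<And>n. u n \<in> tensors" "represents u \<phi>" "A = cls u"
proof -
  obtain u where u: "u \<in> cauchy" "A = cls u" using assms by (auto simp: completion_def)
  obtain \<phi> where "represents u \<phi>" using ex_represents[OF u(1)] by blast
  then show thesis using that[OF u(1) cauchyD(1)[OF u(1)] _ u(2)] by blast
qed

lemma embedding_isometric:
  assumes "A \<in> s'_tensor (dual (opspace X)) (dual (opspace Y))"
  shows "sb (embedding A) = s'_tensor_norm (dual (opspace X)) (dual (opspace Y)) A"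
proof -
  have "A \<in> completion tensors tnorm" using assms by (simp add: s'_tensor_def)
  then show ?thesis
    by (rule completion_cases) (simp add: s'_tensor_norm_def embedding_class comp_norm_class)
qed

lemma elem_tensor_in: "f \<in> points (dual (opspace X)) \<Longrightarrow> g \<in> points (dual (opspace Y)) \<Longrightarrow>
    elem_tensor (dual (opspace X)) (dual (opspace Y)) f g \<in> tensors"
  unfolding tensor_product_def by (rule complex_vector.span_base) blast

lemma natural_embedding_embedding: "natural_embedding (opspace X) (opspace Y) embedding"
  unfolding natural_embedding_def
proof (intro conjI ballI allI impI)
  fix A assume "A \<in> s'_tensor (dual (opspace X)) (dual (opspace Y))"
  then have "A \<in> completion tensors tnorm" by (simp add: s'_tensor_def)
  then show "embedding A \<in> forms"
    by (rule completion_cases) (simp add: embedding_class represents_def)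
next
  fix A assume "A \<notin> s'_tensor (dual (opspace X)) (dual (opspace Y))"
  then show "embedding A = 0" by (simp add: s'_tensor_def embedding_def)
next
  show "comp_linear tensors tnorm embedding"
    unfolding comp_linear_def clinear_on_def
  proof (intro conjI ballI allI)
    fix u w assume u: "u \<in> cauchy" and w: "w \<in> cauchy"
    obtain \<phi> \<psi> where "represents u \<phi>" "represents w \<psi>" using ex_represents u w by blast
    moreover note cauchyD(1)[OF u] cauchyD(1)[OF w]
    moreover have "(u + w) n \<in> tensors" for n
      unfolding plus_fun_apply[of u w] by (intro tensors_subspace cauchyD(1)[OF u] cauchyD(1)[OF w])
    ultimately show "embedding (cls (u + w)) = embedding (cls u) + embedding (cls w)"
      by (simp only: embedding_class[OF _ represents_add] embedding_class)
  next
    fix a u assume u: "u \<in> cauchy"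
    obtain \<phi> where "represents u \<phi>" using ex_represents u by blast
    moreover note cauchyD(1)[OF u]
    moreover have "(a *\<^sub>C u) n \<in> tensors" for n
      unfolding scaleC_fun_def[of a u] by (intro tensors_subspace cauchyD(1)[OF u])
    ultimately show "embedding (cls (a *\<^sub>C u)) = a *\<^sub>C embedding (cls u)"
      by (simp only: embedding_class[OF _ represents_scale] embedding_class)
  qed
next
  show "\<exists>C. \<forall>A\<in>s'_tensor (dual (opspace X)) (dual (opspace Y)).
      sb (embedding A) \<le> C * s'_tensor_norm (dual (opspace X)) (dual (opspace Y)) A"
    by (intro exI[of _ 1]) (simp add: embedding_isometric)
next
  fix f g x y assume "f \<in> points (dual (opspace X))" "g \<in> points (dual (opspace Y))"
  then show "embedding (s'_elem_tensor (dual (opspace X)) (dual (opspace Y)) f g) x y = f x * g y"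
    unfolding s'_elem_tensor_def comp_embed_def
    by (subst embedding_class[OF _ represents_const]) (auto simp: elem_tensor_in tensor_form_elem_tensor)
qed

text \<open>Linearity and the values on elementary tensors fix a natural embedding on the algebraic tensor
  product, and boundedness carries this over to the completion.\<close>

lemma natural_embedding_unique:
  assumes "natural_embedding (opspace X) (opspace Y) \<psi>"
  shows "\<psi> = embedding"
proof
  have mem: "\<psi> A \<in> forms" if "A \<in> completion tensors tnorm" for A
    using assms that by (simp add: natural_embedding_def s'_tensor_def)
  have outside: "\<psi> A = 0" if "A \<notin> completion tensors tnorm" for A
    using assms that by (simp add: natural_embedding_def s'_tensor_def)
  have "comp_linear tensors tnorm \<psi>"
    using assms by (simp add: natural_embedding_def)
  then have add: "\<psi> (cls (u + w)) = \<psi> (cls u) + \<psi> (cls w)"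
    and scale: "\<psi> (cls (a *\<^sub>C u)) = a *\<^sub>C \<psi> (cls u)"
    if "u \<in> cauchy" "w \<in> cauchy" for u w a
    using that by (auto simp: comp_linear_def clinear_on_def)
  obtain C where C: "\<And>A. A \<in> completion tensors tnorm \<Longrightarrow> sb (\<psi> A) \<le> C * comp_norm tnorm A"
    using assms unfolding natural_embedding_def s'_tensor_def s'_tensor_norm_def by blast
  have elem: "\<psi> (cls (\<lambda>_. elem_tensor (dual (opspace X)) (dual (opspace Y)) f g)) x y = f x * g y"
    if "f \<in> points (dual (opspace X))" "g \<in> points (dual (opspace Y))" "x \<in> X" "y \<in> Y" for f g x y
    using assms that unfolding natural_embedding_def s'_elem_tensor_def comp_embed_def by simp
  have const: "(\<lambda>_. t) \<in> cauchy" if "t \<in> tensors" for t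
    using that by (intro cauchy_if_represents[OF _ represents_const])
  have cls_mem: "cls u \<in> completion tensors tnorm" if "u \<in> cauchy" for u
    using that by (simp add: completion_def)
  have on_tensors: "\<psi> (cls (\<lambda>_. t)) = form t" if "t \<in> tensors" for t
    using that[unfolded tensor_product_def]
  proof (induction rule: cspan_induct)
    case zero
    have "\<psi> (cls (0 *\<^sub>C (\<lambda>_. 0))) = 0 *\<^sub>C \<psi> (cls (\<lambda>_. 0))"
      by (intro scale[where w = "\<lambda>_. 0"] const tensors_subspace)
    then show ?case unfolding tensor_form_zero by (simp add: zero_fun_def)
  next
    case (step c b t)
    then obtain f g where b: "b = elem_tensor (dual (opspace X)) (dual (opspace Y)) f g"
      and fg: "f \<in> points (dual (opspace X))" "g \<in> points (dual (opspace Y))" by auto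
    have bS: "b \<in> tensors" unfolding b by (rule elem_tensor_in[OF fg])
    have tS: "t \<in> tensors" using step(2) by (simp add: tensor_product_def)
    have "\<psi> (cls (\<lambda>_. b)) = form b"
    proof (intro ext)
      fix x y
      show "\<psi> (cls (\<lambda>_. b)) x y = form b x y"
      proof (cases "x \<in> X \<and> y \<in> Y")
        case True
        then show ?thesis unfolding b tensor_form_elem_tensor[OF fg] using elem[OF fg] by blast
      next
        case False
        then show ?thesis
          using mem[OF cls_mem[OF const[OF bS]]] form_in[OF bS] by (auto simp: SB_def)
      qed
    qed
    moreover have "(\<lambda>_::nat. c *\<^sub>C b + t) = c *\<^sub>C (\<lambda>_. b) + (\<lambda>_. t)"
      by (simp add: fun_eq_iff scaleC_fun_def)
    moreover have "c *\<^sub>C (\<lambda>_::nat. b) \<in> cauchy"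
      using const[OF tensors_subspace(3)[OF bS, of c]] by (simp only: scaleC_fun_def)
    moreover have "\<psi> (cls (\<lambda>_. t)) = form t" by (rule step(3))
    ultimately show ?case
      by (simp only: add const[OF tS] scale[OF const[OF bS] const[OF bS]] tensor_form_add tensor_form_scale)
  qed
  fix A
  show "\<psi> A = embedding A"
  proof (cases "A \<in> completion tensors tnorm")
    case False
    then show ?thesis using outside by (simp add: embedding_def)
  next
    case True
    then obtain u \<phi> where u: "u \<in> cauchy" "\<And>n. u n \<in> tensors" "represents u \<phi>" and A: "A = cls u"
      by (rule completion_cases) blast
    have \<phi>: "\<phi> \<in> forms" using u(3) by (simp add: represents_def)
    have \<psi>A: "\<psi> A \<in> forms" by (rule mem[OF True])
    have le: "sb (\<psi> A - form (u m)) \<le> C * sb (\<phi> - form (u m))" for m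
    proof -
      define d where "d = u + (- 1) *\<^sub>C (\<lambda>_. u m)"
      have r: "represents ((- 1) *\<^sub>C (\<lambda>_. u m)) ((- 1) *\<^sub>C form (u m))"
        by (intro represents_scale represents_const u(2))
      have c: "((- 1) *\<^sub>C (\<lambda>_::nat. u m)) n \<in> tensors" for n
        unfolding scaleC_fun_def[of "- 1" "\<lambda>_. u m"] by (intro tensors_subspace u(2))
      have dS: "d n \<in> tensors" for n
        unfolding d_def plus_fun_apply[of u] by (intro tensors_subspace(1) u(2) c)
      have d: "represents d (\<phi> + (- 1) *\<^sub>C form (u m))"
        unfolding d_def by (rule represents_add[OF u(2,3) c r])
      have "\<psi> (cls d) = \<psi> A + (- 1) *\<^sub>C form (u m)"
        unfolding d_def A
        using add[OF u(1) cauchy_if_represents[OF c r]] scale[OF const[OF u(2)] u(1), of "- 1" m] on_tensors[OF u(2)]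
        by simp
      moreover have "sb (\<psi> (cls d)) \<le> C * sb (\<phi> + (- 1) *\<^sub>C form (u m))"
        using C[OF cls_mem[OF cauchy_if_represents[OF dS d]]] unfolding comp_norm_class[OF dS d] .
      ultimately show ?thesis by simp
    qed
    have "represents u (\<psi> A)"
      unfolding represents_def
    proof (intro conjI \<psi>A sb_tendsto_zeroI)
      show "form (u n) - \<psi> A \<in> forms" for n by (intro forms_subspace form_in u(2) \<psi>A)
      show "sb (form (u n) - \<psi> A) \<le> C * sb (form (u n) - \<phi>)" for n
        using le[of n] sb_commute[OF \<psi>A form_in[OF u(2)]] sb_commute[OF \<phi> form_in[OF u(2)]] by simp
      show "(\<lambda>n. C * sb (form (u n) - \<phi>)) \<longlonglongrightarrow> 0"
        using u(3) by (intro tendsto_mult_right_zero) (simp add: represents_def)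
    qed
    then show ?thesis
      unfolding A using embedding_class[OF u(2)] by (simp add: A)
  qed
qed

end

theorem proposition2p15:
  fixes X :: "('h::complex_hilbert \<Rightarrow>\<^sub>L 'h) set"
    and Y :: "('k::complex_hilbert \<Rightarrow>\<^sub>L 'k) set"
  assumes "operator_space X" and "operator_space Y"
  shows "(\<exists>!\<psi>. natural_embedding (opspace X) (opspace Y) \<psi>) \<and>
    (\<forall>\<psi>. natural_embedding (opspace X) (opspace Y) \<psi> \<longrightarrow>
      (\<forall>A \<in> s'_tensor (dual (opspace X)) (dual (opspace Y)).
        sb_norm (opspace X) (opspace Y) (\<psi> A) =
          s'_tensor_norm (dual (opspace X)) (dual (opspace Y)) A))"
proof -
  interpret operator_space_pair X Y
    by (simp add: operator_space_pair_def assms)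
  show ?thesis
    using natural_embedding_embedding natural_embedding_unique embedding_isometric by blast
qed

end
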